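(* Let $\Omega\subset\mathbb{R}^d$ ($d\ge1$) be a bounded open domain. Let $a\in L^\infty(\Omega)$ satisfy $a\ge\underline{a}$ almost everywhere in $\Omega$ for some constant $\underline{a}>0$, and assume that there exist $q\in[2,+\infty]$, $\alpha\in(0,1]$ with $\alpha q>d$, and $g\in L^q(\Omega)$ such that $|a(x)-a(y)|\le g(x)|x-y|^\alpha$ for a.e. $(x,y)\in\Omega^2$. Let $u\in H^1(\Omega)$ be a weak solution of $-\operatorname{div}(a\nabla u)=\operatorname{div}F$ in $\Omega$, and let $\Omega'\Subset\Omega$ be a $\theta$-smooth subdomain (for some $\theta>0$). Then $$F\in W^{\alpha,q}(\Omega)\quad\Longrightarrow\quad\nabla u\in W^{\alpha',q}(\Omega')\quad\text{for all }0\le\alpha'<\alpha.$$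
   Context: $\Omega'\Subset\Omega$ means that $\Omega'\subset\Omega$ is an open subdomain with $\operatorname{dist}(\Omega',\partial\Omega)>0$. A bounded open set $D\subset\mathbb{R}^d$ is $\theta$-smooth if $|B(x,r)\cap D|\ge\theta v_d r^d$ for all $x\in D$ and all $r\in(0,\operatorname{diam}D)$, where $v_d$ is the volume of the unit ball of $\mathbb{R}^d$. Weak solution: $F$ is a square-integrable vector field on $\Omega$ and $\int_\Omega a\nabla u\cdot\nabla\varphi=-\int_\Omega F\cdot\nabla\varphi$ for all $\varphi\in C_c^\infty(\Omega)$. For $s\in(0,1)$, $W^{s,q}(D)$ is the fractional Sobolev (Sobolev–Slobodeckij) space of $v\in L^q(D)$ with $(x,y)\mapsto |v(x)-v(y)|/|x-y|^{s+d/q}$ in $L^q(D^2)$ (with $d/\infty=0$); $W^{0,q}=L^q$ and $W^{1,q}$ is the usual Sobolev space. *)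

theory Defs
  imports "HOL-Analysis.Analysis"
begin

subsection \<open>Test functions\<close>

abbreviation partial_deriv :: "'a \<Rightarrow> ('a::euclidean_space \<Rightarrow> real) \<Rightarrow> 'a \<Rightarrow> real"
  where "partial_deriv b f \<equiv> (\<lambda>x. frechet_derivative f (at x) b)"

definition gradient :: "('a::euclidean_space \<Rightarrow> real) \<Rightarrow> 'a \<Rightarrow> 'a"
  where "gradient f x = (\<Sum>b\<in>Basis. partial_deriv b f x *\<^sub>R b)"

primrec C_k :: "nat \<Rightarrow> ('a::euclidean_space \<Rightarrow> real) \<Rightarrow> bool"
  where
    "C_k 0 f \<longleftrightarrow> continuous_on UNIV f"
  | "C_k (Suc k) f \<longleftrightarrow>
       (\<forall>x. f differentiable (at x)) \<and> (\<forall>b\<in>Basis. C_k k (partial_deriv b f))"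

text \<open>The space \<open>C_c^\<infinity>(D)\<close>; its elements are extended by zero to the whole space.\<close>

definition test_functions :: "'a::euclidean_space set \<Rightarrow> ('a \<Rightarrow> real) set"
  where "test_functions D =
    {\<phi>. (\<forall>k. C_k k \<phi>) \<and> compact (closure {x. \<phi> x \<noteq> 0}) \<and> closure {x. \<phi> x \<noteq> 0} \<subseteq> D}"

subsection \<open>Lebesgue and Sobolev spaces\<close>

text \<open>Functions rather than classes modulo equality almost everywhere are used throughout, and only
  the values on the underlying set matter. The exponent is meant to satisfy \<open>1 \<le> q \<le> \<infinity>\<close>.\<close>

definition Lq :: "ennreal \<Rightarrow> 'c measure \<Rightarrow> ('c \<Rightarrow> 'b::euclidean_space) set"
  where "Lq q M =
    {f \<in> borel_measurable M.
      if q = \<infinity> then \<exists>C. AE x in M. norm (f x) \<le> C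
      else integrable M (\<lambda>x. norm (f x) powr enn2real q)}"

definition locally_integrable :: "'a::euclidean_space set \<Rightarrow> ('a \<Rightarrow> 'b::euclidean_space) \<Rightarrow> bool"
  where "locally_integrable D v \<longleftrightarrow>
    (\<forall>K. compact K \<and> K \<subseteq> D \<longrightarrow> v absolutely_integrable_on K)"

definition weak_partial ::
    "'a::euclidean_space set \<Rightarrow> 'a \<Rightarrow> ('a \<Rightarrow> 'b::euclidean_space) \<Rightarrow> ('a \<Rightarrow> 'b) \<Rightarrow> bool"
  where "weak_partial D b v w \<longleftrightarrow>
    locally_integrable D v \<and> locally_integrable D w \<and>
    (\<forall>\<phi>\<in>test_functions D.
      (LINT x|lebesgue_on D. partial_deriv b \<phi> x *\<^sub>R v x) =
      - (LINT x|lebesgue_on D. \<phi> x *\<^sub>R w x))"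

text \<open>\<open>weak_gradient D u G\<close> says that \<open>G\<close> is a representative of \<open>\<nabla>u\<close> on \<open>D\<close>.\<close>

definition weak_gradient :: "'a::euclidean_space set \<Rightarrow> ('a \<Rightarrow> real) \<Rightarrow> ('a \<Rightarrow> 'a) \<Rightarrow> bool"
  where "weak_gradient D u G \<longleftrightarrow> (\<forall>b\<in>Basis. weak_partial D b u (\<lambda>x. G x \<bullet> b))"

definition sobolev1 :: "ennreal \<Rightarrow> 'a::euclidean_space set \<Rightarrow> ('a \<Rightarrow> 'b::euclidean_space) set"
  where "sobolev1 q D =
    {v \<in> Lq q (lebesgue_on D). \<forall>b\<in>Basis. \<exists>w\<in>Lq q (lebesgue_on D). weak_partial D b v w}"

abbreviation H1 :: "'a::euclidean_space set \<Rightarrow> ('a \<Rightarrow> real) set"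
  where "H1 D \<equiv> sobolev1 2 D"

definition sobolev_slobodeckij ::
    "real \<Rightarrow> ennreal \<Rightarrow> 'a::euclidean_space set \<Rightarrow> ('a \<Rightarrow> 'b::euclidean_space) set"
  where "sobolev_slobodeckij s q D =
    {v \<in> Lq q (lebesgue_on D).
      (\<lambda>(x, y). norm (v x - v y) /
          norm (x - y) powr (s + (if q = \<infinity> then 0 else real DIM('a) / enn2real q)))
        \<in> Lq q (lebesgue_on D \<Otimes>\<^sub>M lebesgue_on D)}"

text \<open>The space \<open>W^{s,q}(D)\<close>, for \<open>0 \<le> s \<le> 1\<close> only.\<close>

definition W :: "real \<Rightarrow> ennreal \<Rightarrow> 'a::euclidean_space set \<Rightarrow> ('a \<Rightarrow> 'b::euclidean_space) set"
  where "W s q D =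
    (if s = 0 then Lq q (lebesgue_on D)
     else if s = 1 then sobolev1 q D
     else sobolev_slobodeckij s q D)"

subsection \<open>Domains\<close>

text \<open>The distance to an empty set is 0 for \<^const>\<open>setdist\<close>, so an empty \<open>D'\<close> is excluded here.\<close>

definition compactly_inside :: "'a::euclidean_space set \<Rightarrow> 'a set \<Rightarrow> bool"  (infix "\<Subset>" 50)
  where "D' \<Subset> D \<longleftrightarrow> open D' \<and> D' \<subseteq> D \<and> setdist D' (frontier D) > 0"

definition theta_smooth :: "real \<Rightarrow> 'a::euclidean_space set \<Rightarrow> bool"
  where "theta_smooth \<theta> D \<longleftrightarrow>
    bounded D \<and> open D \<and>
    (\<forall>x\<in>D. \<forall>r. 0 < r \<and> r < diameter D \<longrightarrow>
      measure lebesgue (ball x r \<inter> D) \<ge> \<theta> * measure lebesgue (ball (0::'a) 1) * r ^ DIM('a))"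

subsection \<open>Weak solutions\<close>

text \<open>The function \<open>u\<close>, with weak gradient \<open>Du\<close>, solves \<open>- div (a \<nabla>u) = div F\<close> weakly in \<open>D\<close>.
  Weak gradients are unique up to null sets, so the choice of \<open>Du\<close> is immaterial.\<close>

definition weak_solution ::
    "'a::euclidean_space set \<Rightarrow> ('a \<Rightarrow> real) \<Rightarrow> ('a \<Rightarrow> 'a) \<Rightarrow> ('a \<Rightarrow> real) \<Rightarrow> ('a \<Rightarrow> 'a) \<Rightarrow> bool"
  where "weak_solution D a F u Du \<longleftrightarrow>
    weak_gradient D u Du \<and> F \<in> Lq 2 (lebesgue_on D) \<and>
    (\<forall>\<phi>\<in>test_functions D.
      (LINT x|lebesgue_on D. a x * (Du x \<bullet> gradient \<phi> x)) =
      - (LINT x|lebesgue_on D. F x \<bullet> gradient \<phi> x))"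

end

theory Submission
  imports Defs
begin

text \<open>
  The idea is to measure how an average of a component of \<open>\<nabla>u\<close> changes with the scale, and to see that
  the equation converts this change into the mean oscillation of \<open>a\<close> and \<open>F\<close>.

  Let \<open>n\<close> be the dimension, \<open>\<psi>\<close> a radial bump function (\<open>ker\<close>) and
  \<open>V\<^sub>t(x) = t\<^sup>-\<^sup>n \<integral> v(z) \<psi>((z - x)/t) dz\<close>. Then
  \<open>d/dt V\<^sub>t(x) = - t\<^sup>-\<^sup>n\<^sup>-\<^sup>1 \<integral> v(z) L((z - x)/t) dz\<close>, where \<open>L\<close> (\<open>lker\<close>) is the divergence of the field
  \<open>z \<psi>(z)\<close> (\<open>cint_derivative\<close>). That field has the components \<open>p\<^sub>i(z) = z\<^sub>i \<psi>(z)\<close> (\<open>prof\<close>). For \<open>v = \<partial>\<^sub>iu\<close>, the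
  fact that a gradient is curl free allows to replace \<open>\<integral> \<partial>\<^sub>iu L\<close> by \<open>\<integral> \<nabla>u \<cdot> \<nabla>p\<^sub>i\<close>, and \<open>p\<^sub>i\<close> is a legitimate test
  function in the equation. Since gradients of test functions do not see constants, for every
  number \<open>c\<close> and every vector \<open>f\<close>
  \<open>c \<integral> \<partial>\<^sub>iu L = - \<integral> [(a - c) \<nabla>u + (F - f)] \<cdot> \<nabla>p\<^sub>i\<close>, the kernels being rescaled to any small ball
  (\<open>frozen_identity\<close>).

  Integrating the derivative bound over the scales gives pointwise estimates (\<open>kernel_holder\<close>): at Lebesgue
  points \<open>x\<close>, \<open>y\<close> one passes from scale \<open>0\<close> to scale \<open>|x - y|\<close> separately, and from \<open>|x - y|\<close> to a fixed
  scale for the difference of the two averages, where the Lipschitz continuity of the kernel yields an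
  additional factor \<open>|x - y|/t\<close>. If the right-hand side of the frozen identity is of order
  \<open>t\<^sup>n\<^sup>+\<^sup>\<gamma>\<close> with \<open>0 < \<gamma> < 1\<close>, then \<open>|\<nabla>u(x) - \<nabla>u(y)|\<close> is of order \<open>|x - y|\<^sup>\<gamma>\<close>.

  The data enter as follows. Outside a null set every point \<open>w\<close> near the subdomain is \<open>pinned\<close>: with \<open>H = G\<^sup>1\<^sup>/\<^sup>r\<close>, where \<open>G\<close> is
  integrable, \<open>|a(z) - a(w)| \<le> H(w) |z - w|\<^sup>s\<close> and \<open>\<integral>|F - F(w)| \<le> H(w) \<rho>\<^sup>n\<^sup>+\<^sup>s\<close> over the ball of radius \<open>\<rho>\<close>
  around \<open>w\<close>. For \<open>a\<close> this is the hypothesis. For \<open>F\<close> of fractional smoothness it is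
  Hoelder's inequality on balls (\<open>slobodeckij_osc\<close>, \<open>uniform_osc\<close>). For \<open>F\<close> with weak derivatives in
  \<open>L\<^sup>r\<close> it follows, with an arbitrarily small loss in \<open>s\<close>, by the same integration over scales applied to
  the components of \<open>F\<close>, together with a bound for a fractional maximal function
  (\<open>weakly_differentiable_osc\<close>).

  As the frozen identity has \<open>\<nabla>u\<close> on its right-hand side, \<open>\<nabla>u\<close> has to be bounded first. Every ball of radius
  \<open>t\<close> contains a point \<open>w\<close> with \<open>H(w)\<close> of order \<open>t\<^sup>-\<^sup>n\<^sup>/\<^sup>r\<close>, so that all points become \<open>tame\<close> with the
  exponent \<open>\<beta> = s - n/r > 0\<close>; here \<open>\<alpha> q > d\<close> is used. For tame data an induction over dyadic scales
  absorbs \<open>\<nabla>u\<close> on the right (\<open>tame_bounded\<close>). Two estimates result (\<open>pinned_regularity\<close>). The first is Hoelder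
  continuity of \<open>\<nabla>u\<close> with exponent \<open>s - n/r\<close>; for \<open>q = \<infinity>\<close> this suffices because \<open>r\<close> is at our disposal. The
  second is the pointwise inequality
  \<open>|\<nabla>u(x) - \<nabla>u(y)| \<le> M (H(x) + H(y) + 1) |x - y|\<^sup>s\<close>; for \<open>q < \<infinity>\<close>, where \<open>r = q\<close>, its \<open>q\<close>-th power is integrated
  against \<open>|x - y|\<^sup>-\<^sup>n\<^sup>-\<^sup>\<alpha>\<^sup>'\<^sup>q\<close>, which is finite because \<open>\<alpha>' < s\<close> (\<open>hajlasz_slobodeckij\<close>).
\<close>

section \<open>Smooth bump functions\<close>

lemma C_k_SucI:
  assumes "\<And>x. (f has_derivative D x) (at x)" and "\<And>b. b \<in> Basis \<Longrightarrow> C_k k (\<lambda>x. D x b)"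
  shows "C_k (Suc k) f"
proof -
  have "frechet_derivative f (at x) = D x" for x
    using frechet_derivative_at[OF assms(1)] by simp
  then show ?thesis
    using assms by (auto simp: differentiable_def)
qed

lemma C_k_SucD:
  assumes "C_k (Suc k) f"
  shows "(f has_derivative frechet_derivative f (at x)) (at x)"
    and "b \<in> Basis \<Longrightarrow> C_k k (partial_deriv b f)"
  using assms frechet_derivative_works by auto

lemma C_k_lower: "C_k (Suc k) f \<Longrightarrow> C_k k f"
proof (induction k arbitrary: f)
  case 0
  then show ?case
    by (auto intro!: differentiable_imp_continuous_on simp: differentiable_on_def
      intro: differentiable_at_imp_differentiable_on)
next
  case (Suc k)
  then show ?case by (metis C_k.simps(2))
qed

lemma C_k_const: "C_k k (\<lambda>x. c)"
proof (induction k arbitrary: c)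
  case (Suc k)
  have "C_k (Suc k) (\<lambda>x::'a. c)"
    by (rule C_k_SucI[where D = "\<lambda>x h. 0"]) (auto intro: Suc)
  then show ?case .
qed simp

lemma C_k_add: "C_k k f \<Longrightarrow> C_k k g \<Longrightarrow> C_k k (\<lambda>x. f x + g x)"
proof (induction k arbitrary: f g)
  case 0
  then show ?case by (auto intro: continuous_intros)
next
  case (Suc k)
  show ?case
    by (rule C_k_SucI[OF has_derivative_add[OF C_k_SucD(1)[OF Suc.prems(1)] C_k_SucD(1)[OF Suc.prems(2)]]])
      (intro Suc.IH C_k_SucD(2)[OF Suc.prems(1)] C_k_SucD(2)[OF Suc.prems(2)])
qed

lemma C_k_mult: "C_k k f \<Longrightarrow> C_k k g \<Longrightarrow> C_k k (\<lambda>x. f x * g x)"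
proof (induction k arbitrary: f g)
  case 0
  then show ?case by (auto intro: continuous_intros)
next
  case (Suc k)
  show ?case
    by (rule C_k_SucI[OF has_derivative_mult[OF C_k_SucD(1)[OF Suc.prems(1)] C_k_SucD(1)[OF Suc.prems(2)]]])
      (intro C_k_add Suc.IH C_k_SucD(2)[OF Suc.prems(1)] C_k_SucD(2)[OF Suc.prems(2)]
        C_k_lower[OF Suc.prems(1)] C_k_lower[OF Suc.prems(2)])
qed

lemma C_k_inner: "C_k k (\<lambda>x. x \<bullet> e)"
proof (cases k)
  case (Suc j)
  have "C_k (Suc j) (\<lambda>x. x \<bullet> e)"
    by (rule C_k_SucI[where D = "\<lambda>x h. h \<bullet> e"]) (auto intro!: derivative_eq_intros C_k_const)
  then show ?thesis by (simp only: Suc)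
qed (auto intro: continuous_intros)

lemma C_k_norm_sq: "C_k k (\<lambda>x. x \<bullet> x)"
proof (cases k)
  case (Suc j)
  have "C_k (Suc j) (\<lambda>x::'a. x \<bullet> x)"
  proof (rule C_k_SucI[where D = "\<lambda>x h. x \<bullet> h + h \<bullet> x"])
    show "C_k j (\<lambda>x::'a. x \<bullet> b + b \<bullet> x)" for b
      by (subst inner_commute[of b]) (intro C_k_add C_k_inner)
  qed (auto intro!: derivative_eq_intros)
  then show ?thesis by (simp only: Suc)
qed (auto intro: continuous_intros)

lemma C_k_affine: "C_k k f \<Longrightarrow> C_k k (\<lambda>z. f ((z - x) /\<^sub>R t))"
proof (induction k arbitrary: f)
  case 0
  then have "continuous_on UNIV f" by simp
  then have "continuous_on UNIV (\<lambda>z. f ((z - x) /\<^sub>R t))"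
    by (rule continuous_on_compose2) (auto intro!: continuous_intros)
  then show ?case by simp
next
  case (Suc k)
  have d: "((\<lambda>z. f ((z - x) /\<^sub>R t)) has_derivative
      (\<lambda>h. frechet_derivative f (at ((z - x) /\<^sub>R t)) (h /\<^sub>R t))) (at z)" for z
    by (rule has_derivative_compose[where g = f, OF _ C_k_SucD(1)[OF Suc.prems]])
      (auto intro!: derivative_eq_intros)
  have e: "frechet_derivative f (at ((z - x) /\<^sub>R t)) (h /\<^sub>R t)
     = inverse t * frechet_derivative f (at ((z - x) /\<^sub>R t)) h" for z h
    using has_derivative_linear[OF C_k_SucD(1)[OF Suc.prems]] by (simp add: linear_cmul)
  show ?case
    by (rule C_k_SucI[OF d]) (unfold e, intro C_k_mult C_k_const Suc.IH C_k_SucD(2)[OF Suc.prems])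
qed

text \<open>The powers of \<open>1 / (1 - s)\<close> make the family closed under differentiation: the derivative of
  \<open>bump m\<close> is a combination of \<open>bump (m + 1)\<close> and \<open>bump (m + 2)\<close>. Smoothness of all members is then
  one induction on the order, with \<open>m\<close> generalised.\<close>

definition bump :: "nat \<Rightarrow> real \<Rightarrow> real"
  where "bump m s = (if s < 1 then (1 / (1 - s)) ^ m * exp (- (1 / (1 - s))) else 0)"

lemma bump_eq_0: "1 \<le> s \<Longrightarrow> bump m s = 0"
  by (simp add: bump_def)

lemma bump_nonneg: "0 \<le> bump m s"
  by (simp add: bump_def)

text \<open>The left-hand side times \<open>exp y\<close> is, up to the factorial, a single term of the exponential series.\<close>

lemma power_exp_le_fact:
  fixes y :: real
  assumes "0 \<le> y"
  shows "y ^ m * exp (- y) \<le> fact m"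
proof -
  have s: "(\<lambda>n. y ^ n /\<^sub>R fact n) sums exp y"
    by (rule exp_converges)
  have "(\<Sum>n\<in>{m}. y ^ n /\<^sub>R fact n) \<le> (\<Sum>n. y ^ n /\<^sub>R fact n)"
    using assms by (intro sum_le_suminf sums_summable[OF s]) auto
  then have "y ^ m / fact m \<le> exp y"
    using sums_unique[OF s] by (simp add: divide_inverse mult.commute)
  then show ?thesis
    by (simp add: exp_minus field_simps)
qed

lemma bump_le: "bump m s \<le> fact m"
  using power_exp_le_fact[of "1 / (1 - s)" m] by (simp add: bump_def)

text \<open>Because \<open>bump m s = bump (m + 2) s * (1 - s)\<^sup>2\<close>, the uniform bound for the family already gives
  vanishing of second order at the gluing point \<open>s = 1\<close>, hence differentiability there.\<close>

lemma bump_tail: "bump m s \<le> fact (m + 2) * (1 - s)\<^sup>2"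
proof (cases "s < 1")
  case True
  have "bump m s = bump (m + 2) s * (1 - s)\<^sup>2"
  proof -
    have "(1 / (1 - s)) ^ 2 * (1 - s)\<^sup>2 = 1"
      using True by (simp add: power_divide)
    then show ?thesis
      using True by (simp add: bump_def power_add divide_simps power2_eq_square)
  qed
  then show ?thesis
    using bump_le[of "m + 2" s] by (simp add: mult_right_mono)
qed (simp add: bump_def)

lemma DERIV_bump: "(bump m has_real_derivative (real m * bump (m + 1) s - bump (m + 2) s)) (at s)"
proof (cases "s = 1")
  case False
  consider "s < 1" | "1 < s" using False by linarith
  then show ?thesis
  proof cases
    case 1
    have "((\<lambda>s. (1 / (1 - s)) ^ m * exp (- (1 / (1 - s)))) has_real_derivative
       (real m * bump (m + 1) s - bump (m + 2) s)) (at s)"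
    proof -
      define z where "z = 1 / (1 - s)"
      have z: "((\<lambda>s. 1 / (1 - s)) has_real_derivative z\<^sup>2) (at s)"
        using 1 by (auto intro!: derivative_eq_intros simp: z_def power2_eq_square)
      have f: "((\<lambda>z. z ^ m * exp (- z)) has_real_derivative
          (real m * z ^ (m - 1) - z ^ m) * exp (- z)) (at (1 / (1 - s)))"
        unfolding z_def by (auto intro!: derivative_eq_intros simp: algebra_simps)
      have e: "(real m * z ^ (m - 1) - z ^ m) * exp (- z) * z\<^sup>2 = real m * bump (m + 1) s - bump (m + 2) s"
        using 1 by (cases m) (simp_all add: bump_def z_def[symmetric] power2_eq_square algebra_simps)
      show ?thesis
        using DERIV_chain2[OF f z] unfolding e .
    qed
    moreover have "\<forall>\<^sub>F x in nhds s. (1 / (1 - x)) ^ m * exp (- (1 / (1 - x))) = bump m x"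
      using eventually_nhds_in_open[of "{..<1}" s] 1 by (auto elim!: eventually_mono simp: bump_def)
    ultimately show ?thesis
      by (subst (asm) DERIV_cong_ev[OF refl _ refl])
  next
    case 2
    have "\<forall>\<^sub>F x in nhds s. 0 = bump m x"
      using eventually_nhds_in_open[of "{1<..}" s] 2 by (auto elim!: eventually_mono simp: bump_def)
    moreover have "((\<lambda>s. 0) has_real_derivative (real m * bump (m + 1) s - bump (m + 2) s)) (at s)"
      using 2 by (simp add: bump_def)
    ultimately show ?thesis
      by (subst (asm) DERIV_cong_ev[OF refl _ refl])
  qed
next
  case True
  have "((\<lambda>h. (bump m (1 + h) - bump m 1) / h) \<longlongrightarrow> 0) (at 0)"
  proof (rule tendsto_0_le[where K = 1 and f = "\<lambda>h. fact (m + 2) * \<bar>h\<bar>"])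
    show "((\<lambda>h::real. fact (m + 2) * \<bar>h\<bar>) \<longlongrightarrow> (0::real)) (at 0)"
      by (auto intro!: tendsto_eq_intros)
    show "\<forall>\<^sub>F h in at 0. norm ((bump m (1 + h) - bump m 1) / h) \<le> norm (fact (m + 2) * \<bar>h\<bar> :: real) * 1"
    proof (intro eventually_at_topological[THEN iffD2] exI[of _ UNIV] conjI ballI impI)
      fix h :: real assume "h \<noteq> 0"
      then show "norm ((bump m (1 + h) - bump m 1) / h) \<le> norm (fact (m + 2) * \<bar>h\<bar> :: real) * 1"
        using bump_tail[of m "1 + h"] bump_nonneg[of m "1 + h"]
        by (simp add: bump_eq_0 divide_simps abs_mult mult.assoc flip: power2_eq_square del: fact_Suc)
    qed auto
  qed
  then show ?thesis
    using True by (simp add: DERIV_def bump_eq_0)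
qed

lemma has_derivative_bump_norm_sq:
  "((\<lambda>z. bump m (z \<bullet> z)) has_derivative
     (\<lambda>h. (real m * bump (m + 1) (z \<bullet> z) - bump (m + 2) (z \<bullet> z)) * (2 * (z \<bullet> h)))) (at z)"
proof -
  have "((\<lambda>z. z \<bullet> z) has_derivative (\<lambda>h. 2 * (z \<bullet> h))) (at z)"
    by (auto intro!: derivative_eq_intros simp: inner_commute)
  from has_derivative_compose[OF this, of "bump m"]
    DERIV_bump[of m "z \<bullet> z", unfolded has_field_derivative_def]
  show ?thesis by simp
qed

lemma C_k_bump: "C_k k (\<lambda>z. bump m (z \<bullet> z))"
proof (induction k arbitrary: m)
  case 0
  then show ?case
    unfolding C_k.simps continuous_on_eq_continuous_at[OF open_UNIV]
    using has_derivative_continuous[OF has_derivative_bump_norm_sq] by blast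
next
  case (Suc k)
  show ?case
  proof (rule C_k_SucI[OF has_derivative_bump_norm_sq])
    have "C_k k (\<lambda>z::'a. (real m * bump (m + 1) (z \<bullet> z) + (-1) * bump (m + 2) (z \<bullet> z)) * (2 * (z \<bullet> b)))" for b
      by (intro C_k_mult C_k_add C_k_const C_k_inner Suc)
    then show "C_k k (\<lambda>z::'a. (real m * bump (m + 1) (z \<bullet> z) - bump (m + 2) (z \<bullet> z)) * (2 * (z \<bullet> b)))" for b
      by simp
  qed
qed

section \<open>Lipschitz kernels\<close>

text \<open>Kernels supported in the closed unit ball. They vanish on the unit sphere as well, so the
  Lipschitz constant also bounds the kernel itself, and a single constant serves both purposes.\<close>

definition lip_kernel :: "real \<Rightarrow> ('a::euclidean_space \<Rightarrow> 'b::real_normed_vector) \<Rightarrow> bool"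
  where "lip_kernel C k \<longleftrightarrow>
    (\<forall>x y. norm (k x - k y) \<le> C * norm (x - y)) \<and> (\<forall>x. 1 \<le> norm x \<longrightarrow> k x = 0)"

lemma lip_kernel_mono: "lip_kernel C k \<Longrightarrow> C \<le> C' \<Longrightarrow> lip_kernel C' k"
  unfolding lip_kernel_def by (meson mult_right_mono norm_ge_zero order_trans)

lemma lip_kernel_nonneg:
  fixes k :: "'a::euclidean_space \<Rightarrow> 'b::real_normed_vector"
  assumes "lip_kernel C k" shows "0 \<le> C"
proof -
  obtain b :: 'a where b: "b \<in> Basis" using nonempty_Basis by blast
  have "norm (k b - k 0) \<le> C * norm (b - 0)"
    using assms unfolding lip_kernel_def by blast
  then have "norm (k b - k 0) \<le> C" using b by simp
  then show ?thesis using norm_ge_zero order_trans by blast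
qed

lemma lip_kernel_bounded:
  fixes k :: "'a::euclidean_space \<Rightarrow> 'b::real_normed_vector"
  assumes k: "lip_kernel C k" shows "norm (k x) \<le> C"
proof (cases "1 \<le> norm x")
  case True
  then show ?thesis
    using k lip_kernel_nonneg[OF k] by (simp add: lip_kernel_def)
next
  case False
  obtain b :: 'a where b: "b \<in> Basis" using nonempty_Basis by blast
  define y where "y = (if x = 0 then b else x /\<^sub>R norm x)"
  have y: "norm y = 1" using b by (simp add: y_def)
  have "x - y = (if x = 0 then - b else (1 - 1 / norm x) *\<^sub>R x)"
    by (simp add: y_def algebra_simps divide_inverse)
  then have "norm (x - y) \<le> 1"
    using False b by (simp add: abs_mult divide_simps left_diff_distrib)
  moreover have "norm (k x - k y) \<le> C * norm (x - y)" "k y = 0"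
    using k y unfolding lip_kernel_def by (blast, simp)
  ultimately show ?thesis
    using lip_kernel_nonneg[OF k] mult_left_mono[of "norm (x - y)" 1 C] by auto
qed

lemma lip_kernel_continuous:
  assumes "lip_kernel C k" shows "continuous_on S k"
proof -
  have "C-lipschitz_on UNIV k"
    using assms lip_kernel_nonneg[OF assms] by (auto simp: lipschitz_on_def lip_kernel_def dist_norm)
  then show ?thesis
    by (meson continuous_on_subset lipschitz_on_continuous_on top_greatest)
qed

text \<open>The first derivatives are bounded on the closed unit ball by compactness and vanish outside, so
  the mean value inequality applies.\<close>

lemma C_k_lip_kernel:
  fixes k :: "'a::euclidean_space \<Rightarrow> real"
  assumes k: "C_k 1 k" and z: "\<And>x. 1 \<le> norm x \<Longrightarrow> k x = 0"
  shows "\<exists>C. lip_kernel C k"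
proof -
  have k1: "C_k (Suc 0) k" using k by simp
  define D where "D x = frechet_derivative k (at x)" for x
  have D: "(k has_derivative D x) (at x)" for x
    unfolding D_def by (rule C_k_SucD[OF k1])
  have cont: "continuous_on UNIV (\<lambda>x. \<Sum>b\<in>Basis. \<bar>D x b\<bar>)"
    using C_k_SucD(2)[OF k1] unfolding D_def by (intro continuous_intros) simp
  have "bounded ((\<lambda>x. \<Sum>b\<in>Basis. \<bar>D x b\<bar>) ` cball 0 1)"
    by (intro compact_imp_bounded compact_continuous_image continuous_on_subset[OF cont]) auto
  then obtain C where C: "\<And>x. norm x \<le> 1 \<Longrightarrow> (\<Sum>b\<in>Basis. \<bar>D x b\<bar>) \<le> C" and "0 < C"
    by (force simp: bounded_pos)
  have D0: "D x = (\<lambda>h. 0)" if "1 < norm x" for x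
  proof -
    have "(k has_derivative (\<lambda>h. 0)) (at x)"
    proof (rule has_derivative_transform_within_open[where f = "\<lambda>x. 0" and s = "{x. 1 < norm x}"])
      show "open {x::'a. 1 < norm x}" by (intro open_Collect_less continuous_intros)
    qed (use that z in auto)
    then show ?thesis using D has_derivative_unique by blast
  qed
  have bd: "norm (D x h) \<le> C * norm h" for x h
  proof (cases "norm x \<le> 1")
    case True
    have "D x h = D x (\<Sum>b\<in>Basis. (h \<bullet> b) *\<^sub>R b)"
      by (simp add: euclidean_representation)
    also have "\<dots> = (\<Sum>b\<in>Basis. (h \<bullet> b) * D x b)"
      using has_derivative_linear[OF D[of x]] by (simp add: linear_sum linear_cmul)
    also have "norm \<dots> \<le> (\<Sum>b\<in>Basis. norm h * \<bar>D x b\<bar>)"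
      by (intro sum_norm_le) (auto simp: abs_mult Basis_le_norm mult_right_mono)
    also have "\<dots> = norm h * (\<Sum>b\<in>Basis. \<bar>D x b\<bar>)"
      by (simp add: sum_distrib_left)
    also have "\<dots> \<le> norm h * C"
      using C[OF True] by (intro mult_left_mono) auto
    finally show ?thesis by (simp add: mult.commute)
  next
    case False
    then show ?thesis using D0[of x] \<open>0 < C\<close> by simp
  qed
  have "onorm (D x) \<le> C" for x
    by (rule onorm_bound) (use bd \<open>0 < C\<close> in \<open>auto simp: mult.commute\<close>)
  then have "norm (k x - k y) \<le> C * norm (x - y)" for x y
    by (intro differentiable_bound[of UNIV k D]) (auto intro: D has_derivative_at_withinI)
  then show ?thesis using z unfolding lip_kernel_def by blast
qed

section \<open>The averaging kernel and its scaling field\<close>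

definition ker :: "'a::euclidean_space \<Rightarrow> real"
  where "ker z = bump 0 (z \<bullet> z)"

text \<open>The components of the vector field \<open>z \<psi>(z)\<close>, where \<open>\<psi>\<close> is \<^const>\<open>ker\<close>.\<close>

definition prof :: "'a::euclidean_space \<Rightarrow> 'a \<Rightarrow> real"
  where "prof i z = (z \<bullet> i) * bump 0 (z \<bullet> z)"

text \<open>The derivative of \<open>prof i\<close> in direction \<open>e\<close>. As \<open>\<psi>\<close> is radial, the field \<open>z \<psi>(z)\<close> is a gradient, and
  these derivatives form a Hessian matrix; this is the source of the symmetry in \<open>e\<close> and \<open>i\<close>.\<close>

definition dprof :: "'a::euclidean_space \<Rightarrow> 'a \<Rightarrow> 'a \<Rightarrow> real"
  where "dprof e i z = (e \<bullet> i) * bump 0 (z \<bullet> z) - 2 * (z \<bullet> e) * (z \<bullet> i) * bump 2 (z \<bullet> z)"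

text \<open>The gradient of \<open>prof i\<close>.\<close>

definition gprof :: "'a::euclidean_space \<Rightarrow> 'a \<Rightarrow> 'a"
  where "gprof i z = (\<Sum>e\<in>Basis. dprof e i z *\<^sub>R e)"

text \<open>The divergence of the field \<open>z \<psi>(z)\<close>.\<close>

definition lker :: "'a::euclidean_space \<Rightarrow> real"
  where "lker z = real DIM('a) * bump 0 (z \<bullet> z) - 2 * (z \<bullet> z) * bump 2 (z \<bullet> z)"

lemma dprof_commute: "dprof e i z = dprof i e z"
  by (simp add: dprof_def inner_commute mult.commute mult.left_commute)

lemma lker_eq_divergence: "lker z = (\<Sum>e\<in>Basis. dprof e e z)"
proof -
  have "(\<Sum>e\<in>Basis. 2 * (z \<bullet> e) * (z \<bullet> e) * bump 2 (z \<bullet> z)) = 2 * (z \<bullet> z) * bump 2 (z \<bullet> z)"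
    by (subst (4) euclidean_inner) (simp add: sum_distrib_left sum_distrib_right mult.assoc)
  then show ?thesis
    by (simp add: dprof_def lker_def sum_subtractf)
qed

lemma has_derivative_prof: "(prof i has_derivative (\<lambda>h. dprof h i z)) (at z)"
  unfolding prof_def[abs_def] dprof_def
  by (rule has_derivative_eq_rhs[OF has_derivative_mult[OF _ has_derivative_bump_norm_sq]])
    (auto intro!: derivative_eq_intros simp: algebra_simps eval_nat_numeral)

lemma C_k_prof: "C_k k (prof i)"
  unfolding prof_def[abs_def] by (intro C_k_mult C_k_inner C_k_bump)

lemma partial_deriv_prof: "partial_deriv e (prof i) = dprof e i"
  by (rule ext) (simp add: frechet_derivative_at[OF has_derivative_prof, symmetric])

lemma C_k_dprof: "C_k k (dprof e i)"
proof -
  have eq: "dprof e i = (\<lambda>z. (e \<bullet> i) * bump 0 (z \<bullet> z) + (- 2) * ((z \<bullet> e) * (z \<bullet> i) * bump 2 (z \<bullet> z)))"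
    by (auto simp: dprof_def)
  show ?thesis
    unfolding eq by (intro C_k_add C_k_mult C_k_inner C_k_bump C_k_const)
qed

lemma C_k_ker: "C_k k ker"
  unfolding ker_def[abs_def] by (intro C_k_bump)

lemma C_k_lker: "C_k k lker"
proof -
  have eq: "lker = (\<lambda>z::'a. real DIM('a) * bump 0 (z \<bullet> z) + (- 2) * ((z \<bullet> z) * bump 2 (z \<bullet> z)))"
    by (auto simp: lker_def)
  show ?thesis
    unfolding eq by (intro C_k_add C_k_mult C_k_bump C_k_const C_k_norm_sq)
qed

text \<open>Both sides are the mixed second derivative of \<open>prof e\<close> in the directions \<open>i\<close> and \<open>e\<close>, written in the
  two possible orders.\<close>

lemma mixed_partials_dprof:
  assumes "i \<in> Basis" "e \<in> Basis"
  shows "partial_deriv i (dprof e e) = partial_deriv e (dprof i e)"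
proof -
  define B where "B z = 2 * bump 3 (z \<bullet> z) - bump 4 (z \<bullet> z)" for z :: 'a
  have d: "(dprof e i has_derivative (\<lambda>h. - (e \<bullet> i) * bump 2 (z \<bullet> z) * (2 * (z \<bullet> h))
     - 2 * ((h \<bullet> e) * (z \<bullet> i) * bump 2 (z \<bullet> z) + (z \<bullet> e) * (h \<bullet> i) * bump 2 (z \<bullet> z)
     + (z \<bullet> e) * (z \<bullet> i) * B z * (2 * (z \<bullet> h))))) (at z)" for e i z :: 'a
    unfolding dprof_def[abs_def] B_def
    by (auto intro!: derivative_eq_intros has_derivative_bump_norm_sq
        simp: algebra_simps eval_nat_numeral)
  show ?thesis
    unfolding frechet_derivative_at[OF d, symmetric]
    using assms by (auto simp: inner_Basis algebra_simps)
qed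

lemma norm_sq_ge_1: "1 \<le> norm z \<Longrightarrow> 1 \<le> z \<bullet> z"
  by (simp add: one_le_power flip: power2_norm_eq_inner)

lemma lip_kernel_sum:
  assumes "finite I" "\<And>e. e \<in> I \<Longrightarrow> lip_kernel (C e) (k e)"
  shows "lip_kernel (\<Sum>e\<in>I. C e) (\<lambda>z. \<Sum>e\<in>I. k e z)"
  unfolding lip_kernel_def
proof (intro conjI allI impI)
  fix x y
  have "norm ((\<Sum>e\<in>I. k e x) - (\<Sum>e\<in>I. k e y)) \<le> (\<Sum>e\<in>I. C e * norm (x - y))"
    unfolding sum_subtractf[symmetric] using assms(2) by (intro sum_norm_le) (simp add: lip_kernel_def)
  then show "norm ((\<Sum>e\<in>I. k e x) - (\<Sum>e\<in>I. k e y)) \<le> (\<Sum>e\<in>I. C e) * norm (x - y)"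
    by (simp add: sum_distrib_right)
next
  show "1 \<le> norm x \<Longrightarrow> (\<Sum>e\<in>I. k e x) = 0" for x
    using assms(2) by (simp add: lip_kernel_def)
qed

lemma lip_kernel_scaleR:
  assumes k: "lip_kernel C k" shows "lip_kernel (C * norm w) (\<lambda>z. k z *\<^sub>R w)"
proof -
  have "norm (k x *\<^sub>R w - k y *\<^sub>R w) \<le> C * norm w * norm (x - y)" for x y
  proof -
    have "norm (k x *\<^sub>R w - k y *\<^sub>R w) = norm (k x - k y) * norm w"
      by (simp flip: scaleR_diff_left)
    also have "\<dots> \<le> C * norm (x - y) * norm w"
      using k by (intro mult_right_mono) (auto simp: lip_kernel_def)
    finally show ?thesis by (simp add: mult_ac)
  qed
  then show ?thesis using k by (simp add: lip_kernel_def)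
qed

text \<open>One constant for all kernels keeps the later estimates free of bookkeeping.\<close>

lemma ex_lip_kernel_const:
  "\<exists>C>0. lip_kernel C (ker :: 'a::euclidean_space \<Rightarrow> real) \<and> lip_kernel C (lker :: 'a \<Rightarrow> real) \<and>
     (\<forall>i\<in>Basis. lip_kernel C (prof i :: 'a \<Rightarrow> real) \<and> lip_kernel C (gprof i :: 'a \<Rightarrow> 'a))"
proof -
  obtain C1 where C1: "lip_kernel C1 (ker :: 'a \<Rightarrow> real)"
    using C_k_lip_kernel[OF C_k_ker, where 'a = 'a] norm_sq_ge_1[where 'a = 'a]
    by (auto simp: ker_def bump_eq_0)
  obtain C2 where C2: "lip_kernel C2 (lker :: 'a \<Rightarrow> real)"
    using C_k_lip_kernel[OF C_k_lker, where 'a = 'a] norm_sq_ge_1[where 'a = 'a]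
    by (auto simp: lker_def bump_eq_0)
  have "\<exists>C. lip_kernel C (prof i)" for i :: 'a
    by (rule C_k_lip_kernel[OF C_k_prof]) (auto simp: prof_def bump_eq_0 norm_sq_ge_1)
  then obtain C3 where C3: "\<And>i. lip_kernel (C3 i) (prof i :: 'a \<Rightarrow> real)"
    by metis
  have "\<exists>C. lip_kernel C (dprof e i)" for e i :: 'a
    by (rule C_k_lip_kernel[OF C_k_dprof]) (auto simp: dprof_def bump_eq_0 norm_sq_ge_1)
  then obtain C4 where C4: "\<And>e i. lip_kernel (C4 e i) (dprof e i :: 'a \<Rightarrow> real)"
    by metis
  have g: "\<exists>C. lip_kernel C (gprof i :: 'a \<Rightarrow> 'a)" for i
    unfolding gprof_def[abs_def]
    by (rule exI[of _ "\<Sum>e\<in>Basis. C4 e i * norm e"]) (intro lip_kernel_sum lip_kernel_scaleR C4 finite_Basis)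
  then obtain C5 where C5: "\<And>i. lip_kernel (C5 i) (gprof i :: 'a \<Rightarrow> 'a)"
    by metis
  define C where "C = 1 + \<bar>C1\<bar> + \<bar>C2\<bar> + (\<Sum>i\<in>(Basis::'a set). \<bar>C3 i\<bar>) + (\<Sum>i\<in>(Basis::'a set). \<bar>C5 i\<bar>)"
  have s: "(\<Sum>i\<in>(Basis::'a set). \<bar>C3 i\<bar>) \<ge> 0" "(\<Sum>i\<in>(Basis::'a set). \<bar>C5 i\<bar>) \<ge> 0"
    by (auto intro: sum_nonneg)
  have "C3 i \<le> C" "C5 i \<le> C" if "i \<in> Basis" for i
    using s member_le_sum[of i Basis "\<lambda>i. \<bar>C3 i\<bar>"] member_le_sum[of i Basis "\<lambda>i. \<bar>C5 i\<bar>"] that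
    by (auto simp: C_def)
  moreover have "C1 \<le> C" "C2 \<le> C" "C > 0"
    unfolding C_def using s by linarith+
  ultimately show ?thesis
    by (intro exI[of _ C] conjI ballI lip_kernel_mono[OF C1] lip_kernel_mono[OF C2]
      lip_kernel_mono[OF C3] lip_kernel_mono[OF C5]) auto
qed

section \<open>Averages against a kernel\<close>

text \<open>The inner product allows a scalar function to be paired with a scalar kernel and a vector field
  with a vector kernel. The factor \<open>t\<^sup>-\<^sup>n\<close> that turns the integral into an average is left out.\<close>

definition cint :: "('a::euclidean_space \<Rightarrow> 'b::euclidean_space) \<Rightarrow> ('a \<Rightarrow> 'b) \<Rightarrow> real \<Rightarrow> 'a \<Rightarrow> real"
  where "cint f k t x = (LINT z|lebesgue. f z \<bullet> k ((z - x) /\<^sub>R t))"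

lemma lip_kernel_outside:
  assumes "lip_kernel C k" "0 < t" "z \<notin> cball x t"
  shows "k ((z - x) /\<^sub>R t) = 0"
proof -
  have "1 \<le> norm ((z - x) /\<^sub>R t)"
    using assms(2,3) by (simp add: dist_norm norm_minus_commute divide_simps)
  then show ?thesis using assms(1) by (simp add: lip_kernel_def)
qed

lemma lip_kernel_measurable:
  fixes k :: "'a::euclidean_space \<Rightarrow> 'b::euclidean_space"
  assumes "lip_kernel C k"
  shows "(\<lambda>z. k ((z - x) /\<^sub>R t)) \<in> borel_measurable lebesgue"
proof -
  have "k \<in> borel_measurable borel"
    using lip_kernel_continuous[OF assms] by (rule borel_measurable_continuous_onI)
  then have "(\<lambda>z. k ((z - x) /\<^sub>R t)) \<in> borel_measurable borel"
    by simp
  then show ?thesis by (simp add: measurable_completion)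
qed

lemma cint_cong_ball:
  assumes k: "lip_kernel C k" and t: "0 < t" and "\<And>z. z \<in> cball x t \<Longrightarrow> f z = g z"
  shows "cint f k t x = cint g k t x"
  unfolding cint_def
proof (rule Bochner_Integration.integral_cong[OF refl])
  fix z show "f z \<bullet> k ((z - x) /\<^sub>R t) = g z \<bullet> k ((z - x) /\<^sub>R t)"
    using assms(3)[of z] lip_kernel_outside[OF k t, of z x] by (cases "z \<in> cball x t") auto
qed

lemma cint_integrable:
  fixes f k :: "'a::euclidean_space \<Rightarrow> 'b::euclidean_space"
  assumes k: "lip_kernel C k" and t: "0 < t" and f: "set_integrable lebesgue (cball x t) f"
  shows "integrable lebesgue (\<lambda>z. f z \<bullet> k ((z - x) /\<^sub>R t))"
proof -
  define g where "g z = indicator (cball x t) z *\<^sub>R f z" for z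
  have g: "integrable lebesgue g" using f by (simp add: g_def[abs_def] set_integrable_def)
  have "integrable lebesgue (\<lambda>z. g z \<bullet> k ((z - x) /\<^sub>R t))"
  proof (rule Bochner_Integration.integrable_bound[OF integrable_scaleR_right[OF integrable_norm[OF g], of C]])
    show "AE z in lebesgue. norm (g z \<bullet> k ((z - x) /\<^sub>R t)) \<le> norm (C *\<^sub>R norm (g z))"
    proof (rule AE_I2)
      fix z
      have "\<bar>g z \<bullet> k ((z - x) /\<^sub>R t)\<bar> \<le> norm (g z) * norm (k ((z - x) /\<^sub>R t))"
        by (rule Cauchy_Schwarz_ineq2)
      also have "\<dots> \<le> norm (g z) * C"
        by (intro mult_left_mono lip_kernel_bounded[OF k]) auto
      finally show "norm (g z \<bullet> k ((z - x) /\<^sub>R t)) \<le> norm (C *\<^sub>R norm (g z))"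
        using lip_kernel_nonneg[OF k] by (simp add: mult.commute abs_mult)
    qed
    show "(\<lambda>z. g z \<bullet> k ((z - x) /\<^sub>R t)) \<in> borel_measurable lebesgue"
      using g lip_kernel_measurable[OF k] by (intro borel_measurable_inner) auto
  qed
  moreover have "g z \<bullet> k ((z - x) /\<^sub>R t) = f z \<bullet> k ((z - x) /\<^sub>R t)" for z
    using lip_kernel_outside[OF k t, of z x] by (cases "z \<in> cball x t") (auto simp: g_def)
  ultimately show ?thesis by simp
qed

lemma cint_bound:
  fixes f k :: "'a::euclidean_space \<Rightarrow> 'b::euclidean_space"
  assumes k: "lip_kernel C k" and t: "0 < t" and f: "set_integrable lebesgue (cball x t) f"
  shows "\<bar>cint f k t x\<bar> \<le> C * (LINT z:cball x t|lebesgue. norm (f z))"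
proof -
  have fn: "set_integrable lebesgue (cball x t) (\<lambda>z. norm (f z))"
    using f by (rule set_integrable_norm)
  have "norm (cint f k t x) \<le> (LINT z|lebesgue. C * (indicator (cball x t) z *\<^sub>R norm (f z)))"
    unfolding cint_def
  proof (rule Bochner_Integration.integral_norm_bound_integral[OF cint_integrable[OF k t f]])
    show "integrable lebesgue (\<lambda>z. C * (indicator (cball x t) z *\<^sub>R norm (f z)))"
      using fn by (simp add: set_integrable_def)
    fix z
    show "norm (f z \<bullet> k ((z - x) /\<^sub>R t)) \<le> C * (indicator (cball x t) z *\<^sub>R norm (f z))"
    proof (cases "z \<in> cball x t")
      case True
      have "norm (f z \<bullet> k ((z - x) /\<^sub>R t)) \<le> norm (f z) * norm (k ((z - x) /\<^sub>R t))"
        by (simp add: Cauchy_Schwarz_ineq2)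
      also have "\<dots> \<le> norm (f z) * C"
        by (intro mult_left_mono lip_kernel_bounded[OF k]) auto
      finally show ?thesis using True by (simp add: mult.commute)
    qed (simp add: lip_kernel_outside[OF k t])
  qed
  then show ?thesis by (simp add: set_lebesgue_integral_def)
qed

text \<open>The arguments of the two kernels differ by \<open>(x - y) / t\<close>, which gains the factor \<open>|x - y| / t\<close> over
  the trivial bound; both balls lie in the one of radius \<open>2t\<close> around \<open>x\<close>.\<close>

lemma cint_diff_bound:
  fixes f k :: "'a::euclidean_space \<Rightarrow> 'b::euclidean_space"
  assumes k: "lip_kernel C k" and t: "0 < t" and f: "set_integrable lebesgue (cball x (2 * t)) f"
    and xy: "norm (x - y) \<le> t"
  shows "\<bar>cint f k t x - cint f k t y\<bar>
    \<le> C * (norm (x - y) / t) * (LINT z:cball x (2 * t)|lebesgue. norm (f z))"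
proof -
  have sub: "cball x t \<subseteq> cball x (2 * t)" "cball y t \<subseteq> cball x (2 * t)"
  proof -
    show "cball x t \<subseteq> cball x (2 * t)" using t by (intro subset_cball) simp
    show "cball y t \<subseteq> cball x (2 * t)"
    proof
      fix z assume "z \<in> cball y t"
      then show "z \<in> cball x (2 * t)"
        using dist_triangle[of x z y] xy by (simp add: dist_norm)
    qed
  qed
  have fx: "set_integrable lebesgue (cball x t) f" and fy: "set_integrable lebesgue (cball y t) f"
    using f sub by (auto intro: set_integrable_subset)
  have fn: "set_integrable lebesgue (cball x (2 * t)) (\<lambda>z. norm (f z))"
    using f by (rule set_integrable_norm)
  define L where "L = C * (norm (x - y) / t)"
  have L0: "0 \<le> L" using t lip_kernel_nonneg[OF k] by (simp add: L_def)
  have "norm (cint f k t x - cint f k t y)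
      \<le> (LINT z|lebesgue. L * (indicator (cball x (2 * t)) z *\<^sub>R norm (f z)))"
    unfolding cint_def Bochner_Integration.integral_diff[OF cint_integrable[OF k t fx] cint_integrable[OF k t fy], symmetric]
  proof (rule Bochner_Integration.integral_norm_bound_integral)
    show "integrable lebesgue (\<lambda>z. f z \<bullet> k ((z - x) /\<^sub>R t) - f z \<bullet> k ((z - y) /\<^sub>R t))"
      by (intro Bochner_Integration.integrable_diff cint_integrable[OF k t] fx fy)
    show "integrable lebesgue (\<lambda>z. L * (indicator (cball x (2 * t)) z *\<^sub>R norm (f z)))"
      using fn by (simp add: set_integrable_def)
    fix z
    show "norm (f z \<bullet> k ((z - x) /\<^sub>R t) - f z \<bullet> k ((z - y) /\<^sub>R t))
       \<le> L * (indicator (cball x (2 * t)) z *\<^sub>R norm (f z))"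
    proof (cases "z \<in> cball x (2 * t)")
      case True
      have "(z - x) /\<^sub>R t - (z - y) /\<^sub>R t = - (x - y) /\<^sub>R t"
        by (simp add: algebra_simps)
      then have "norm ((z - x) /\<^sub>R t - (z - y) /\<^sub>R t) = norm (x - y) / t"
        using t by (simp add: divide_inverse_commute norm_minus_commute)
      then have kk: "norm (k ((z - x) /\<^sub>R t) - k ((z - y) /\<^sub>R t)) \<le> L"
        using k unfolding lip_kernel_def L_def by metis
      have "norm (f z \<bullet> k ((z - x) /\<^sub>R t) - f z \<bullet> k ((z - y) /\<^sub>R t))
        = \<bar>f z \<bullet> (k ((z - x) /\<^sub>R t) - k ((z - y) /\<^sub>R t))\<bar>"
        by (simp add: inner_diff_right)
      also have "\<dots> \<le> norm (f z) * norm (k ((z - x) /\<^sub>R t) - k ((z - y) /\<^sub>R t))"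
        by (rule Cauchy_Schwarz_ineq2)
      also have "\<dots> \<le> norm (f z) * L"
        by (intro mult_left_mono kk) auto
      finally show ?thesis using True by (simp add: mult.commute)
    next
      case False
      then have "z \<notin> cball x t" "z \<notin> cball y t" using sub by blast+
      then show ?thesis using False by (simp add: lip_kernel_outside[OF k t])
    qed
  qed
  then show ?thesis by (simp add: set_lebesgue_integral_def L_def)
qed

section \<open>Weak identities tested with rescaled kernels\<close>

lemma kernel_test_function:
  fixes f :: "'a::euclidean_space \<Rightarrow> real"
  assumes f: "\<And>k. C_k k f" and z: "\<And>z. 1 \<le> norm z \<Longrightarrow> f z = 0" and t: "0 < t" and sub: "cball x t \<subseteq> D"
  shows "(\<lambda>z. f ((z - x) /\<^sub>R t)) \<in> test_functions D"
proof -
  have out: "f ((z - x) /\<^sub>R t) = 0" if "z \<notin> cball x t" for z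
    using that t by (intro assms(2)) (simp add: dist_norm norm_minus_commute divide_simps)
  have *: "closure {z. f ((z - x) /\<^sub>R t) \<noteq> 0} \<subseteq> cball x t"
    by (rule closure_minimal) (use out in \<open>blast, simp\<close>)
  have "compact (closure {z. f ((z - x) /\<^sub>R t) \<noteq> 0})"
    using compact_Int_closed[OF compact_cball[of x t] closed_closure] * by (metis inf.absorb_iff2)
  then show ?thesis
    unfolding test_functions_def using * sub C_k_affine[OF f] by auto
qed

lemma partial_deriv_affine:
  fixes f :: "'a::euclidean_space \<Rightarrow> real"
  assumes "C_k 1 f"
  shows "partial_deriv b (\<lambda>z. f ((z - x) /\<^sub>R t)) z = partial_deriv b f ((z - x) /\<^sub>R t) / t"
proof -
  note D = C_k_SucD(1)[of 0, folded One_nat_def, OF assms]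
  have d: "((\<lambda>z. f ((z - x) /\<^sub>R t)) has_derivative
      (\<lambda>h. frechet_derivative f (at ((z - x) /\<^sub>R t)) (h /\<^sub>R t))) (at z)"
    by (rule has_derivative_compose[where g = f, OF _ D]) (auto intro!: derivative_eq_intros)
  show ?thesis
    unfolding frechet_derivative_at[OF d, symmetric]
    using has_derivative_linear[OF D] by (simp add: linear_cmul divide_inverse mult.commute)
qed

lemma lebesgue_on_kernel:
  fixes h :: "'a::euclidean_space \<Rightarrow> 'b::euclidean_space"
  assumes "open D" "S \<subseteq> D" and h: "\<And>z. z \<notin> S \<Longrightarrow> h z = 0"
  shows "(LINT z|lebesgue_on D. h z) = (LINT z|lebesgue. h z)"
proof -
  have "(LINT z|lebesgue_on D. h z) = (LINT z|lebesgue. indicator D z *\<^sub>R h z)"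
    using assms(1) by (intro integral_restrict_space) auto
  also have "\<dots> = (LINT z|lebesgue. h z)"
    using assms(2) h by (intro Bochner_Integration.integral_cong) (auto simp: indicator_def)
  finally show ?thesis .
qed

lemma lebesgue_integral_affine:
  fixes g :: "'a::euclidean_space \<Rightarrow> 'b::euclidean_space"
  assumes g: "g \<in> borel_measurable borel" and t: "0 < t"
  shows "(LINT z|lebesgue. g ((z - x) /\<^sub>R t)) = t ^ DIM('a) *\<^sub>R (LINT z|lborel. g z)"
proof -
  note g[measurable]
  have "(LINT z|lebesgue. g ((z - x) /\<^sub>R t)) = (LINT z|lborel. g ((z - x) /\<^sub>R t))"
    by (rule integral_completion) simp
  also have "\<dots> = (LINT z|density (distr lborel borel (\<lambda>y. x + t *\<^sub>R y)) (\<lambda>_. ennreal (\<bar>t\<bar> ^ DIM('a))). g ((z - x) /\<^sub>R t))"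
    using lborel_affine[of t x] t by simp
  also have "\<dots> = t ^ DIM('a) *\<^sub>R (LINT z|lborel. g z)"
    using t by (subst integral_density) (simp_all add: integral_distr)
  finally show ?thesis .
qed

lemma integral_translate_lborel:
  fixes g :: "'a::euclidean_space \<Rightarrow> real"
  assumes "g \<in> borel_measurable borel"
  shows "(LINT z|lborel. g (h + z)) = (LINT z|lborel. g z)"
  by (subst (2) lborel_distr_plus[symmetric, of h], subst integral_distr) (use assms in auto)

text \<open>By translation invariance the difference quotients of \<open>f\<close> have integral zero, and by the Lipschitz
  bound they converge dominatedly to the derivative.\<close>

lemma integral_partial_kernel_0:
  fixes f :: "'a::euclidean_space \<Rightarrow> real"
  assumes k: "lip_kernel C f" and D: "\<And>z. (f has_derivative D z) (at z)" and b: "norm b = 1"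
    and m: "(\<lambda>z. D z b) \<in> borel_measurable borel"
  shows "(LINT z|lborel. D z b) = 0"
proof -
  define h where "h n = 1 / real (Suc n)" for n
  have h: "h n > 0" "h n \<le> 1" for n by (auto simp: h_def)
  have fb[measurable]: "f \<in> borel_measurable borel"
    using lip_kernel_continuous[OF k] by (rule borel_measurable_continuous_onI)
  have fi: "integrable lborel f"
  proof (rule Bochner_Integration.integrable_bound)
    show "integrable lborel (\<lambda>z::'a. C * indicator (cball 0 1) z)"
      by (intro integrable_mult_right integrable_real_indicator)
        (use emeasure_lborel_cball_finite[of "0::'a"] in \<open>auto simp flip: infinity_ennreal_def\<close>)
    show "AE z in lborel. norm (f z) \<le> norm (C * indicator (cball 0 1) z)"
    proof (rule AE_I2)
      fix z :: 'a show "norm (f z) \<le> norm (C * indicator (cball 0 1) z)"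
        using k lip_kernel_bounded[OF k, of z] by (auto simp: lip_kernel_def indicator_def)
    qed
  qed simp
  have fih: "integrable lborel (\<lambda>z. f (w + z))" for w
    using fi by (subst (asm) lborel_distr_plus[symmetric, of w], subst (asm) integrable_distr_eq) auto
  have "(\<lambda>n. LINT z|lborel. (f (h n *\<^sub>R b + z) - f z) / h n) \<longlonglongrightarrow> (LINT z|lborel. D z b)"
  proof (rule integral_dominated_convergence)
    show "integrable lborel (\<lambda>z::'a. C * indicator (cball 0 2) z)"
      by (intro integrable_mult_right integrable_real_indicator)
        (use emeasure_lborel_cball_finite[of "0::'a"] in \<open>auto simp flip: infinity_ennreal_def\<close>)
    show "AE z in lborel. (\<lambda>n. (f (h n *\<^sub>R b + z) - f z) / h n) \<longlonglongrightarrow> D z b"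
    proof (rule AE_I2)
      fix z
      have "((\<lambda>s. f (s *\<^sub>R b + z)) has_derivative (\<lambda>s. D (0 *\<^sub>R b + z) (s *\<^sub>R b))) (at 0)"
        by (rule has_derivative_compose[of "\<lambda>s. s *\<^sub>R b + z" "\<lambda>s. s *\<^sub>R b" 0 UNIV f, OF _ D])
          (auto intro!: derivative_eq_intros)
      moreover have "D z (s *\<^sub>R b) = s * D z b" for s
        using has_derivative_linear[OF D[of z]] by (simp add: linear_cmul)
      ultimately have "((\<lambda>s. f (s *\<^sub>R b + z)) has_real_derivative D z b) (at 0)"
        by (simp add: has_field_derivative_def mult_commute_abs)
      then have "((\<lambda>s. (f (s *\<^sub>R b + z) - f z) / s) \<longlongrightarrow> D z b) (at 0)"
        by (simp add: DERIV_def)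
      moreover have "filterlim h (at 0) sequentially"
        unfolding filterlim_at
        using h(1) LIMSEQ_Suc[OF lim_1_over_n] by (auto simp: h_def[abs_def] less_imp_neq[symmetric])
      ultimately show "(\<lambda>n. (f (h n *\<^sub>R b + z) - f z) / h n) \<longlonglongrightarrow> D z b"
        by (rule filterlim_compose)
    qed
    show "AE z in lborel. norm ((f (h n *\<^sub>R b + z) - f z) / h n) \<le> C * indicator (cball 0 2) z" for n
    proof (rule AE_I2)
      fix z
      show "norm ((f (h n *\<^sub>R b + z) - f z) / h n) \<le> C * indicator (cball 0 2) z"
      proof (cases "norm z \<le> 2")
        case True
        have "norm (f (h n *\<^sub>R b + z) - f z) \<le> C * norm (h n *\<^sub>R b + z - z)"
          using k unfolding lip_kernel_def by blast
        then show ?thesis using True h[of n] b by (simp add: divide_simps)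
      next
        case False
        have "norm z \<le> norm (h n *\<^sub>R b + z) + norm (h n *\<^sub>R b)"
          using norm_triangle_sub[of z "- (h n *\<^sub>R b)"] by (simp add: add.commute)
        then have "1 \<le> norm (h n *\<^sub>R b + z)" "1 \<le> norm z"
          using False h[of n] b by auto
        then show ?thesis using k False by (simp add: lip_kernel_def)
      qed
    qed
  qed (use m in \<open>auto simp: measurable_lborel1\<close>)
  moreover have "(LINT z|lborel. (f (h n *\<^sub>R b + z) - f z) / h n) = 0" for n
    using fi fih by (simp add: integral_translate_lborel[OF fb])
  ultimately have "(\<lambda>n::nat. 0::real) \<longlonglongrightarrow> (LINT z|lborel. D z b)"
    by (simp only:)
  then show ?thesis
    by (simp add: LIMSEQ_const_iff)
qed

lemma ex_lip_dprof: "\<exists>C. lip_kernel C (dprof e i :: 'a::euclidean_space \<Rightarrow> real)"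
  by (rule C_k_lip_kernel[OF C_k_dprof]) (auto simp: dprof_def bump_eq_0 norm_sq_ge_1)

lemma ex_lip_prof: "\<exists>C. lip_kernel C (prof i :: 'a::euclidean_space \<Rightarrow> real)"
  by (rule C_k_lip_kernel[OF C_k_prof]) (auto simp: prof_def bump_eq_0 norm_sq_ge_1)

lemma set_integrable_inner_left:
  fixes f :: "'a::euclidean_space \<Rightarrow> 'b::euclidean_space"
  assumes "set_integrable lebesgue S f"
  shows "set_integrable lebesgue S (\<lambda>z. f z \<bullet> b)"
  using assms unfolding set_integrable_def by (simp flip: inner_scaleR_left)

lemma cint_gprof:
  fixes f :: "'a::euclidean_space \<Rightarrow> 'a"
  assumes t: "0 < t" and f: "set_integrable lebesgue (cball x t) f"
  shows "cint f (gprof i) t x = (\<Sum>e\<in>Basis. cint (\<lambda>z. f z \<bullet> e) (dprof e i) t x)"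
proof -
  have int: "integrable lebesgue (\<lambda>z. (f z \<bullet> e) \<bullet> dprof e i ((z - x) /\<^sub>R t))" for e
    using ex_lip_dprof[of e i] cint_integrable[OF _ t set_integrable_inner_left[OF f]] by blast
  have "cint f (gprof i) t x = (LINT z|lebesgue. (\<Sum>e\<in>Basis. (f z \<bullet> e) \<bullet> dprof e i ((z - x) /\<^sub>R t)))"
    unfolding cint_def gprof_def by (simp add: inner_sum_right mult.commute)
  also have "\<dots> = (\<Sum>e\<in>Basis. cint (\<lambda>z. f z \<bullet> e) (dprof e i) t x)"
    unfolding cint_def by (intro Bochner_Integration.integral_sum int)
  finally show ?thesis .
qed

text \<open>This is what permits to subtract arbitrary constants from \<open>a\<close> and \<open>F\<close>.\<close>

lemma cint_const_gprof:
  fixes c :: "'a::euclidean_space"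
  assumes t: "0 < t"
  shows "cint (\<lambda>_. c) (gprof i) t x = 0"
proof -
  have "cint (\<lambda>z. c \<bullet> e) (dprof e i) t x = 0" if e: "e \<in> Basis" for e
  proof -
    obtain C where C: "lip_kernel C (prof i :: 'a \<Rightarrow> real)" using ex_lip_prof by blast
    obtain C' where C': "lip_kernel C' (dprof e i :: 'a \<Rightarrow> real)" using ex_lip_dprof by blast
    have m: "(dprof e i :: 'a \<Rightarrow> real) \<in> borel_measurable borel"
      using lip_kernel_continuous[OF C'] by (rule borel_measurable_continuous_onI)
    have "cint (\<lambda>z. c \<bullet> e) (dprof e i) t x = (c \<bullet> e) * (LINT z|lebesgue. dprof e i ((z - x) /\<^sub>R t))"
      by (simp add: cint_def)
    also have "\<dots> = (c \<bullet> e) * (t ^ DIM('a) * (LINT z|lborel. dprof e i z))"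
      using lebesgue_integral_affine[OF m t] by simp
    also have "(LINT z|lborel. dprof e i (z::'a)) = 0"
      by (rule integral_partial_kernel_0[OF C has_derivative_prof _ m]) (use e in simp)
    finally show ?thesis by simp
  qed
  moreover have "set_integrable lebesgue (cball x t) (\<lambda>_. c)"
    by (rule absolutely_integrable_on_const) simp
  ultimately show ?thesis by (subst cint_gprof[OF t]) auto
qed

lemma kernel_scaleR_integrable:
  fixes k :: "'a::euclidean_space \<Rightarrow> real" and v :: "'a \<Rightarrow> 'b::euclidean_space"
  assumes k: "continuous_on UNIV k" and out: "\<And>z. z \<notin> S \<Longrightarrow> k z = 0"
    and S: "compact S" and v: "set_integrable lebesgue S v"
  shows "integrable lebesgue (\<lambda>z. k z *\<^sub>R v z)"
proof -
  have "set_integrable lebesgue S (\<lambda>z. k z *\<^sub>R v z)"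
  proof (rule absolutely_integrable_bounded_measurable_product[where h = "(*\<^sub>R)" and f = k, OF _ _ _ _ v])
    show "bilinear ((*\<^sub>R) :: real \<Rightarrow> 'b \<Rightarrow> 'b)"
      by (simp add: bilinear_conv_bounded_bilinear bounded_bilinear_scaleR)
    show "k \<in> borel_measurable (lebesgue_on S)"
      using borel_measurable_continuous_onI[OF k] by (intro measurable_restrict_space1) (simp add: measurable_completion)
    show "bounded (k ` S)"
      using S k by (intro compact_imp_bounded compact_continuous_image) (auto intro: continuous_on_subset)
  qed (use S in \<open>simp add: lmeasurable_compact fmeasurableD\<close>)
  moreover have "(\<lambda>z. indicator S z *\<^sub>R (k z *\<^sub>R v z)) = (\<lambda>z. k z *\<^sub>R v z)"
    using out by (intro ext) (auto simp: indicator_def)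
  ultimately show ?thesis by (simp add: set_integrable_def)
qed

text \<open>The defining identity of a weak derivative, tested with the rescaled kernel; the chain rule
  produces the factor \<open>t\<close>.\<close>

lemma weak_partial_kernel:
  fixes f :: "'a::euclidean_space \<Rightarrow> real" and v w :: "'a \<Rightarrow> 'b::euclidean_space"
  assumes w: "weak_partial D b v w" and b: "b \<in> Basis" and D: "open D" and f: "\<And>k. C_k k f"
    and z: "\<And>z. 1 \<le> norm z \<Longrightarrow> f z = 0" and t: "0 < t" and sub: "cball x t \<subseteq> D"
  shows "cint (\<lambda>z. v z \<bullet> e) (partial_deriv b f) t x = - t * cint (\<lambda>z. w z \<bullet> e) f t x"
proof -
  have z': "partial_deriv b f z = 0" if "1 < norm z" for z
  proof -
    have "(f has_derivative (\<lambda>h. 0)) (at z)"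
    proof (rule has_derivative_transform_within_open[where f = "\<lambda>x. 0" and s = "{x. 1 < norm x}"])
      show "open {x::'a. 1 < norm x}" by (intro open_Collect_less continuous_intros)
    qed (use that z in auto)
    then show ?thesis by (simp flip: frechet_derivative_at)
  qed
  have out: "partial_deriv b f ((z - x) /\<^sub>R t) = 0" "f ((z - x) /\<^sub>R t) = 0" if "z \<notin> cball x t" for z
  proof -
    have "1 < norm ((z - x) /\<^sub>R t)"
      using that t by (simp add: dist_norm norm_minus_commute divide_simps)
    then show "partial_deriv b f ((z - x) /\<^sub>R t) = 0" "f ((z - x) /\<^sub>R t) = 0"
      using z' z by auto
  qed
  have "(LINT z|lebesgue_on D. partial_deriv b (\<lambda>z. f ((z - x) /\<^sub>R t)) z *\<^sub>R v z)
      = - (LINT z|lebesgue_on D. f ((z - x) /\<^sub>R t) *\<^sub>R w z)"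
    using w kernel_test_function[OF f z t sub] unfolding weak_partial_def by blast
  then have "(LINT z|lebesgue_on D. (partial_deriv b f ((z - x) /\<^sub>R t) / t) *\<^sub>R v z)
      = - (LINT z|lebesgue_on D. f ((z - x) /\<^sub>R t) *\<^sub>R w z)"
    by (simp add: partial_deriv_affine[OF f])
  also have "(LINT z|lebesgue_on D. (partial_deriv b f ((z - x) /\<^sub>R t) / t) *\<^sub>R v z)
      = (LINT z|lebesgue. (partial_deriv b f ((z - x) /\<^sub>R t) / t) *\<^sub>R v z)"
    by (rule lebesgue_on_kernel[OF D sub]) (simp add: out)
  also have "(LINT z|lebesgue_on D. f ((z - x) /\<^sub>R t) *\<^sub>R w z) = (LINT z|lebesgue. f ((z - x) /\<^sub>R t) *\<^sub>R w z)"
    by (rule lebesgue_on_kernel[OF D sub]) (simp add: out)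
  finally have eq: "(LINT z|lebesgue. (partial_deriv b f ((z - x) /\<^sub>R t) / t) *\<^sub>R v z) \<bullet> e
      = - (LINT z|lebesgue. f ((z - x) /\<^sub>R t) *\<^sub>R w z) \<bullet> e"
    by simp
  have li: "set_integrable lebesgue (cball x t) v" "set_integrable lebesgue (cball x t) w"
    using w sub by (auto simp: weak_partial_def locally_integrable_def)
  have c1: "continuous_on UNIV (partial_deriv b f)"
    using C_k_SucD(2)[OF f[of "Suc 0"] b] by simp
  have c2: "continuous_on UNIV f" using f[of 0] by simp
  have "integrable lebesgue (\<lambda>z. (partial_deriv b f ((z - x) /\<^sub>R t) / t) *\<^sub>R v z)"
    using t by (intro kernel_scaleR_integrable[OF _ _ compact_cball li(1)])
      (auto simp: out intro!: continuous_intros continuous_on_compose2[OF c1])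
  moreover have "integrable lebesgue (\<lambda>z. f ((z - x) /\<^sub>R t) *\<^sub>R w z)"
    by (intro kernel_scaleR_integrable[OF _ _ compact_cball li(2)])
      (auto simp: out intro!: continuous_intros continuous_on_compose2[OF c2])
  ultimately have "(LINT z|lebesgue. ((partial_deriv b f ((z - x) /\<^sub>R t) / t) *\<^sub>R v z) \<bullet> e)
      = - (LINT z|lebesgue. (f ((z - x) /\<^sub>R t) *\<^sub>R w z) \<bullet> e)"
    using eq by (subst (1 2) integral_inner_left) auto
  then have "cint (\<lambda>z. v z \<bullet> e) (partial_deriv b f) t x / t = - cint (\<lambda>z. w z \<bullet> e) f t x"
    unfolding cint_def by (simp add: mult.commute)
  then show ?thesis using t by (simp add: field_simps)
qed

lemma cint_lker:
  fixes v :: "'a::euclidean_space \<Rightarrow> real"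
  assumes t: "0 < t" and v: "set_integrable lebesgue (cball x t) v"
  shows "cint v lker t x = (\<Sum>e\<in>Basis. cint v (dprof e e) t x)"
proof -
  have int: "integrable lebesgue (\<lambda>z. v z \<bullet> dprof e e ((z - x) /\<^sub>R t))" for e
    using ex_lip_dprof[of e e] cint_integrable[OF _ t v] by blast
  have "cint v lker t x = (LINT z|lebesgue. (\<Sum>e\<in>Basis. v z \<bullet> dprof e e ((z - x) /\<^sub>R t)))"
    unfolding cint_def lker_eq_divergence by (simp add: sum_distrib_left)
  also have "\<dots> = (\<Sum>e\<in>Basis. cint v (dprof e e) t x)"
    unfolding cint_def by (intro Bochner_Integration.integral_sum int)
  finally show ?thesis .
qed

text \<open>As \<open>lker\<close> is the divergence of the field \<open>z \<psi>(z)\<close>, integration by parts moves one derivative onto \<open>v\<close>.\<close>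

lemma weak_partials_lker:
  fixes v :: "'a::euclidean_space \<Rightarrow> 'b::euclidean_space"
  assumes w: "\<And>b. b \<in> Basis \<Longrightarrow> weak_partial D b v (w b)" and D: "open D"
    and t: "0 < t" and sub: "cball x t \<subseteq> D"
  shows "cint (\<lambda>z. v z \<bullet> e) lker t x = - t * (\<Sum>b\<in>Basis. cint (\<lambda>z. w b z \<bullet> e) (prof b) t x)"
proof -
  obtain b0 :: 'a where "b0 \<in> Basis" using nonempty_Basis by blast
  with w sub have v: "set_integrable lebesgue (cball x t) v"
    unfolding weak_partial_def locally_integrable_def by (meson compact_cball)
  have "cint (\<lambda>z. v z \<bullet> e) (dprof b b) t x = - t * cint (\<lambda>z. w b z \<bullet> e) (prof b) t x" if "b \<in> Basis" for b
    using weak_partial_kernel[OF w[OF that] that D C_k_prof _ t sub, of b]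
    by (simp add: partial_deriv_prof prof_def bump_eq_0 norm_sq_ge_1)
  then show ?thesis
    unfolding cint_lker[OF t set_integrable_inner_left[OF v]] by (simp add: sum_distrib_left)
qed

text \<open>A gradient is curl free. Testing \<open>u\<close> with the mixed derivative of \<open>prof e\<close> in both orders shows that
  \<open>\<partial>\<^sub>iu\<close> against \<open>\<partial>\<^sub>e(prof e)\<close> equals \<open>\<partial>\<^sub>eu\<close> against \<open>\<partial>\<^sub>i(prof e) = \<partial>\<^sub>e(prof i)\<close>; summation over \<open>e\<close> gives the
  claim. The right-hand side has the form in which the equation can be applied.\<close>

lemma gradient_field_lker:
  fixes Du :: "'a::euclidean_space \<Rightarrow> 'a"
  assumes u: "weak_gradient D u Du" and D: "open D" and t: "0 < t" and sub: "cball x t \<subseteq> D"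
    and i: "i \<in> Basis" and Du: "set_integrable lebesgue (cball x t) Du"
  shows "cint (\<lambda>z. Du z \<bullet> i) lker t x = cint Du (gprof i) t x"
proof -
  have "cint (\<lambda>z. Du z \<bullet> i) (dprof e e) t x = cint (\<lambda>z. Du z \<bullet> e) (dprof e i) t x" if e: "e \<in> Basis" for e
  proof -
    have out: "dprof b c z = 0" if "1 \<le> norm z" for b c z :: 'a
      using that by (simp add: dprof_def bump_eq_0 norm_sq_ge_1)
    have "cint u (partial_deriv i (dprof e e)) t x = - t * cint (\<lambda>z. Du z \<bullet> i) (dprof e e) t x"
      using u i weak_partial_kernel[OF _ i D C_k_dprof out t sub, where e = "1::real"] by (auto simp: weak_gradient_def)
    moreover have "cint u (partial_deriv e (dprof i e)) t x = - t * cint (\<lambda>z. Du z \<bullet> e) (dprof i e) t x"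
      using u e weak_partial_kernel[OF _ e D C_k_dprof out t sub, where e = "1::real"] by (auto simp: weak_gradient_def)
    moreover have "dprof i e = dprof e i" by (rule ext) (rule dprof_commute)
    ultimately show ?thesis
      using mixed_partials_dprof[OF i e] t by simp
  qed
  then show ?thesis
    unfolding cint_lker[OF t set_integrable_inner_left[OF Du]] cint_gprof[OF t Du] by simp
qed

text \<open>The test function is \<open>prof i\<close>, rescaled to the ball. Its gradient annihilates constants, so the
  coefficient and the datum may be frozen at arbitrary values \<open>c\<close> and \<open>f\<close>, which need not be values
  of \<open>a\<close> and \<open>F\<close>.\<close>

lemma frozen_identity:
  fixes Du F :: "'a::euclidean_space \<Rightarrow> 'a" and a :: "'a \<Rightarrow> real"
  assumes sol: "weak_solution D a F u Du" and D: "open D" and t: "0 < t" and sub: "cball x t \<subseteq> D"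
    and i: "i \<in> Basis" and Du: "set_integrable lebesgue (cball x t) Du"
    and aDu: "set_integrable lebesgue (cball x t) (\<lambda>z. a z *\<^sub>R Du z)"
    and F: "set_integrable lebesgue (cball x t) F"
  shows "c * cint (\<lambda>z. Du z \<bullet> i) lker t x
    = - cint (\<lambda>z. (a z - c) *\<^sub>R Du z + (F z - f)) (gprof i) t x"
proof -
  obtain C where C: "lip_kernel C (gprof i :: 'a \<Rightarrow> 'a)"
    using ex_lip_kernel_const i by blast
  have grad: "gradient (\<lambda>z. prof i ((z - x) /\<^sub>R t)) z = gprof i ((z - x) /\<^sub>R t) /\<^sub>R t" for z
    unfolding gradient_def partial_deriv_affine[OF C_k_prof] partial_deriv_prof[THEN fun_cong] gprof_def
    by (simp add: scaleR_sum_right divide_inverse mult.commute)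
  have "(LINT z|lebesgue_on D. a z * (Du z \<bullet> gradient (\<lambda>z. prof i ((z - x) /\<^sub>R t)) z))
      = - (LINT z|lebesgue_on D. F z \<bullet> gradient (\<lambda>z. prof i ((z - x) /\<^sub>R t)) z)"
  proof -
    have "(\<lambda>z. prof i ((z - x) /\<^sub>R t)) \<in> test_functions D"
      by (rule kernel_test_function[OF C_k_prof _ t sub]) (simp add: prof_def bump_eq_0 norm_sq_ge_1)
    then show ?thesis using sol unfolding weak_solution_def by blast
  qed
  also have "(LINT z|lebesgue_on D. a z * (Du z \<bullet> gradient (\<lambda>z. prof i ((z - x) /\<^sub>R t)) z))
     = (LINT z|lebesgue. a z * (Du z \<bullet> gradient (\<lambda>z. prof i ((z - x) /\<^sub>R t)) z))"
    by (rule lebesgue_on_kernel[OF D sub]) (simp add: grad lip_kernel_outside[OF C t])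
  also have "\<dots> = cint (\<lambda>z. a z *\<^sub>R Du z) (gprof i) t x / t"
    unfolding grad cint_def by (simp add: divide_inverse mult_ac)
  also have "(LINT z|lebesgue_on D. F z \<bullet> gradient (\<lambda>z. prof i ((z - x) /\<^sub>R t)) z)
     = (LINT z|lebesgue. F z \<bullet> gradient (\<lambda>z. prof i ((z - x) /\<^sub>R t)) z)"
    by (rule lebesgue_on_kernel[OF D sub]) (simp add: grad lip_kernel_outside[OF C t])
  also have "\<dots> = cint F (gprof i) t x / t"
    unfolding grad cint_def by (simp add: divide_inverse mult_ac)
  finally have eq: "cint (\<lambda>z. a z *\<^sub>R Du z) (gprof i) t x = - cint F (gprof i) t x"
    using t by (simp add: field_simps)
  have cst: "set_integrable lebesgue (cball x t) (\<lambda>_. f)"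
    by (rule absolutely_integrable_on_const) simp
  note I = cint_integrable[OF C t]
  have "cint (\<lambda>z. (a z - c) *\<^sub>R Du z + (F z - f)) (gprof i) t x
     = (LINT z|lebesgue. ((a z *\<^sub>R Du z) \<bullet> gprof i ((z - x) /\<^sub>R t) - c * (Du z \<bullet> gprof i ((z - x) /\<^sub>R t)))
         + (F z \<bullet> gprof i ((z - x) /\<^sub>R t) - f \<bullet> gprof i ((z - x) /\<^sub>R t)))"
    unfolding cint_def by (intro Bochner_Integration.integral_cong) (auto simp: inner_simps algebra_simps)
  also have "\<dots> = (cint (\<lambda>z. a z *\<^sub>R Du z) (gprof i) t x - c * cint Du (gprof i) t x)
         + (cint F (gprof i) t x - cint (\<lambda>_. f) (gprof i) t x)"
    unfolding cint_def using I[OF aDu] I[OF Du] I[OF F] I[OF cst] by simp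
  finally have "cint (\<lambda>z. (a z - c) *\<^sub>R Du z + (F z - f)) (gprof i) t x = - c * cint Du (gprof i) t x"
    by (simp add: eq cint_const_gprof[OF t])
  then show ?thesis
    using gradient_field_lker[OF _ D t sub i Du, of u] sol by (simp add: weak_solution_def)
qed

section \<open>Lebesgue points\<close>

definition leb_point :: "('a::euclidean_space \<Rightarrow> real) \<Rightarrow> 'a \<Rightarrow> bool"
  where "leb_point v x \<longleftrightarrow> (\<forall>e>0. \<exists>d>0. \<forall>r. 0 < r \<and> r < d \<longrightarrow>
    (LINT z:cball x r|lebesgue. \<bar>v z - v x\<bar>) \<le> e * r ^ DIM('a))"

text \<open>Changing the sign of the coordinates in \<open>S\<close> carries cubes with lowest corner \<open>x\<close> to cubes with any
  prescribed corner at the image of \<open>x\<close>.\<close>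

definition reflect :: "'a::euclidean_space set \<Rightarrow> 'a \<Rightarrow> 'a"
  where "reflect S z = (\<Sum>b\<in>Basis. ((if b \<in> S then - 1 else 1) * (z \<bullet> b)) *\<^sub>R b)"

lemma reflect_inner: "b \<in> Basis \<Longrightarrow> reflect S z \<bullet> b = (if b \<in> S then - 1 else 1) * (z \<bullet> b)"
  by (simp add: reflect_def)

lemma reflect_reflect: "reflect S (reflect S z) = z"
  by (rule euclidean_eqI) (simp add: reflect_inner)

lemma reflect_measurable [measurable]: "reflect S \<in> lebesgue \<rightarrow>\<^sub>M lebesgue"
  using lebesgue_affine_measurable[of "\<lambda>b. if b \<in> S then - 1 else 1" 0]
  unfolding reflect_def[abs_def] by simp

lemma distr_reflect: "distr lebesgue lebesgue (reflect S) = (lebesgue :: 'a::euclidean_space measure)"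
proof -
  have "(\<Prod>j\<in>(Basis::'a set). \<bar>if j \<in> S then - 1 else (1::real)\<bar>) = 1"
    by (rule prod.neutral) auto
  then show ?thesis
    using lebesgue_affine_euclidean[of "\<lambda>b::'a. if b \<in> S then - 1 else 1" 0]
    unfolding reflect_def[abs_def] by (simp add: density_1)
qed

text \<open>Differentiation of integrals along the cubes with lowest corner \<open>x\<close> is applied to
  \<open>|v - q|\<close> for rational \<open>q\<close> and to its images under the reflections. The countably many exceptional sets
  form a null set. Outside of it the reflected cubes together cover a ball around \<open>x\<close>, and a \<open>q\<close> close to
  \<open>v x\<close> turns the estimate for \<open>|v - q|\<close> into one for \<open>|v - v x|\<close>.\<close>

lemma AE_leb_point:
  fixes v :: "'a::euclidean_space \<Rightarrow> real"
  assumes v: "integrable lebesgue v"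
  shows "AE x in lebesgue. leb_point v x"
proof -
  define f where "f q z = \<bar>v z - real_of_rat q\<bar>" for q z
  have fm: "f q \<in> borel_measurable lebesgue" for q
    using v unfolding f_def[abs_def] by measurable
  have fi: "set_integrable lebesgue S (f q)" if "S \<in> lmeasurable" for q S
  proof -
    have "set_integrable lebesgue S v"
      using v that integrable_mult_indicator[of S lebesgue v] by (auto simp: set_integrable_def fmeasurableD)
    then have "set_integrable lebesgue S (\<lambda>z. v z - real_of_rat q)"
      using that by (intro set_integral_diff absolutely_integrable_on_const)
    then show ?thesis unfolding f_def[abs_def] by (rule set_integrable_abs)
  qed
  have fri: "set_integrable lebesgue (cbox a b) (f q \<circ> reflect S)" for q S a b
  proof -
    have "integrable lebesgue (v \<circ> reflect S)"
      using v by (subst (asm) distr_reflect[of S, symmetric], subst (asm) integrable_distr_eq) (auto simp: comp_def)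
    then have "set_integrable lebesgue (cbox a b) (v \<circ> reflect S)"
      using integrable_mult_indicator[of "cbox a b" lebesgue "v \<circ> reflect S"] by (simp add: set_integrable_def)
    then have "set_integrable lebesgue (cbox a b) (\<lambda>z. (v \<circ> reflect S) z - real_of_rat q)"
      by (intro set_integral_diff absolutely_integrable_on_const) (auto simp: comp_def)
    from set_integrable_abs[OF this] show ?thesis by (simp add: f_def[abs_def] comp_def)
  qed
  have "\<exists>N. negligible N \<and> (\<forall>x e. x \<notin> N \<and> 0 < e \<longrightarrow> (\<exists>d>0. \<forall>h. 0 < h \<and> h < d \<longrightarrow>
      norm (integral (cbox x (x + h *\<^sub>R One)) (f q \<circ> reflect S) /\<^sub>R h ^ DIM('a) - (f q \<circ> reflect S) x) < e))"
    for q S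
    using integrable_ccontinuous_explicit[of "f q \<circ> reflect S"] set_lebesgue_integral_eq_integral(1)[OF fri]
    by (metis (no_types, lifting))
  then obtain N where N: "\<And>q S. negligible (N q S)" and
    NN: "\<And>q S x e. x \<notin> N q S \<Longrightarrow> 0 < e \<Longrightarrow> (\<exists>d>0. \<forall>h. 0 < h \<and> h < d \<longrightarrow>
      norm (integral (cbox x (x + h *\<^sub>R One)) (f q \<circ> reflect S) /\<^sub>R h ^ DIM('a) - (f q \<circ> reflect S) x) < e)"
    by metis
  have "AE x in lebesgue. reflect S x \<notin> N q S" for q S
  proof -
    have "AE x in lebesgue. x \<notin> N q S"
      using N[of q S] by (intro AE_not_in) (simp add: negligible_iff_null_sets)
    then have "AE x in distr lebesgue lebesgue (reflect S). x \<notin> N q S"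
      unfolding distr_reflect .
    then show ?thesis by (rule AE_distrD[rotated]) (rule reflect_measurable)
  qed
  then have "AE x in lebesgue. \<forall>q. \<forall>S\<in>Pow Basis. reflect S x \<notin> N q S"
    by (simp add: AE_all_countable AE_finite_all)
  then show ?thesis
  proof (rule AE_mp, intro AE_I2 impI)
    fix x assume good: "\<forall>q. \<forall>S\<in>Pow Basis. reflect S x \<notin> N q S"
    show "leb_point v x"
      unfolding leb_point_def
    proof (intro allI impI)
      fix e :: real assume e: "0 < e"
      \<comment> \<open>\<open>2 ^ DIM('a)\<close> reflected cubes, on each of which the mean of \<open>|v - q|\<close> is at most \<open>2 * e'\<close>\<close>
      define m where "m = 2 ^ DIM('a) * 2 + measure lebesgue (cball (0::'a) 1)"
      have m: "m > 0" by (simp add: m_def add_pos_nonneg)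
      define e' where "e' = e / m"
      have e': "e' > 0" using e m by (simp add: e'_def)
      obtain q where "v x - e' < real_of_rat q" "real_of_rat q < v x + e'"
        using of_rat_dense[of "v x - e'" "v x + e'"] e' by auto
      then have q: "\<bar>v x - real_of_rat q\<bar> < e'" by linarith
      have "\<forall>S\<in>Pow Basis. \<exists>d>0. \<forall>h. 0 < h \<and> h < d \<longrightarrow>
          norm (integral (cbox (reflect S x) (reflect S x + h *\<^sub>R One)) (f q \<circ> reflect S) /\<^sub>R h ^ DIM('a) - (f q \<circ> reflect S) (reflect S x)) < e'"
        using NN good e' by blast
      then obtain d where d0: "\<And>S. S \<in> Pow Basis \<Longrightarrow> d S > 0" and
        d: "\<And>S h. S \<in> Pow Basis \<Longrightarrow> 0 < h \<Longrightarrow> h < d S \<Longrightarrow> norm (integral (cbox (reflect S x) (reflect S x + h *\<^sub>R One)) (f q \<circ> reflect S) /\<^sub>R h ^ DIM('a) - (f q \<circ> reflect S) (reflect S x)) < e'"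
        by metis
      define d' where "d' = Min (d ` Pow Basis)"
      have d'0: "d' > 0" unfolding d'_def using d0 by (subst Min_gr_iff) auto
      have d': "d' \<le> d S" if "S \<in> Pow Basis" for S
        unfolding d'_def using that by (intro Min_le) auto
      show "\<exists>d>0. \<forall>r. 0 < r \<and> r < d \<longrightarrow> (LINT z:cball x r|lebesgue. \<bar>v z - v x\<bar>) \<le> e * r ^ DIM('a)"
      proof (intro exI[of _ d'] conjI d'0 allI impI)
        fix r assume r: "0 < r \<and> r < d'"
        define Q where "Q S = cbox (reflect S x) (reflect S x + r *\<^sub>R One)" for S
        have one: "(LINT z:reflect S -` Q S|lebesgue. f q z) \<le> r ^ DIM('a) * (2 * e')"
          and onei: "set_integrable lebesgue (reflect S -` Q S) (f q)"
          if S: "S \<in> Pow Basis" for S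
        proof -
          have ind: "indicator (reflect S -` Q S) (reflect S w) = (indicator (Q S) w :: real)" for w
            by (simp add: indicator_def reflect_reflect)
          have mm: "reflect S -` Q S \<in> sets lebesgue"
            using measurable_sets[OF reflect_measurable, of "Q S" S] by (simp add: Q_def)
          have "integrable lebesgue (\<lambda>w. indicator (reflect S -` Q S) (reflect S w) *\<^sub>R f q (reflect S w))"
            using fri[of "reflect S x" "reflect S x + r *\<^sub>R One" q S]
            unfolding ind set_integrable_def Q_def[symmetric] by (simp add: comp_def)
          then have "integrable (distr lebesgue lebesgue (reflect S)) (\<lambda>z. indicator (reflect S -` Q S) z *\<^sub>R f q z)"
            using mm fm[of q] by (subst integrable_distr_eq) auto
          then show "set_integrable lebesgue (reflect S -` Q S) (f q)"
            by (simp add: distr_reflect set_integrable_def)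
          have "(LINT z:reflect S -` Q S|lebesgue. f q z)
            = (LINT z|distr lebesgue lebesgue (reflect S). indicator (reflect S -` Q S) z *\<^sub>R f q z)"
            by (simp add: distr_reflect set_lebesgue_integral_def)
          also have "\<dots> = (LINT w|lebesgue. indicator (Q S) w *\<^sub>R f q (reflect S w))"
            using mm fm[of q] by (subst integral_distr) (auto simp: ind)
          also have "\<dots> = integral (Q S) (f q \<circ> reflect S)"
            using set_lebesgue_integral_eq_integral(2)[OF fri] by (simp add: set_lebesgue_integral_def Q_def comp_def)
          finally have 1: "(LINT z:reflect S -` Q S|lebesgue. f q z) = integral (Q S) (f q \<circ> reflect S)" .
          have "norm (integral (Q S) (f q \<circ> reflect S) /\<^sub>R r ^ DIM('a) - f q x) < e'"
            using d[OF S, of r] d'[OF S] r by (simp add: Q_def reflect_reflect)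
          then have "integral (Q S) (f q \<circ> reflect S) / r ^ DIM('a) < f q x + e'"
            by (simp add: abs_less_iff divide_inverse mult.commute)
          then have "integral (Q S) (f q \<circ> reflect S) / r ^ DIM('a) < 2 * e'"
            using q by (simp add: f_def)
          then show "(LINT z:reflect S -` Q S|lebesgue. f q z) \<le> r ^ DIM('a) * (2 * e')"
            using r by (simp add: 1 field_simps)
        qed
        have cov: "\<exists>S\<in>Pow Basis. z \<in> reflect S -` Q S" if "z \<in> cball x r" for z
        proof (intro bexI)
          let ?S = "{b\<in>Basis. z \<bullet> b < x \<bullet> b}"
          have "\<bar>(z - x) \<bullet> b\<bar> \<le> r" if "b \<in> Basis" for b
            using Basis_le_norm[OF that, of "z - x"] \<open>z \<in> cball x r\<close> by (simp add: dist_norm norm_minus_commute)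
          then show "z \<in> reflect ?S -` Q ?S"
            by (force simp: Q_def mem_box reflect_inner inner_simps abs_le_iff algebra_simps)
        qed auto
        have fci: "set_integrable lebesgue (cball x r) (f q)" by (rule fi) simp
        have "(LINT z:cball x r|lebesgue. f q z) \<le> (LINT z|lebesgue. (\<Sum>S\<in>Pow Basis. indicator (reflect S -` Q S) z *\<^sub>R f q z))"
          unfolding set_lebesgue_integral_def
        proof (rule integral_mono)
          show "integrable lebesgue (\<lambda>z. indicator (cball x r) z *\<^sub>R f q z)"
            using fci by (simp add: set_integrable_def)
          show "integrable lebesgue (\<lambda>z. \<Sum>S\<in>Pow Basis. indicator (reflect S -` Q S) z *\<^sub>R f q z)"
            using onei by (intro Bochner_Integration.integrable_sum) (simp add: set_integrable_def)
          fix z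
          have nn: "0 \<le> indicator (reflect S -` Q S) z *\<^sub>R f q z" for S by (simp add: f_def)
          show "indicator (cball x r) z *\<^sub>R f q z \<le> (\<Sum>S\<in>Pow Basis. indicator (reflect S -` Q S) z *\<^sub>R f q z)"
          proof (cases "z \<in> cball x r")
            case True
            then obtain S where S: "S \<in> Pow Basis" "z \<in> reflect S -` Q S" using cov by blast
            then have "indicator (cball x r) z *\<^sub>R f q z = indicator (reflect S -` Q S) z *\<^sub>R f q z"
              using True by simp
            also have "\<dots> \<le> (\<Sum>S\<in>Pow Basis. indicator (reflect S -` Q S) z *\<^sub>R f q z)"
              using S nn by (intro member_le_sum) auto
            finally show ?thesis .
          next
            case False
            then have "indicator (cball x r) z *\<^sub>R f q z = 0" by simp
            moreover have "0 \<le> (\<Sum>S\<in>Pow Basis. indicator (reflect S -` Q S) z *\<^sub>R f q z)"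
              by (intro sum_nonneg nn)
            ultimately show ?thesis by linarith
          qed
        qed
        also have "\<dots> = (\<Sum>S\<in>Pow Basis. LINT z:reflect S -` Q S|lebesgue. f q z)"
          unfolding set_lebesgue_integral_def
          using onei by (intro Bochner_Integration.integral_sum) (simp add: set_integrable_def)
        also have "\<dots> \<le> (\<Sum>S\<in>Pow (Basis::'a set). r ^ DIM('a) * (2 * e'))"
          by (intro sum_mono one)
        also have "\<dots> = 2 ^ DIM('a) * 2 * e' * r ^ DIM('a)"
          by (simp add: card_Pow)
        finally have A: "(LINT z:cball x r|lebesgue. f q z) \<le> 2 ^ DIM('a) * 2 * e' * r ^ DIM('a)" .
        have cst: "set_integrable lebesgue (cball x r) (\<lambda>_. e')"
          by (rule absolutely_integrable_on_const) simp
        have "set_integrable lebesgue (cball x r) (\<lambda>z. v z - v x)"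
          using v integrable_mult_indicator[of "cball x r" lebesgue v]
          by (intro set_integral_diff absolutely_integrable_on_const) (auto simp: set_integrable_def)
        from set_integrable_abs[OF this]
        have "(LINT z:cball x r|lebesgue. \<bar>v z - v x\<bar>) \<le> (LINT z:cball x r|lebesgue. f q z + e')"
          using q by (intro set_integral_mono set_integral_add(1)[OF fci cst]) (auto simp: f_def)
        also have "\<dots> = (LINT z:cball x r|lebesgue. f q z) + e' * measure lebesgue (cball x r)"
          by (subst set_integral_add(2)[OF fci cst]) (simp add: set_lebesgue_integral_def)
        also have "measure lebesgue (cball x r) = r ^ DIM('a) * measure lebesgue (cball (0::'a) 1)"
          using r content_ball_conv_unit_ball[of r x] by (simp add: content_cball_conv_ball)
        finally have "(LINT z:cball x r|lebesgue. \<bar>v z - v x\<bar>) \<le> m * e' * r ^ DIM('a)"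
          using A by (simp add: m_def algebra_simps)
        then show "(LINT z:cball x r|lebesgue. \<bar>v z - v x\<bar>) \<le> e * r ^ DIM('a)"
          using m by (simp add: e'_def)
      qed
    qed
  qed
qed

section \<open>Kernel averages across scales\<close>

lemma leb_point_cint:
  fixes v k :: "'a::euclidean_space \<Rightarrow> real"
  assumes v: "integrable lebesgue v" and x: "leb_point v x" and k: "lip_kernel C k"
  shows "((\<lambda>t. cint v k t x / t ^ DIM('a)) \<longlongrightarrow> (LINT z|lborel. k z) * v x) (at_right 0)"
proof -
  define I where "I = (LINT z|lborel. k z)"
  have km: "k \<in> borel_measurable borel"
    using lip_kernel_continuous[OF k] by (rule borel_measurable_continuous_onI)
  have vS: "set_integrable lebesgue (cball x t) v" for t
    using v integrable_mult_indicator[of "cball x t" lebesgue v] by (auto simp: set_integrable_def)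
  have cst: "set_integrable lebesgue (cball x t) (\<lambda>_. v x)" for t
    by (rule absolutely_integrable_on_const) simp
  have est: "\<bar>cint v k t x / t ^ DIM('a) - I * v x\<bar> * t ^ DIM('a)
      \<le> C * (LINT z:cball x t|lebesgue. \<bar>v z - v x\<bar>)" if t: "0 < t" for t
  proof -
    have "cint (\<lambda>z. v z - v x) k t x = cint v k t x - cint (\<lambda>_. v x) k t x"
      unfolding cint_def using cint_integrable[OF k t vS] cint_integrable[OF k t cst]
      by (simp add: left_diff_distrib)
    also have "cint (\<lambda>_. v x) k t x = v x * (t ^ DIM('a) * I)"
      using lebesgue_integral_affine[OF km t, of x] by (simp add: cint_def I_def)
    finally have "cint (\<lambda>z. v z - v x) k t x = (cint v k t x / t ^ DIM('a) - I * v x) * t ^ DIM('a)"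
      using t by (simp add: left_diff_distrib)
    then have "\<bar>cint v k t x / t ^ DIM('a) - I * v x\<bar> * t ^ DIM('a) = \<bar>cint (\<lambda>z. v z - v x) k t x\<bar>"
      using t by (simp add: abs_mult)
    also have "\<dots> \<le> C * (LINT z:cball x t|lebesgue. norm (v z - v x))"
      by (rule cint_bound[OF k t set_integral_diff(1)[OF vS cst]])
    finally show ?thesis by simp
  qed
  show ?thesis
    unfolding I_def[symmetric] tendsto_iff
  proof (intro allI impI)
    fix e :: real assume e: "0 < e"
    define e' where "e' = e / (2 * (C + 1))"
    have C: "0 \<le> C" by (rule lip_kernel_nonneg[OF k])
    have e': "0 < e'" using e C by (simp add: e'_def)
    obtain d where d: "0 < d" "\<And>r. 0 < r \<and> r < d \<Longrightarrow> (LINT z:cball x r|lebesgue. \<bar>v z - v x\<bar>) \<le> e' * r ^ DIM('a)"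
      using x e' unfolding leb_point_def by blast
    show "\<forall>\<^sub>F t in at_right 0. dist (cint v k t x / t ^ DIM('a)) (I * v x) < e"
      unfolding eventually_at_right_field
    proof (intro exI[of _ d] conjI d(1) allI impI)
      fix t assume t: "0 < t" "t < d"
      have "\<bar>cint v k t x / t ^ DIM('a) - I * v x\<bar> * t ^ DIM('a) \<le> C * (e' * t ^ DIM('a))"
        using est[OF t(1)] mult_left_mono[OF d(2)[of t] C] t by linarith
      then have "\<bar>cint v k t x / t ^ DIM('a) - I * v x\<bar> \<le> C * e'"
        using t(1) by (simp flip: mult.assoc)
      also have "C * e' < e"
        using e C mult_nonneg_nonneg[of C e] by (simp add: e'_def field_simps add_nonneg_pos)
      finally show "dist (cint v k t x / t ^ DIM('a)) (I * v x) < e"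
        by (simp add: dist_real_def)
    qed
  qed
qed

text \<open>The scale derivative of \<open>t\<^sup>-\<^sup>n \<psi>((z - x)/t)\<close> is \<open>- t\<^sup>-\<^sup>n\<^sup>-\<^sup>1 (n \<psi> + y \<cdot> \<nabla>\<psi>)\<close> at \<open>y = (z - x)/t\<close>, and the bracket
  is the divergence of \<open>y \<psi>(y)\<close>.\<close>

lemma scaled_ker_derivative:
  fixes x z :: "'a::euclidean_space"
  assumes t: "0 < t"
  shows "((\<lambda>t. ker ((z - x) /\<^sub>R t) / t ^ DIM('a)) has_real_derivative
     - (lker ((z - x) /\<^sub>R t) / t ^ (DIM('a) + 1))) (at t)"
proof -
  define s where "s = (z - x) \<bullet> (z - x)"
  define n where "n = DIM('a)"
  have n: "n > 0" by (simp add: n_def)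
  have s: "((z - x) /\<^sub>R t) \<bullet> ((z - x) /\<^sub>R t) = s / t\<^sup>2" for t
    by (simp add: s_def power2_eq_square divide_inverse)
  have d: "((\<lambda>t. s / t\<^sup>2) has_real_derivative - 2 * s / t ^ 3) (at t)"
    using t by (auto intro!: derivative_eq_intros simp: power2_eq_square power3_eq_cube field_simps)
  have "((\<lambda>t. bump 0 (s / t\<^sup>2)) has_real_derivative (- bump 2 (s / t\<^sup>2)) * (- 2 * s / t ^ 3)) (at t)"
    using DERIV_chain2[OF DERIV_bump[of 0 "s / t\<^sup>2"] d] by (simp add: eval_nat_numeral)
  then have "((\<lambda>t. bump 0 (s / t\<^sup>2) / t ^ n) has_real_derivative
     ((- bump 2 (s / t\<^sup>2)) * (- 2 * s / t ^ 3) * t ^ n - bump 0 (s / t\<^sup>2) * (real n * t ^ (n - 1))) / (t ^ n * t ^ n)) (at t)"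
    using t by (intro DERIV_divide) (auto intro!: derivative_eq_intros)
  moreover have "((- bump 2 (s / t\<^sup>2)) * (- 2 * s / t ^ 3) * t ^ n - bump 0 (s / t\<^sup>2) * (real n * t ^ (n - 1))) / (t ^ n * t ^ n)
     = - ((real n * bump 0 (s / t\<^sup>2) - 2 * (s / t\<^sup>2) * bump 2 (s / t\<^sup>2)) / t ^ (n + 1))"
  proof -
    have e: "t ^ n = t * t ^ (n - 1)" "t ^ (n + 1) = t * (t * t ^ (n - 1))"
      using n by (cases n; simp)+
    have alg: "((- b2) * (- 2 * s / t ^ 3) * (t * P) - b0 * (real n * P)) / (t * P * (t * P))
        = - ((real n * b0 - 2 * (s / t\<^sup>2) * b2) / (t * (t * P)))" if "0 < P" for P b0 b2 :: real
      using t that by (simp add: divide_simps power2_eq_square power3_eq_cube) (simp add: algebra_simps)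
    show ?thesis
      unfolding e by (rule alg) (use t in simp)
  qed
  ultimately show ?thesis
    unfolding ker_def lker_def s by (simp add: n_def)
qed

text \<open>Differentiation under the integral. On \<open>{t/2<..}\<close> the scaled kernel is Lipschitz continuous in the
  scale, uniformly in \<open>z\<close>, which dominates the difference quotients.\<close>

lemma cint_derivative:
  fixes v :: "'a::euclidean_space \<Rightarrow> real"
  assumes v: "integrable lebesgue v" and t: "0 < t"
  shows "((\<lambda>t. cint v ker t x / t ^ DIM('a)) has_real_derivative
     - (cint v lker t x / t ^ (DIM('a) + 1))) (at t)"
proof -
  define n where "n = DIM('a)"
  obtain C where Ck: "lip_kernel C (ker :: 'a \<Rightarrow> real)" and Cl: "lip_kernel C (lker :: 'a \<Rightarrow> real)"
    using ex_lip_kernel_const by blast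
  have C: "0 \<le> C" by (rule lip_kernel_nonneg[OF Ck])
  have vS: "set_integrable lebesgue (cball x t) v" for t
    using v integrable_mult_indicator[of "cball x t" lebesgue v] by (auto simp: set_integrable_def)
  define G where "G s z = ker ((z - x) /\<^sub>R s) / s ^ n" for s z
  \<comment> \<open>a bound for the scale derivative on \<open>{t/2<..}\<close>\<close>
  define L where "L = C / (t / 2) ^ (n + 1)"
  have Gd: "((\<lambda>s. G s z) has_real_derivative - (lker ((z - x) /\<^sub>R s) / s ^ (n + 1))) (at s)" if "0 < s" for s z
    unfolding G_def n_def by (rule scaled_ker_derivative[OF that])
  have Gl: "\<bar>G s z - G t z\<bar> \<le> L * \<bar>s - t\<bar>" if "t / 2 < s" for s z
  proof -
    have "norm (G s z - G t z) \<le> L * norm (s - t)"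
    proof (rule field_differentiable_bound[of "{t/2<..}"])
      fix r assume r: "r \<in> {t/2<..}"
      then have r0: "0 < r" using t by simp
      show "((\<lambda>s. G s z) has_field_derivative - (lker ((z - x) /\<^sub>R r) / r ^ (n + 1))) (at r within {t / 2<..})"
        by (rule has_field_derivative_at_within[OF Gd[OF r0]])
      have "norm (lker ((z - x) /\<^sub>R r)) / r ^ (n + 1) \<le> C / (t / 2) ^ (n + 1)"
        using r t r0 by (intro frac_le lip_kernel_bounded[OF Cl] power_mono C) auto
      then show "norm (- (lker ((z - x) /\<^sub>R r) / r ^ (n + 1))) \<le> L"
        using r0 by (simp add: L_def)
    qed (use that t in auto)
    then show ?thesis by simp
  qed
  have Gi: "integrable lebesgue (\<lambda>z. v z * G s z)" if "0 < s" for s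
    using cint_integrable[OF Ck that vS] by (simp add: G_def)
  have GV: "(LINT z|lebesgue. v z * G s z) = cint v ker s x / s ^ n" for s
    by (simp add: G_def cint_def)
  have "((\<lambda>s. (cint v ker s x / s ^ n - cint v ker t x / t ^ n) / (s - t)) \<longlongrightarrow> - (cint v lker t x / t ^ (n + 1))) (at t)"
    unfolding tendsto_at_iff_sequentially
  proof (intro allI impI)
    fix X :: "nat \<Rightarrow> real" assume X: "\<forall>i. X i \<in> UNIV - {t}" and lim: "X \<longlonglongrightarrow> t"
    obtain N where N: "\<And>i. N \<le> i \<Longrightarrow> t / 2 < X i"
      using order_tendstoD(1)[OF lim, of "t / 2"] t unfolding eventually_sequentially by auto
    define Y where "Y i = X (i + N)" for i
    have Y: "t / 2 < Y i" "Y i \<noteq> t" "0 < Y i" for i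
      using N[of "i + N"] X t by (auto simp: Y_def)
    have Ylim: "Y \<longlonglongrightarrow> t" using LIMSEQ_ignore_initial_segment[OF lim] by (simp add: Y_def[abs_def])
    have "(\<lambda>i. LINT z|lebesgue. v z * ((G (Y i) z - G t z) / (Y i - t)))
      \<longlonglongrightarrow> (LINT z|lebesgue. v z * - (lker ((z - x) /\<^sub>R t) / t ^ (n + 1)))"
    proof (rule integral_dominated_convergence)
      show "integrable lebesgue (\<lambda>z. \<bar>v z\<bar> * L)" using v by simp
      show "(\<lambda>z. v z * - (lker ((z - x) /\<^sub>R t) / t ^ (n + 1))) \<in> borel_measurable lebesgue"
        using v lip_kernel_measurable[OF Cl, where x = x and t = t] by measurable
      show "(\<lambda>z. v z * ((G (Y i) z - G t z) / (Y i - t))) \<in> borel_measurable lebesgue" for i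
        unfolding G_def using v lip_kernel_measurable[OF Ck, where x = x and t = t] lip_kernel_measurable[OF Ck, where x = x and t = "Y i"]
        by measurable
      show "AE z in lebesgue. (\<lambda>i. v z * ((G (Y i) z - G t z) / (Y i - t))) \<longlonglongrightarrow> v z * - (lker ((z - x) /\<^sub>R t) / t ^ (n + 1))"
      proof (intro AE_I2 tendsto_mult tendsto_const)
        fix z
        have "((\<lambda>s. (G s z - G t z) / (s - t)) \<longlongrightarrow> - (lker ((z - x) /\<^sub>R t) / t ^ (n + 1))) (at t)"
          using Gd[OF t, of z] by (simp add: has_field_derivative_iff)
        moreover have "filterlim Y (at t) sequentially"
          unfolding filterlim_at using Ylim Y by auto
        ultimately show "(\<lambda>i. (G (Y i) z - G t z) / (Y i - t)) \<longlonglongrightarrow> - (lker ((z - x) /\<^sub>R t) / t ^ (n + 1))"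
          by (rule filterlim_compose)
      qed
      show "AE z in lebesgue. norm (v z * ((G (Y i) z - G t z) / (Y i - t))) \<le> \<bar>v z\<bar> * L" for i
      proof (rule AE_I2)
        fix z
        have "\<bar>(G (Y i) z - G t z) / (Y i - t)\<bar> \<le> L"
          using Gl[OF Y(1)[of i], of z] Y(2)[of i] by (simp add: divide_simps)
        then show "norm (v z * ((G (Y i) z - G t z) / (Y i - t))) \<le> \<bar>v z\<bar> * L"
          by (simp only: real_norm_def abs_mult) (rule mult_left_mono, auto)
      qed
    qed
    moreover have "(LINT z|lebesgue. v z * ((G (Y i) z - G t z) / (Y i - t)))
       = (cint v ker (Y i) x / Y i ^ n - cint v ker t x / t ^ n) / (Y i - t)" for i
    proof -
      have "(LINT z|lebesgue. v z * ((G (Y i) z - G t z) / (Y i - t)))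
        = (LINT z|lebesgue. (v z * G (Y i) z - v z * G t z) / (Y i - t))"
        by (simp add: right_diff_distrib)
      also have "\<dots> = ((LINT z|lebesgue. v z * G (Y i) z) - (LINT z|lebesgue. v z * G t z)) / (Y i - t)"
        using Gi[OF Y(3)[of i]] Gi[OF t] by simp
      finally show ?thesis by (simp add: GV)
    qed
    moreover have "(LINT z|lebesgue. v z * - (lker ((z - x) /\<^sub>R t) / t ^ (n + 1))) = - (cint v lker t x / t ^ (n + 1))"
      by (simp add: cint_def)
    ultimately have "(\<lambda>i. (cint v ker (Y i) x / Y i ^ n - cint v ker t x / t ^ n) / (Y i - t))
       \<longlonglongrightarrow> - (cint v lker t x / t ^ (n + 1))" by (simp only:)
    then show "((\<lambda>s. (cint v ker s x / s ^ n - cint v ker t x / t ^ n) / (s - t)) \<circ> X) \<longlonglongrightarrow> - (cint v lker t x / t ^ (n + 1))"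
      unfolding Y_def comp_def by (rule LIMSEQ_offset)
  qed
  then show ?thesis by (simp add: has_field_derivative_iff n_def)
qed

text \<open>Both \<open>A t\<^sup>p / p - f\<close> and \<open>A t\<^sup>p / p + f\<close> are nondecreasing. The exponent may be negative: the case
  \<open>p = \<gamma> - 1\<close> is used for the large scales.\<close>

lemma power_growth_bound:
  fixes f f' :: "real \<Rightarrow> real"
  assumes p: "p \<noteq> 0" and sr: "0 < s" "s \<le> r"
    and f: "\<And>t. s \<le> t \<Longrightarrow> t \<le> r \<Longrightarrow> (f has_real_derivative f' t) (at t)"
    and b: "\<And>t. s \<le> t \<Longrightarrow> t \<le> r \<Longrightarrow> \<bar>f' t\<bar> \<le> A * t powr (p - 1)"
  shows "\<bar>f r - f s\<bar> \<le> A * (r powr p - s powr p) / p"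
proof -
  have d: "((\<lambda>t. A * t powr p / p) has_real_derivative A * t powr (p - 1)) (at t)" if "s \<le> t" for t
    using that sr p by (auto intro!: derivative_eq_intros)
  have "(\<lambda>t. A * t powr p / p - f t) s \<le> (\<lambda>t. A * t powr p / p - f t) r"
  proof (rule DERIV_nonneg_imp_nondecreasing[OF sr(2)])
    fix t assume t: "s \<le> t" "t \<le> r"
    have "((\<lambda>t. A * t powr p / p - f t) has_real_derivative (A * t powr (p - 1) - f' t)) (at t)"
      by (intro DERIV_diff d f t)
    then show "\<exists>y. ((\<lambda>t. A * t powr p / p - f t) has_real_derivative y) (at t) \<and> 0 \<le> y"
      using b[OF t] by (intro exI conjI) (auto simp: abs_le_iff)
  qed
  moreover have "(\<lambda>t. A * t powr p / p + f t) s \<le> (\<lambda>t. A * t powr p / p + f t) r"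
  proof (rule DERIV_nonneg_imp_nondecreasing[OF sr(2)])
    fix t assume t: "s \<le> t" "t \<le> r"
    have "((\<lambda>t. A * t powr p / p + f t) has_real_derivative (A * t powr (p - 1) + f' t)) (at t)"
      by (intro DERIV_add d f t)
    then show "\<exists>y. ((\<lambda>t. A * t powr p / p + f t) has_real_derivative y) (at t) \<and> 0 \<le> y"
      using b[OF t] by (intro exI conjI) (auto simp: abs_le_iff)
  qed
  ultimately show ?thesis
    by (simp add: right_diff_distrib diff_divide_distrib abs_le_iff)
qed

lemma cint_scale_bound:
  fixes v :: "'a::euclidean_space \<Rightarrow> real"
  assumes v: "integrable lebesgue v" and \<gamma>: "\<gamma> \<noteq> 0" and sr: "0 < s" "s \<le> r"
    and b: "\<And>t. s \<le> t \<Longrightarrow> t \<le> r \<Longrightarrow> \<bar>cint v lker t x\<bar> \<le> A * t powr (real DIM('a) + \<gamma>)"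
  shows "\<bar>cint v ker r x / r ^ DIM('a) - cint v ker s x / s ^ DIM('a)\<bar> \<le> A * (r powr \<gamma> - s powr \<gamma>) / \<gamma>"
proof (rule power_growth_bound[OF \<gamma> sr])
  fix t assume t: "s \<le> t" "t \<le> r"
  then have t0: "0 < t" using sr by simp
  show "((\<lambda>t. cint v ker t x / t ^ DIM('a)) has_real_derivative - (cint v lker t x / t ^ (DIM('a) + 1))) (at t)"
    by (rule cint_derivative[OF v t0])
  have "\<bar>cint v lker t x\<bar> / t ^ (DIM('a) + 1) \<le> A * t powr (real DIM('a) + \<gamma>) / t ^ (DIM('a) + 1)"
    using b[OF t] t0 by (intro divide_right_mono) auto
  also have "t ^ (DIM('a) + 1) = t powr (real DIM('a) + 1)"
    using t0 powr_realpow[of t "DIM('a) + 1"] by (simp add: add.commute)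
  also have "A * t powr (real DIM('a) + \<gamma>) / t powr (real DIM('a) + 1) = A * t powr (\<gamma> - 1)"
    using t0 by (simp add: powr_diff[symmetric] flip: times_divide_eq_right)
  finally show "\<bar>- (cint v lker t x / t ^ (DIM('a) + 1))\<bar> \<le> A * t powr (\<gamma> - 1)"
    using t0 powr_realpow[of t "DIM('a) + 1"] by (simp add: add.commute)
qed

lemma cint_limit_bound:
  fixes v :: "'a::euclidean_space \<Rightarrow> real"
  assumes v: "integrable lebesgue v" and x: "leb_point v x" and \<gamma>: "0 < \<gamma>" and r: "0 < r" and A: "0 \<le> A"
    and b: "\<And>t. 0 < t \<Longrightarrow> t \<le> r \<Longrightarrow> \<bar>cint v lker t x\<bar> \<le> A * t powr (real DIM('a) + \<gamma>)"
  shows "\<bar>cint v ker r x / r ^ DIM('a) - (LINT z|lborel. ker (z::'a)) * v x\<bar> \<le> A * r powr \<gamma> / \<gamma>"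
proof -
  obtain C where C: "lip_kernel C (ker :: 'a \<Rightarrow> real)" using ex_lip_kernel_const by blast
  have "((\<lambda>s. \<bar>cint v ker r x / r ^ DIM('a) - cint v ker s x / s ^ DIM('a)\<bar>) \<longlongrightarrow>
     \<bar>cint v ker r x / r ^ DIM('a) - (LINT z|lborel. ker (z::'a)) * v x\<bar>) (at_right 0)"
    by (intro tendsto_intros leb_point_cint[OF v x C])
  moreover have "\<forall>\<^sub>F s in at_right 0. \<bar>cint v ker r x / r ^ DIM('a) - cint v ker s x / s ^ DIM('a)\<bar> \<le> A * r powr \<gamma> / \<gamma>"
    unfolding eventually_at_right_field
  proof (intro exI[of _ r] conjI r allI impI)
    fix s assume s: "0 < s" "s < r"
    have "\<bar>cint v ker r x / r ^ DIM('a) - cint v ker s x / s ^ DIM('a)\<bar> \<le> A * (r powr \<gamma> - s powr \<gamma>) / \<gamma>"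
      using s \<gamma> b by (intro cint_scale_bound[OF v]) auto
    also have "\<dots> \<le> A * r powr \<gamma> / \<gamma>"
      using \<gamma> A by (intro divide_right_mono mult_left_mono) auto
    finally show "\<bar>cint v ker r x / r ^ DIM('a) - cint v ker s x / s ^ DIM('a)\<bar> \<le> A * r powr \<gamma> / \<gamma>" .
  qed
  ultimately show ?thesis
    by (intro tendsto_upperbound[of _ _ "at_right (0::real)"]) auto
qed

text \<open>Averages at the two points are compared at the scale \<open>r = |x - y|\<close>. Below \<open>r\<close> the scale derivative
  is integrated at each point separately, which costs \<open>A / \<gamma>\<close> and \<open>A' / \<gamma>\<close>. From \<open>r\<close> to \<open>R\<close> the difference of the
  two averages is followed; its derivative carries the extra factor \<open>r / t\<close>, so the integral
  converges at the lower end precisely because \<open>\<gamma> < 1\<close>. At the scale \<open>R\<close> the kernel itself is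
  Lipschitz continuous.\<close>

lemma kernel_holder:
  fixes v :: "'a::euclidean_space \<Rightarrow> real"
  assumes v: "integrable lebesgue v" and x: "leb_point v x" and y: "leb_point v y"
    and \<gamma>: "0 < \<gamma>" "\<gamma> < 1" and R: "0 < R" "R \<le> 1" and xy: "norm (x - y) \<le> R"
    and C: "lip_kernel C (ker :: 'a \<Rightarrow> real)" and nn: "0 \<le> A" "0 \<le> A'" "0 \<le> B"
    and hx: "\<And>t. 0 < t \<Longrightarrow> t \<le> R \<Longrightarrow> \<bar>cint v lker t x\<bar> \<le> A * t powr (real DIM('a) + \<gamma>)"
    and hy: "\<And>t. 0 < t \<Longrightarrow> t \<le> R \<Longrightarrow> \<bar>cint v lker t y\<bar> \<le> A' * t powr (real DIM('a) + \<gamma>)"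
    and hxy: "\<And>t. 0 < t \<Longrightarrow> norm (x - y) \<le> t \<Longrightarrow> t \<le> R \<Longrightarrow>
      \<bar>cint v lker t x - cint v lker t y\<bar> \<le> B * norm (x - y) * t powr (real DIM('a) + \<gamma> - 1)"
  shows "(LINT z|lborel. ker (z::'a)) * \<bar>v x - v y\<bar> \<le> (A / \<gamma> + A' / \<gamma> + B / (1 - \<gamma>)
    + C / R ^ (DIM('a) + 1) * (LINT z|lebesgue. \<bar>v z\<bar>)) * norm (x - y) powr \<gamma>"
proof (cases "x = y")
  case False
  define E where "E = C / R ^ (DIM('a) + 1) * (LINT z|lebesgue. \<bar>v z\<bar>)"
  have C0: "0 \<le> C" by (rule lip_kernel_nonneg[OF C])
  then have E: "0 \<le> E" using R by (simp add: E_def)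
  have hR: "\<bar>cint v ker R x / R ^ DIM('a) - cint v ker R y / R ^ DIM('a)\<bar> \<le> E * norm (x - y)"
  proof -
    have S: "set_integrable lebesgue S v" if "S \<in> sets lebesgue" for S
      using v that unfolding set_integrable_def by (intro integrable_mult_indicator)
    have "(LINT z:cball x (2 * R)|lebesgue. norm (v z)) \<le> (LINT z|lebesgue. \<bar>v z\<bar>)"
      unfolding set_lebesgue_integral_def
    proof (rule integral_mono)
      show "integrable lebesgue (\<lambda>z. indicator (cball x (2 * R)) z *\<^sub>R norm (v z))"
        using v by (intro integrable_mult_indicator integrable_norm) auto
    qed (use v in \<open>auto simp: indicator_def\<close>)
    then have "C * (norm (x - y) / R) * (LINT z:cball x (2 * R)|lebesgue. norm (v z))
        \<le> C * (norm (x - y) / R) * (LINT z|lebesgue. \<bar>v z\<bar>)"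
      using C0 R by (intro mult_left_mono) auto
    with cint_diff_bound[OF C R(1) S xy]
    have "\<bar>cint v ker R x - cint v ker R y\<bar> \<le> C * (norm (x - y) / R) * (LINT z|lebesgue. \<bar>v z\<bar>)"
      by (meson fmeasurableD lmeasurable_cball order_trans)
    then have "\<bar>cint v ker R x - cint v ker R y\<bar> / R ^ DIM('a) \<le> (C * (norm (x - y) / R) * (LINT z|lebesgue. \<bar>v z\<bar>)) / R ^ DIM('a)"
      using R by (intro divide_right_mono) auto
    then show ?thesis
      using R by (simp add: E_def mult_ac flip: diff_divide_distrib)
  qed
  define r where "r = norm (x - y)"
  have r: "0 < r" "r \<le> R" using False xy by (auto simp: r_def)
  define I where "I = (LINT z|lborel. ker (z::'a))"
  define n where "n = DIM('a)"
  define V where "V t x = cint v ker t x / t ^ n" for t x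
  \<comment> \<open>the scales below \<open>r\<close>\<close>
  have 1: "\<bar>V r x - I * v x\<bar> \<le> A * r powr \<gamma> / \<gamma>"
    unfolding V_def n_def I_def using r hx \<gamma> nn by (intro cint_limit_bound[OF v x]) auto
  have 2: "\<bar>V r y - I * v y\<bar> \<le> A' * r powr \<gamma> / \<gamma>"
    unfolding V_def n_def I_def using r hy \<gamma> nn by (intro cint_limit_bound[OF v y]) auto
  \<comment> \<open>the scales between \<open>r\<close> and \<open>R\<close>; the power \<open>\<gamma> - 1\<close> is negative\<close>
  have "\<bar>(V R x - V R y) - (V r x - V r y)\<bar> \<le> (B * r) * (R powr (\<gamma> - 1) - r powr (\<gamma> - 1)) / (\<gamma> - 1)"
  proof (rule power_growth_bound)
    fix t assume t: "r \<le> t" "t \<le> R"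
    then have t0: "0 < t" using r by simp
    show "((\<lambda>t. V t x - V t y) has_real_derivative - (cint v lker t x / t ^ (n + 1)) - - (cint v lker t y / t ^ (n + 1))) (at t)"
      unfolding V_def n_def by (intro DERIV_diff cint_derivative v t0)
    have "\<bar>cint v lker t x - cint v lker t y\<bar> / t ^ (n + 1) \<le> B * r * t powr (real n + \<gamma> - 1) / t ^ (n + 1)"
      using hxy[OF t0] t t0 by (intro divide_right_mono) (auto simp: r_def n_def)
    also have "t ^ (n + 1) = t powr (real n + 1)"
      using t0 powr_realpow[of t "n + 1"] by (simp add: add.commute)
    also have "B * r * t powr (real n + \<gamma> - 1) / t powr (real n + 1) = B * r * t powr (\<gamma> - 1 - 1)"
      using t0 by (simp add: powr_diff[symmetric] flip: times_divide_eq_right)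
    finally have "\<bar>cint v lker t x - cint v lker t y\<bar> / t ^ (n + 1) \<le> B * r * t powr (\<gamma> - 1 - 1)"
      using t0 powr_realpow[of t "n + 1"] by (simp add: add.commute)
    moreover have "- (cint v lker t x / t ^ (n + 1)) - - (cint v lker t y / t ^ (n + 1))
        = - ((cint v lker t x - cint v lker t y) / t ^ (n + 1))"
      by (simp add: diff_divide_distrib)
    ultimately show "\<bar>- (cint v lker t x / t ^ (n + 1)) - - (cint v lker t y / t ^ (n + 1))\<bar> \<le> B * r * t powr (\<gamma> - 1 - 1)"
      using t0 by simp
  qed (use r \<gamma> in auto)
  also have "\<dots> = (B * r) * (r powr (\<gamma> - 1) - R powr (\<gamma> - 1)) / (1 - \<gamma>)"
    using \<gamma> by (simp add: field_simps)
  also have "\<dots> \<le> (B * r) * r powr (\<gamma> - 1) / (1 - \<gamma>)"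
    using \<gamma> nn r by (intro divide_right_mono mult_left_mono) auto
  also have "\<dots> = B / (1 - \<gamma>) * r powr \<gamma>"
    using r by (simp add: powr_diff)
  finally have 3: "\<bar>(V R x - V R y) - (V r x - V r y)\<bar> \<le> B / (1 - \<gamma>) * r powr \<gamma>" .
  have "r powr 1 \<le> r powr \<gamma>"
    using r R \<gamma> by (intro powr_mono') auto
  then have "E * r \<le> E * r powr \<gamma>" using E r by (intro mult_left_mono) auto
  then have 4: "\<bar>V R x - V R y\<bar> \<le> E * r powr \<gamma>"
    using hR by (simp add: V_def n_def r_def)
  have "I \<ge> 0" unfolding I_def ker_def by (intro Bochner_Integration.integral_nonneg bump_nonneg)
  then have "I * \<bar>v x - v y\<bar> = \<bar>I * v x - I * v y\<bar>" by (simp add: abs_mult flip: right_diff_distrib)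
  also have "\<dots> \<le> A * r powr \<gamma> / \<gamma> + A' * r powr \<gamma> / \<gamma> + B / (1 - \<gamma>) * r powr \<gamma> + E * r powr \<gamma>"
    using 1 2 3 4 by linarith
  also have "\<dots> = (A / \<gamma> + A' / \<gamma> + B / (1 - \<gamma>) + E) * norm (x - y) powr \<gamma>"
    by (simp add: r_def distrib_right)
  finally show ?thesis by (simp add: I_def E_def)
qed simp

text \<open>The averages are not normalised, so this integral appears as a factor wherever they converge.\<close>

lemma ker_integral_pos: "0 < (LINT z|lborel. ker (z::'a::euclidean_space))"
proof -
  obtain C where C: "lip_kernel C (ker :: 'a \<Rightarrow> real)" using ex_lip_kernel_const by blast
  define m where "m = exp (- 2 :: real)"
  have ker_ge: "m * indicator (ball 0 (1 / 2)) z \<le> ker z" for z :: 'a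
  proof (cases "norm z < 1 / 2")
    case True
    then have "(norm z)\<^sup>2 \<le> (1 / 2)\<^sup>2" by (intro power_mono) auto
    then have "z \<bullet> z \<le> 1 / 4" by (simp add: power2_norm_eq_inner power_divide)
    then have "1 / (1 - z \<bullet> z) \<le> 2" by (simp add: divide_simps)
    then show ?thesis using True \<open>z \<bullet> z \<le> 1 / 4\<close> by (simp add: ker_def bump_def m_def)
  qed (simp add: ker_def bump_nonneg)
  have fin: "emeasure lborel (ball (0::'a) (1 / 2)) < \<infinity>"
    using emeasure_lborel_ball_finite by blast
  have i1: "integrable lborel (\<lambda>z::'a. m * indicator (ball 0 (1 / 2)) z)"
    using fin by (intro integrable_mult_right integrable_real_indicator) auto
  have i2: "integrable lborel (ker :: 'a \<Rightarrow> real)"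
  proof (rule Bochner_Integration.integrable_bound)
    show "integrable lborel (\<lambda>z::'a. C * indicator (cball 0 1) z)"
      using emeasure_lborel_cball_finite[of "0::'a" 1]
      by (intro integrable_mult_right integrable_real_indicator) auto
    show "AE z in lborel. norm (ker z) \<le> norm (C * indicator (cball (0::'a) 1) z)"
    proof (rule AE_I2)
      fix z :: 'a show "norm (ker z) \<le> norm (C * indicator (cball 0 1) z)"
        using C lip_kernel_bounded[OF C, of z] by (auto simp: lip_kernel_def indicator_def)
    qed
    show "(ker :: 'a \<Rightarrow> real) \<in> borel_measurable lborel"
      using borel_measurable_continuous_onI[OF lip_kernel_continuous[OF C]] by simp
  qed
  have "0 < m * measure lborel (ball (0::'a) (1 / 2))"
    using content_ball_pos[of "1/2" "0::'a"] by (simp add: m_def)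
  also have "\<dots> = (LINT z|lborel. m * indicator (ball (0::'a) (1 / 2)) z)"
    by simp
  also have "\<dots> \<le> (LINT z|lborel. ker (z::'a))"
    by (rule integral_mono[OF i1 i2 ker_ge])
  finally show ?thesis .
qed

section \<open>Freezing the coefficient\<close>

lemma integrable_imp_set_integrable:
  fixes f :: "'a::euclidean_space \<Rightarrow> 'b::euclidean_space"
  shows "integrable lebesgue f \<Longrightarrow> S \<in> sets lebesgue \<Longrightarrow> set_integrable lebesgue S f"
  unfolding set_integrable_def by (rule integrable_mult_indicator)

lemma set_integral_mono_set_nonneg:
  fixes f :: "'a::euclidean_space \<Rightarrow> real"
  assumes "set_integrable lebesgue T f" "S \<subseteq> T" "S \<in> sets lebesgue" "\<And>z. 0 \<le> f z"
  shows "(LINT z:S|lebesgue. f z) \<le> (LINT z:T|lebesgue. f z)"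
  unfolding set_lebesgue_integral_def
proof (rule integral_mono)
  show "integrable lebesgue (\<lambda>z. indicator S z *\<^sub>R f z)"
    using set_integrable_subset[OF assms(1,3,2)] by (simp add: set_integrable_def)
  show "integrable lebesgue (\<lambda>z. indicator T z *\<^sub>R f z)"
    using assms(1) by (simp add: set_integrable_def)
  show "indicator S z *\<^sub>R f z \<le> indicator T z *\<^sub>R f z" for z
    using assms(2,4) by (auto simp: indicator_def)
qed

text \<open>A Morrey condition at a single point. Both decay of oscillations (\<open>p\<close> above the dimension) and
  fractional maximal bounds (\<open>p\<close> below it) are of this kind.\<close>

definition ball_growth :: "('a::euclidean_space \<Rightarrow> real) \<Rightarrow> real \<Rightarrow> real \<Rightarrow> real \<Rightarrow> 'a \<Rightarrow> bool"
  where "ball_growth w p H R x \<longleftrightarrow>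
    (\<forall>\<rho>. 0 < \<rho> \<and> \<rho> \<le> R \<longrightarrow> (LINT z:cball x \<rho>|lebesgue. w z) \<le> H * \<rho> powr p)"

lemma ball_growth_mono: "ball_growth w p H R x \<Longrightarrow> H \<le> H' \<Longrightarrow> R' \<le> R \<Longrightarrow> ball_growth w p H' R' x"
  unfolding ball_growth_def by (meson mult_right_mono order_trans powr_ge_zero)

lemma shift_norm_integrable:
  fixes f :: "'a::euclidean_space \<Rightarrow> 'b::euclidean_space"
  assumes "integrable lebesgue f" "S \<in> lmeasurable"
  shows "set_integrable lebesgue S (\<lambda>z. norm (f z - c))"
  using assms
  by (intro set_integrable_norm set_integral_diff integrable_imp_set_integrable absolutely_integrable_on_const) auto

text \<open>The equation is used only through the identity \<open>frozen\<close>. The set \<open>K\<close> is where it is available; outside of it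
  \<open>Du\<close> and \<open>F\<close> may be cut off, and therefore they can be taken to be integrable on the whole space.\<close>

locale frozen_equation =
  fixes K :: "'a::euclidean_space set" and a :: "'a \<Rightarrow> real" and Du F :: "'a \<Rightarrow> 'a"
    and lam C :: real
  assumes Du: "integrable lebesgue Du" and F: "integrable lebesgue F"
    and aDu: "integrable lebesgue (\<lambda>z. a z *\<^sub>R Du z)"
    and lam: "0 < lam"
    and ker: "lip_kernel C (ker :: 'a \<Rightarrow> real)" and lker: "lip_kernel C (lker :: 'a \<Rightarrow> real)"
    and gprof: "\<And>i. i \<in> Basis \<Longrightarrow> lip_kernel C (gprof i :: 'a \<Rightarrow> 'a)"
    and frozen: "\<And>i x t c f. i \<in> Basis \<Longrightarrow> 0 < t \<Longrightarrow> cball x t \<subseteq> K \<Longrightarrow>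
      c * cint (\<lambda>z. Du z \<bullet> i) lker t x = - cint (\<lambda>z. (a z - c) *\<^sub>R Du z + (F z - f)) (gprof i) t x"
begin

text \<open>The size of the right-hand side of \<open>frozen\<close>, up to the kernel.\<close>

definition err :: "real \<Rightarrow> 'a \<Rightarrow> 'a set \<Rightarrow> real"
  where "err c f S = (LINT z:S|lebesgue. \<bar>a z - c\<bar> * norm (Du z) + norm (F z - f))"

lemma C_nonneg: "0 \<le> C"
  by (rule lip_kernel_nonneg[OF ker])

lemma flux_integrable:
  "S \<in> lmeasurable \<Longrightarrow> set_integrable lebesgue S (\<lambda>z. (a z - c) *\<^sub>R Du z + (F z - f))"
  "S \<in> lmeasurable \<Longrightarrow> set_integrable lebesgue S (\<lambda>z. \<bar>a z - c\<bar> * norm (Du z) + norm (F z - f))"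
proof -
  assume S: "S \<in> lmeasurable"
  then have Ss: "S \<in> sets lebesgue" by auto
  have "integrable lebesgue (\<lambda>z. a z *\<^sub>R Du z - c *\<^sub>R Du z)"
    using Du aDu by simp
  then have 1: "integrable lebesgue (\<lambda>z. (a z - c) *\<^sub>R Du z)"
    by (simp add: scaleR_diff_left)
  have 2: "set_integrable lebesgue S (\<lambda>z. F z - f)"
    using S by (intro set_integral_diff integrable_imp_set_integrable[OF F] Ss absolutely_integrable_on_const)
  show "set_integrable lebesgue S (\<lambda>z. (a z - c) *\<^sub>R Du z + (F z - f))"
    by (intro set_integral_add integrable_imp_set_integrable[OF 1] Ss 2)
  have "set_integrable lebesgue S (\<lambda>z. norm ((a z - c) *\<^sub>R Du z) + norm (F z - f))"
    by (intro set_integral_add set_integrable_norm integrable_imp_set_integrable[OF 1] Ss 2)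
  then show "set_integrable lebesgue S (\<lambda>z. \<bar>a z - c\<bar> * norm (Du z) + norm (F z - f))"
    by simp
qed

lemma err_mono: "S \<subseteq> T \<Longrightarrow> S \<in> lmeasurable \<Longrightarrow> T \<in> lmeasurable \<Longrightarrow> err c f S \<le> err c f T"
  unfolding err_def by (intro set_integral_mono_set_nonneg flux_integrable) auto

lemma flux_norm_le_err:
  assumes "S \<in> lmeasurable"
  shows "(LINT z:S|lebesgue. norm ((a z - c) *\<^sub>R Du z + (F z - f))) \<le> err c f S"
  unfolding err_def
proof (rule set_integral_mono)
  show "norm ((a z - c) *\<^sub>R Du z + (F z - f)) \<le> \<bar>a z - c\<bar> * norm (Du z) + norm (F z - f)" for z
    using norm_triangle_ineq[of "(a z - c) *\<^sub>R Du z" "F z - f"] by simp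
qed (intro set_integrable_norm flux_integrable assms)+

lemma component_bound:
  assumes i: "i \<in> Basis" and t: "0 < t" "cball x t \<subseteq> K" and c: "lam \<le> c"
  shows "\<bar>cint (\<lambda>z. Du z \<bullet> i) lker t x\<bar> \<le> C / lam * err c f (cball x t)"
proof -
  let ?v = "cint (\<lambda>z. Du z \<bullet> i) lker t x"
  have "lam * \<bar>?v\<bar> \<le> c * \<bar>?v\<bar>" using c by (intro mult_right_mono) auto
  also have "\<dots> = \<bar>c * ?v\<bar>" using c lam by (simp add: abs_mult)
  also have "\<dots> = \<bar>cint (\<lambda>z. (a z - c) *\<^sub>R Du z + (F z - f)) (gprof i) t x\<bar>"
    unfolding frozen[OF i t, of c f] by simp
  also have "\<dots> \<le> C * (LINT z:cball x t|lebesgue. norm ((a z - c) *\<^sub>R Du z + (F z - f)))"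
    by (intro cint_bound gprof i t flux_integrable) simp
  also have "\<dots> \<le> C * err c f (cball x t)"
    by (intro mult_left_mono flux_norm_le_err C_nonneg) simp
  finally show ?thesis using lam by (simp add: field_simps)
qed

text \<open>The same \<open>c\<close> and \<open>f\<close> are used at both points, so the frozen identities can be subtracted.\<close>

lemma component_diff_bound:
  assumes i: "i \<in> Basis" and t: "0 < t" "cball x (2 * t) \<subseteq> K" and c: "lam \<le> c" and xy: "norm (x - y) \<le> t"
  shows "\<bar>cint (\<lambda>z. Du z \<bullet> i) lker t x - cint (\<lambda>z. Du z \<bullet> i) lker t y\<bar>
    \<le> C / lam * (norm (x - y) / t) * err c f (cball x (2 * t))"
proof -
  let ?d = "cint (\<lambda>z. Du z \<bullet> i) lker t x - cint (\<lambda>z. Du z \<bullet> i) lker t y"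
  let ?g = "\<lambda>z. (a z - c) *\<^sub>R Du z + (F z - f)"
  have sub: "cball x t \<subseteq> K" "cball y t \<subseteq> K"
  proof -
    have "cball x t \<subseteq> cball x (2 * t)" using t by (intro subset_cball) simp
    then show "cball x t \<subseteq> K" using t by blast
    have "cball y t \<subseteq> cball x (2 * t)"
    proof
      fix z assume "z \<in> cball y t"
      then show "z \<in> cball x (2 * t)"
        using dist_triangle[of x z y] xy by (simp add: dist_norm)
    qed
    then show "cball y t \<subseteq> K" using t by blast
  qed
  have "lam * \<bar>?d\<bar> \<le> c * \<bar>?d\<bar>" using c by (intro mult_right_mono) auto
  also have "\<dots> = \<bar>c * cint (\<lambda>z. Du z \<bullet> i) lker t x - c * cint (\<lambda>z. Du z \<bullet> i) lker t y\<bar>"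
    using c lam by (simp add: abs_mult flip: right_diff_distrib)
  also have "\<dots> = \<bar>cint ?g (gprof i) t x - cint ?g (gprof i) t y\<bar>"
    unfolding frozen[OF i t(1) sub(1), of c f] frozen[OF i t(1) sub(2), of c f] by simp
  also have "\<dots> \<le> C * (norm (x - y) / t) * (LINT z:cball x (2 * t)|lebesgue. norm (?g z))"
    by (intro cint_diff_bound gprof i t flux_integrable xy) simp
  also have "\<dots> \<le> C * (norm (x - y) / t) * err c f (cball x (2 * t))"
    using t C_nonneg by (intro mult_left_mono flux_norm_le_err) auto
  finally have "\<bar>?d\<bar> \<le> C * (norm (x - y) / t) * err c f (cball x (2 * t)) / lam"
    using lam by (simp only: pos_le_divide_eq mult.commute[of _ lam])
  then show ?thesis by (simp add: mult.commute)
qed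

text \<open>The representative \<open>Du\<close> is arbitrary on null sets; pointwise statements are made at these points.\<close>

definition good_point :: "'a \<Rightarrow> bool"
  where "good_point x \<longleftrightarrow> (\<forall>i\<in>Basis. leb_point (\<lambda>z. Du z \<bullet> i) x)"

lemma Du_component: "integrable lebesgue (\<lambda>z. Du z \<bullet> i)"
  using Du by (rule integrable_inner_left)

lemma AE_good_point: "AE x in lebesgue. good_point x"
  unfolding good_point_def by (simp add: AE_finite_all AE_leb_point[OF Du_component])

text \<open>The frozen data may be chosen anew at every scale. The radius \<open>2t\<close> is the one in
  \<open>component_diff_bound\<close>.\<close>

definition flat :: "real \<Rightarrow> real \<Rightarrow> real \<Rightarrow> 'a \<Rightarrow> bool"
  where "flat \<gamma> R A x \<longleftrightarrow> 0 \<le> A \<and> cball x (2 * R) \<subseteq> K \<and> (\<forall>t. 0 < t \<and> t \<le> R \<longrightarrow>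
     (\<exists>c\<ge>lam. \<exists>f. err c f (cball x (2 * t)) \<le> A * t powr (real DIM('a) + \<gamma>)))"

text \<open>The constant that \<open>kernel_holder\<close> yields for the \<open>n\<close> components together.\<close>

definition holder_const :: "real \<Rightarrow> real \<Rightarrow> real"
  where "holder_const \<gamma> R = real DIM('a) / (LINT z|lborel. ker (z::'a)) *
    (C / lam * (1 / \<gamma> + 1 / (1 - \<gamma>)) + C / R ^ (DIM('a) + 1) * (LINT z|lebesgue. norm (Du z)))"

lemma flat_lker_bound:
  assumes "flat \<gamma> R A x" "i \<in> Basis" "0 < t" "t \<le> R"
  shows "\<bar>cint (\<lambda>z. Du z \<bullet> i) lker t x\<bar> \<le> (C / lam * A) * t powr (real DIM('a) + \<gamma>)"
proof -
  obtain c f where cf: "lam \<le> c" "err c f (cball x (2 * t)) \<le> A * t powr (real DIM('a) + \<gamma>)"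
    using assms by (auto simp: flat_def)
  have sub: "cball x t \<subseteq> cball x (2 * t)" "cball x (2 * t) \<subseteq> cball x (2 * R)"
    using assms by (auto intro!: subset_cball)
  then have "cball x t \<subseteq> K" using assms by (auto simp: flat_def)
  then have "\<bar>cint (\<lambda>z. Du z \<bullet> i) lker t x\<bar> \<le> C / lam * err c f (cball x t)"
    using assms cf by (intro component_bound) auto
  also have "\<dots> \<le> C / lam * err c f (cball x (2 * t))"
    using sub lam C_nonneg by (intro mult_left_mono err_mono) auto
  also have "\<dots> \<le> C / lam * (A * t powr (real DIM('a) + \<gamma>))"
    using lam C_nonneg by (intro mult_left_mono cf) auto
  finally show ?thesis by simp
qed

lemma flat_holder:
  assumes x: "good_point x" "flat \<gamma> R A x" and y: "good_point y" "flat \<gamma> R A' y"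
    and \<gamma>: "0 < \<gamma>" "\<gamma> < 1" and R: "0 < R" "R \<le> 1" and xy: "norm (x - y) \<le> R"
  shows "norm (Du x - Du y) \<le> holder_const \<gamma> R * (A + A' + 1) * norm (x - y) powr \<gamma>"
proof -
  define I where "I = (LINT z|lborel. ker (z::'a))"
  define E where "E = C / R ^ (DIM('a) + 1) * (LINT z|lebesgue. norm (Du z))"
  have I: "0 < I" unfolding I_def by (rule ker_integral_pos)
  have A: "0 \<le> A" "0 \<le> A'" using x y by (auto simp: flat_def)
  have E: "0 \<le> E" unfolding E_def using C_nonneg R by auto
  define X where "X = (C / lam * (1 / \<gamma> + 1 / (1 - \<gamma>)) + E) * (A + A' + 1)"
  have comp: "I * \<bar>(Du x - Du y) \<bullet> i\<bar> \<le> X * norm (x - y) powr \<gamma>" if i: "i \<in> Basis" for i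
  proof -
    let ?v = "\<lambda>z. Du z \<bullet> i"
    have "I * \<bar>?v x - ?v y\<bar> \<le> ((C / lam * A) / \<gamma> + (C / lam * A') / \<gamma> + (C / lam * A) / (1 - \<gamma>)
      + C / R ^ (DIM('a) + 1) * (LINT z|lebesgue. \<bar>?v z\<bar>)) * norm (x - y) powr \<gamma>"
      unfolding I_def
    proof (rule kernel_holder[OF Du_component _ _ \<gamma> R xy ker])
      show "leb_point ?v x" "leb_point ?v y" using x y i by (auto simp: good_point_def)
      show "0 \<le> C / lam * A" "0 \<le> C / lam * A'" "0 \<le> C / lam * A"
        using A lam C_nonneg by auto
      show "\<bar>cint ?v lker t x\<bar> \<le> C / lam * A * t powr (real DIM('a) + \<gamma>)" if "0 < t" "t \<le> R" for t
        by (rule flat_lker_bound[OF x(2) i that])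
      show "\<bar>cint ?v lker t y\<bar> \<le> C / lam * A' * t powr (real DIM('a) + \<gamma>)" if "0 < t" "t \<le> R" for t
        by (rule flat_lker_bound[OF y(2) i that])
    next
      fix t assume t: "0 < t" "norm (x - y) \<le> t" "t \<le> R"
      then obtain c f where cf: "lam \<le> c" "err c f (cball x (2 * t)) \<le> A * t powr (real DIM('a) + \<gamma>)"
        using x by (auto simp: flat_def)
      have "cball x (2 * t) \<subseteq> cball x (2 * R)" using t by (auto intro!: subset_cball)
      then have "cball x (2 * t) \<subseteq> K" using x by (auto simp: flat_def)
      then have "\<bar>cint ?v lker t x - cint ?v lker t y\<bar> \<le> C / lam * (norm (x - y) / t) * err c f (cball x (2 * t))"
        using t cf i by (intro component_diff_bound) auto
      also have "\<dots> \<le> C / lam * (norm (x - y) / t) * (A * t powr (real DIM('a) + \<gamma>))"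
        using t lam C_nonneg by (intro mult_left_mono cf) auto
      also have "\<dots> = C / lam * A * norm (x - y) * t powr (real DIM('a) + \<gamma> - 1)"
        using t by (simp add: powr_diff)
      finally show "\<bar>cint ?v lker t x - cint ?v lker t y\<bar> \<le> C / lam * A * norm (x - y) * t powr (real DIM('a) + \<gamma> - 1)" .
    qed
    also have "\<dots> \<le> X * norm (x - y) powr \<gamma>"
    proof (rule mult_right_mono)
      define p where "p = C / lam * (1 / \<gamma>)"
      define q where "q = C / lam * (1 / (1 - \<gamma>))"
      have pq: "0 \<le> p" "0 \<le> q" using C_nonneg lam \<gamma> by (auto simp: p_def q_def)
      have "(LINT z|lebesgue. \<bar>?v z\<bar>) \<le> (LINT z|lebesgue. norm (Du z))"
        using Du Du_component[of i] by (intro integral_mono) (auto simp: Basis_le_norm[OF i])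
      then have "C / R ^ (DIM('a) + 1) * (LINT z|lebesgue. \<bar>?v z\<bar>) \<le> E"
        unfolding E_def using C_nonneg R by (intro mult_left_mono) auto
      moreover have "(C / lam * A) / \<gamma> + (C / lam * A') / \<gamma> + (C / lam * A) / (1 - \<gamma>) + E = p * A + p * A' + q * A + E"
        by (simp add: p_def q_def)
      moreover have "p * A + p * A' + q * A + E \<le> (p + q + E) * (A + A' + 1)"
        using pq A E by (simp add: algebra_simps)
      moreover have "(p + q + E) * (A + A' + 1) = X" by (simp add: X_def p_def q_def algebra_simps)
      ultimately show "(C / lam * A) / \<gamma> + (C / lam * A') / \<gamma> + (C / lam * A) / (1 - \<gamma>)
        + C / R ^ (DIM('a) + 1) * (LINT z|lebesgue. \<bar>?v z\<bar>) \<le> X"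
        by linarith
    qed simp
    finally show ?thesis by (simp add: inner_diff_left)
  qed
  have "I * norm (Du x - Du y) \<le> I * (\<Sum>i\<in>Basis. \<bar>(Du x - Du y) \<bullet> i\<bar>)"
    using I by (intro mult_left_mono norm_le_l1) auto
  also have "\<dots> = (\<Sum>i\<in>Basis. I * \<bar>(Du x - Du y) \<bullet> i\<bar>)" by (rule sum_distrib_left)
  also have "\<dots> \<le> (\<Sum>i\<in>(Basis::'a set). X * norm (x - y) powr \<gamma>)" by (intro sum_mono comp)
  also have "\<dots> = real DIM('a) * (X * norm (x - y) powr \<gamma>)" by simp
  finally have "norm (Du x - Du y) \<le> real DIM('a) * (X * norm (x - y) powr \<gamma>) / I"
    using I by (simp add: field_simps)
  then show ?thesis by (simp add: holder_const_def X_def I_def E_def)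
qed

end

section \<open>Boundedness of the gradient\<close>

lemma sigma_finite_lebesgue: "sigma_finite_measure (lebesgue :: 'a::euclidean_space measure)"
proof
  have "(\<Union>n. cball (0::'a) (real n)) = UNIV"
    by (auto simp: real_arch_simple)
  moreover have "emeasure lebesgue (cball (0::'a) (real n)) \<noteq> \<infinity>" for n
    using fmeasurableD2[OF lmeasurable_cball[of "0::'a" "real n"]] by simp
  ultimately show "\<exists>A. countable A \<and> A \<subseteq> sets lebesgue \<and> \<Union> A = space (lebesgue::'a measure) \<and> (\<forall>a\<in>A. emeasure lebesgue a \<noteq> \<infinity>)"
    by (intro exI[of _ "range (\<lambda>n. cball (0::'a) (real n))"]) auto
qed

interpretation leb_pair: pair_sigma_finite "lebesgue :: 'a::euclidean_space measure" "lebesgue :: 'a measure"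
  by (intro pair_sigma_finite.intro sigma_finite_lebesgue)

lemma ennreal_mult_add_mult:
  assumes "0 \<le> a" "0 \<le> b" "0 \<le> c" "0 \<le> d"
  shows "ennreal a * ennreal b + ennreal c * ennreal d = ennreal (a * b + c * d)"
  using assms by (simp add: ennreal_mult ennreal_plus)

lemma indicator_cball_measurable [measurable]:
  "(indicator (cball x r) :: 'a::euclidean_space \<Rightarrow> ennreal) \<in> borel_measurable lebesgue"
  by (rule borel_measurable_indicator) simp

lemma norm_diff_measurable:
  "(\<lambda>p. norm (fst p - snd p)) \<in> borel_measurable (lebesgue \<Otimes>\<^sub>M (lebesgue :: 'a::euclidean_space measure))"
proof -
  have id: "(\<lambda>x::'a. x) \<in> borel_measurable lebesgue" by (simp add: measurable_completion)
  have "fst \<in> borel_measurable ((lebesgue :: 'a measure) \<Otimes>\<^sub>M (lebesgue :: 'a measure))"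
    by (rule measurable_compose[OF measurable_fst id])
  moreover have "snd \<in> borel_measurable ((lebesgue :: 'a measure) \<Otimes>\<^sub>M (lebesgue :: 'a measure))"
    by (rule measurable_compose[OF measurable_snd id])
  ultimately show ?thesis by measurable
qed

lemma measure_cball:
  fixes x :: "'a::euclidean_space"
  shows "0 \<le> r \<Longrightarrow> measure lebesgue (cball x r) = measure lebesgue (cball (0::'a) 1) * r ^ DIM('a)"
  using content_ball_conv_unit_ball[of r x] by (simp add: content_cball_conv_ball)

lemma ball_emeasure:
  fixes x :: "'a::euclidean_space"
  shows "0 \<le> r \<Longrightarrow> emeasure lebesgue (cball x r) = ennreal (measure lebesgue (cball (0::'a) 1) * r ^ DIM('a))"
  using emeasure_eq_measure2[OF lmeasurable_cball[of x r]] measure_cball[of r x] by simp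

text \<open>By Fubini's theorem a point \<open>z\<close> is counted with the measure of those centres \<open>y\<close> whose ball contains
  it, and only points within \<open>\<rho> + r\<close> of \<open>x\<close> are counted.\<close>

lemma nn_integral_average:
  fixes f :: "'a::euclidean_space \<Rightarrow> ennreal"
  assumes f[measurable]: "f \<in> borel_measurable lebesgue" and r: "0 \<le> r"
  shows "(\<lambda>y. \<integral>\<^sup>+z. f z * indicator (cball y r) z \<partial>lebesgue) \<in> borel_measurable lebesgue"
    and "(\<integral>\<^sup>+y. (\<integral>\<^sup>+z. f z * indicator (cball y r) z \<partial>lebesgue) * indicator (cball x \<rho>) y \<partial>lebesgue)
      \<le> ennreal (measure lebesgue (cball (0::'a) 1) * r ^ DIM('a)) * (\<integral>\<^sup>+z. f z * indicator (cball x (\<rho> + r)) z \<partial>lebesgue)"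
proof -
  note norm_diff_measurable[where 'a = 'a, measurable]
  have ind: "(\<lambda>p. indicator {p. norm (fst p - snd p) \<le> r} p :: ennreal) \<in> borel_measurable (lebesgue \<Otimes>\<^sub>M (lebesgue :: 'a measure))"
    by measurable
  have ind2: "(\<lambda>p. indicator (cball x \<rho>) (fst p) :: ennreal) \<in> borel_measurable (lebesgue \<Otimes>\<^sub>M (lebesgue :: 'a measure))"
    by (rule measurable_compose[OF measurable_fst borel_measurable_indicator]) simp
  have eq: "indicator (cball y r) z = (indicator {p. norm (fst p - snd p) \<le> r} (y, z) :: ennreal)" for y z :: 'a
    by (simp add: indicator_def dist_norm)
  have m1: "(\<lambda>(y, z). f z * indicator (cball y r) z) \<in> borel_measurable (lebesgue \<Otimes>\<^sub>M (lebesgue :: 'a measure))"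
    unfolding eq using ind by (simp add: case_prod_beta')
  show "(\<lambda>y. \<integral>\<^sup>+z. f z * indicator (cball y r) z \<partial>lebesgue) \<in> borel_measurable lebesgue"
    using sigma_finite_measure.borel_measurable_nn_integral[OF sigma_finite_lebesgue m1] .
  have m2: "(\<lambda>(y, z). f z * indicator (cball y r) z * indicator (cball x \<rho>) y) \<in> borel_measurable (lebesgue \<Otimes>\<^sub>M (lebesgue :: 'a measure))"
    unfolding eq using ind ind2 by (simp add: case_prod_beta')
  have em: "emeasure lebesgue (cball z r) = ennreal (measure lebesgue (cball (0::'a) 1) * r ^ DIM('a))" for z :: 'a
    by (rule ball_emeasure[OF r])
  have "(\<integral>\<^sup>+y. (\<integral>\<^sup>+z. f z * indicator (cball y r) z \<partial>lebesgue) * indicator (cball x \<rho>) y \<partial>lebesgue)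
     = (\<integral>\<^sup>+y. (\<integral>\<^sup>+z. f z * indicator (cball y r) z * indicator (cball x \<rho>) y \<partial>lebesgue) \<partial>lebesgue)"
    unfolding eq using ind by (intro nn_integral_cong nn_integral_multc[symmetric]) simp
  also have "\<dots> = (\<integral>\<^sup>+z. (\<integral>\<^sup>+y. f z * indicator (cball y r) z * indicator (cball x \<rho>) y \<partial>lebesgue) \<partial>lebesgue)"
    using leb_pair.Fubini'[OF m2] by simp
  also have "\<dots> \<le> (\<integral>\<^sup>+z. ennreal (measure lebesgue (cball (0::'a) 1) * r ^ DIM('a)) * (f z * indicator (cball x (\<rho> + r)) z) \<partial>lebesgue)"
  proof (rule nn_integral_mono)
    fix z :: 'a
    have "(\<integral>\<^sup>+y. f z * indicator (cball y r) z * indicator (cball x \<rho>) y \<partial>lebesgue)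
      \<le> (\<integral>\<^sup>+y. f z * indicator (cball x (\<rho> + r)) z * indicator (cball z r) y \<partial>lebesgue)"
    proof (rule nn_integral_mono)
      fix y :: 'a
      have "dist x z \<le> \<rho> + r" if "dist x y \<le> \<rho>" "dist y z \<le> r"
        using that dist_triangle[of x z y] by simp
      then show "f z * indicator (cball y r) z * indicator (cball x \<rho>) y \<le> f z * indicator (cball x (\<rho> + r)) z * indicator (cball z r) y"
        by (auto simp: indicator_def dist_commute)
    qed
    also have "\<dots> = f z * indicator (cball x (\<rho> + r)) z * emeasure lebesgue (cball z r)"
      by (rule nn_integral_cmult_indicator) simp
    finally show "(\<integral>\<^sup>+y. f z * indicator (cball y r) z * indicator (cball x \<rho>) y \<partial>lebesgue)
      \<le> ennreal (measure lebesgue (cball (0::'a) 1) * r ^ DIM('a)) * (f z * indicator (cball x (\<rho> + r)) z)"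
      by (simp add: em mult.commute)
  qed
  also have "\<dots> = ennreal (measure lebesgue (cball (0::'a) 1) * r ^ DIM('a)) * (\<integral>\<^sup>+z. f z * indicator (cball x (\<rho> + r)) z \<partial>lebesgue)"
    by (intro nn_integral_cmult borel_measurable_times_ennreal f borel_measurable_indicator) simp
  finally show "(\<integral>\<^sup>+y. (\<integral>\<^sup>+z. f z * indicator (cball y r) z \<partial>lebesgue) * indicator (cball x \<rho>) y \<partial>lebesgue)
      \<le> ennreal (measure lebesgue (cball (0::'a) 1) * r ^ DIM('a)) * (\<integral>\<^sup>+z. f z * indicator (cball x (\<rho> + r)) z \<partial>lebesgue)" .
qed

context frozen_equation
begin

definition mass :: "'a \<Rightarrow> real \<Rightarrow> real"
  where "mass x t = (LINT z:cball x t|lebesgue. norm (Du z))"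

lemma Dun_set: "S \<in> sets lebesgue \<Longrightarrow> set_integrable lebesgue S (\<lambda>z. norm (Du z))"
  using Du by (intro integrable_imp_set_integrable) auto

lemma mass_mono: "cball x s \<subseteq> cball y t \<Longrightarrow> mass x s \<le> mass y t"
  unfolding mass_def by (intro set_integral_mono_set_nonneg Dun_set) auto

lemma mass_nonneg: "0 \<le> mass x t"
  unfolding mass_def set_lebesgue_integral_def by (intro Bochner_Integration.integral_nonneg) auto

lemma mass_le: "mass x t \<le> (LINT z|lebesgue. norm (Du z))"
proof -
  have "(LINT z:cball x t|lebesgue. norm (Du z)) \<le> (LINT z:UNIV|lebesgue. norm (Du z))"
    by (intro set_integral_mono_set_nonneg Dun_set) auto
  then show ?thesis by (simp add: mass_def set_lebesgue_integral_def)
qed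

lemma mass_ennreal: "ennreal (mass x t) = (\<integral>\<^sup>+z. ennreal (norm (Du z)) * indicator (cball x t) z \<partial>lebesgue)"
proof -
  have "(\<integral>\<^sup>+z. ennreal (indicator (cball x t) z *\<^sub>R norm (Du z)) \<partial>lebesgue) = ennreal (mass x t)"
    unfolding mass_def set_lebesgue_integral_def
    using Dun_set[of "cball x t"] by (intro nn_integral_eq_integral) (auto simp: set_integrable_def)
  also have "(\<integral>\<^sup>+z. ennreal (indicator (cball x t) z *\<^sub>R norm (Du z)) \<partial>lebesgue)
     = (\<integral>\<^sup>+z. ennreal (norm (Du z)) * indicator (cball x t) z \<partial>lebesgue)"
    by (intro nn_integral_cong) (auto simp: indicator_def)
  finally show ?thesis ..
qed

text \<open>Unlike in \<open>pinned\<close> below, the frozen values may depend on the scale, and the oscillation of \<open>a\<close> is bounded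
  uniformly on the ball.\<close>

definition tame_at :: "real \<Rightarrow> real \<Rightarrow> real \<Rightarrow> 'a \<Rightarrow> bool"
  where "tame_at \<beta> M R x \<longleftrightarrow> 0 \<le> M \<and> (\<forall>t. 0 < t \<and> t \<le> R \<longrightarrow> cball x t \<subseteq> K \<and>
    (\<exists>c\<ge>lam. \<exists>f. (AE z in lebesgue. z \<in> cball x t \<longrightarrow> \<bar>a z - c\<bar> \<le> M * t powr \<beta>) \<and>
      (LINT z:cball x t|lebesgue. norm (F z - f)) \<le> M * t powr (real DIM('a) + \<beta>)))"

definition tame :: "real \<Rightarrow> real \<Rightarrow> 'a set \<Rightarrow> real \<Rightarrow> bool"
  where "tame \<beta> M V R \<longleftrightarrow> 0 \<le> M \<and> (\<forall>x\<in>V. tame_at \<beta> M R x)"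

definition avg :: "'a \<Rightarrow> real \<Rightarrow> 'a \<Rightarrow> real"
  where "avg i t x = cint (\<lambda>z. Du z \<bullet> i) ker t x / t ^ DIM('a)"

text \<open>As nothing is known about the size of \<open>Du\<close> yet, its mass on the ball stays on the right.\<close>

lemma tame_lker_bound:
  assumes T: "tame \<beta> M V R" and x: "x \<in> V" and t: "0 < t" "t \<le> R" and i: "i \<in> Basis"
  shows "\<bar>cint (\<lambda>z. Du z \<bullet> i) lker t x\<bar> \<le> C * M / lam * t powr \<beta> * (mass x t + t ^ DIM('a))"
proof -
  obtain c f where K: "cball x t \<subseteq> K" and c: "lam \<le> c"
    and ae: "AE z in lebesgue. z \<in> cball x t \<longrightarrow> \<bar>a z - c\<bar> \<le> M * t powr \<beta>"
    and f: "(LINT z:cball x t|lebesgue. norm (F z - f)) \<le> M * t powr (real DIM('a) + \<beta>)"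
    using T x t unfolding tame_def tame_at_def by blast
  have Fi: "set_integrable lebesgue (cball x t) (\<lambda>z. norm (F z - f))"
    by (rule shift_norm_integrable[OF F]) simp
  have Di: "set_integrable lebesgue (cball x t) (\<lambda>z. M * t powr \<beta> * norm (Du z))"
    by (intro set_integrable_mult_right) (use Dun_set in auto)
  have "err c f (cball x t) \<le> (LINT z:cball x t|lebesgue. M * t powr \<beta> * norm (Du z) + norm (F z - f))"
    unfolding err_def
  proof (rule set_integral_mono_AE)
    show "AE z in lebesgue. z \<in> cball x t \<longrightarrow> \<bar>a z - c\<bar> * norm (Du z) + norm (F z - f) \<le> M * t powr \<beta> * norm (Du z) + norm (F z - f)"
      using ae by eventually_elim (auto intro: mult_right_mono)
  qed (intro flux_integrable set_integral_add Fi Di lmeasurable_cball)+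
  also have "\<dots> = M * t powr \<beta> * mass x t + (LINT z:cball x t|lebesgue. norm (F z - f))"
    using set_integral_add(2)[OF Di Fi] by (simp add: mass_def)
  also have "\<dots> \<le> M * t powr \<beta> * mass x t + M * (t powr \<beta> * t ^ DIM('a))"
    using f t by (simp add: powr_add powr_realpow mult.commute)
  finally have e: "err c f (cball x t) \<le> M * t powr \<beta> * (mass x t + t ^ DIM('a))"
    by (simp add: algebra_simps)
  have "\<bar>cint (\<lambda>z. Du z \<bullet> i) lker t x\<bar> \<le> C / lam * err c f (cball x t)"
    by (rule component_bound[OF i t(1) K c])
  also have "\<dots> \<le> C / lam * (M * t powr \<beta> * (mass x t + t ^ DIM('a)))"
    using lam C_nonneg by (intro mult_left_mono e) auto
  finally show ?thesis by simp
qed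

lemma tame_scale_bound:
  assumes T: "tame \<beta> M V R" and y: "y \<in> V" and i: "i \<in> Basis" and \<beta>: "0 < \<beta>"
    and sr: "0 < s" "s \<le> r" "r \<le> R" and q: "0 \<le> q" "\<And>t. s \<le> t \<Longrightarrow> t \<le> r \<Longrightarrow> mass y t \<le> q * t ^ DIM('a)"
  shows "\<bar>avg i r y - avg i s y\<bar> \<le> C * M / lam * (q + 1) * r powr \<beta> / \<beta>"
proof -
  have D: "0 \<le> C * M / lam" using C_nonneg lam T by (simp add: tame_def)
  have "\<bar>avg i r y - avg i s y\<bar> \<le> C * M / lam * (q + 1) * (r powr \<beta> - s powr \<beta>) / \<beta>"
    unfolding avg_def
  proof (rule cint_scale_bound[OF Du_component _ sr(1,2)])
    show "\<beta> \<noteq> 0" using \<beta> by simp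
    fix t assume t: "s \<le> t" "t \<le> r"
    then have t0: "0 < t" "t \<le> R" using sr by auto
    have "\<bar>cint (\<lambda>z. Du z \<bullet> i) lker t y\<bar> \<le> C * M / lam * t powr \<beta> * (mass y t + t ^ DIM('a))"
      by (rule tame_lker_bound[OF T y t0 i])
    also have "\<dots> \<le> C * M / lam * t powr \<beta> * (q * t ^ DIM('a) + t ^ DIM('a))"
      using q(2)[OF t] D by (intro mult_left_mono add_right_mono mult_nonneg_nonneg) auto
    also have "\<dots> = C * M / lam * (q + 1) * t powr (real DIM('a) + \<beta>)"
      using t0 by (simp add: powr_add powr_realpow algebra_simps add_divide_distrib)
    finally show "\<bar>cint (\<lambda>z. Du z \<bullet> i) lker t y\<bar> \<le> C * M / lam * (q + 1) * t powr (real DIM('a) + \<beta>)" .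
  qed
  also have "\<dots> \<le> C * M / lam * (q + 1) * r powr \<beta> / \<beta>"
    using \<beta> q(1) D by (intro divide_right_mono mult_left_mono mult_nonneg_nonneg) auto
  finally show ?thesis .
qed

lemma avg_limit:
  assumes "good_point y" "i \<in> Basis" "0 < r"
  shows "(\<lambda>N. \<bar>avg i (r / 2 ^ N) y\<bar>) \<longlonglongrightarrow> (LINT z|lborel. ker (z::'a)) * \<bar>Du y \<bullet> i\<bar>"
proof -
  have "((\<lambda>t. avg i t y) \<longlongrightarrow> (LINT z|lborel. ker (z::'a)) * (Du y \<bullet> i)) (at_right 0)"
    unfolding avg_def using assms by (intro leb_point_cint[OF Du_component _ ker]) (auto simp: good_point_def)
  moreover have "filterlim (\<lambda>N. r / 2 ^ N) (at_right 0) sequentially"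
  proof -
    have "(\<lambda>N. r * (1 / 2) ^ N) \<longlonglongrightarrow> r * 0"
      by (intro tendsto_mult tendsto_const LIMSEQ_power_zero) auto
    then show ?thesis
      using assms(3) by (simp add: filterlim_at power_divide)
  qed
  ultimately have "(\<lambda>N. avg i (r / 2 ^ N) y) \<longlonglongrightarrow> (LINT z|lborel. ker (z::'a)) * (Du y \<bullet> i)"
    by (rule filterlim_compose)
  from tendsto_rabs[OF this] show ?thesis
    using ker_integral_pos[where 'a = 'a] by (simp add: abs_mult)
qed

text \<open>Telescoping over the scales \<open>r / 2\<^sup>k\<close>. The sum may diverge at individual points, hence the extended
  reals.\<close>

lemma tame_pointwise:
  assumes T: "tame \<beta> M V R" and y: "y \<in> V" "good_point y" and i: "i \<in> Basis" and \<beta>: "0 < \<beta>"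
    and r: "0 < r" "r \<le> R" and X: "\<bar>avg i r y\<bar> \<le> X"
  shows "ennreal ((LINT z|lborel. ker (z::'a)) * \<bar>Du y \<bullet> i\<bar>) \<le> ennreal X +
    (\<Sum>k. ennreal (C * M / lam * 2 ^ DIM('a) / \<beta> * (r / 2 ^ k) powr \<beta> * (mass y (r / 2 ^ k) / (r / 2 ^ k) ^ DIM('a) + 1)))"
proof -
  define D where "D = C * M / lam"
  have D: "0 \<le> D" using C_nonneg lam T by (simp add: tame_def D_def)
  define b where "b k = D * 2 ^ DIM('a) / \<beta> * (r / 2 ^ k) powr \<beta> * (mass y (r / 2 ^ k) / (r / 2 ^ k) ^ DIM('a) + 1)" for k
  have b0: "0 \<le> b k" for k
    unfolding b_def using D \<beta> r mass_nonneg by (intro mult_nonneg_nonneg add_nonneg_nonneg divide_nonneg_nonneg) auto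
  have step: "\<bar>avg i (r / 2 ^ k) y - avg i (r / 2 ^ Suc k) y\<bar> \<le> b k" for k
  proof -
    define s where "s = r / 2 ^ k"
    have s: "0 < s" "s \<le> R" using r by (auto simp: s_def divide_simps) (smt (verit) mult_left_le one_le_power mult_le_cancel_left1)
    define q where "q = 2 ^ DIM('a) * (mass y s / s ^ DIM('a))"
    have q: "0 \<le> q" using mass_nonneg s by (simp add: q_def)
    have "\<bar>avg i s y - avg i (s / 2) y\<bar> \<le> D * (q + 1) * s powr \<beta> / \<beta>"
      unfolding D_def
    proof (rule tame_scale_bound[OF T y(1) i \<beta> _ _ s(2) q])
      fix t assume t: "s / 2 \<le> t" "t \<le> s"
      have "mass y t \<le> mass y s" using t by (intro mass_mono subset_cball)
      also have "\<dots> = q * (s / 2) ^ DIM('a)" using s by (simp add: q_def power_divide)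
      also have "\<dots> \<le> q * t ^ DIM('a)" using q t s by (intro mult_left_mono power_mono) auto
      finally show "mass y t \<le> q * t ^ DIM('a)" .
    qed (use s in auto)
    also have "\<dots> \<le> D * (q + 2 ^ DIM('a)) * s powr \<beta> / \<beta>"
      using D \<beta> by (intro divide_right_mono mult_right_mono mult_left_mono) auto
    also have "\<dots> = b k" unfolding b_def q_def s_def by (simp add: algebra_simps add_divide_distrib)
    finally show ?thesis by (simp add: s_def mult.commute)
  qed
  have tele: "\<bar>avg i (r / 2 ^ N) y\<bar> \<le> X + (\<Sum>k<N. b k)" for N
  proof (induction N)
    case (Suc N)
    then show ?case using step[of N] by simp
  qed (use X in simp)
  have X0: "0 \<le> X" using X by simp
  have "ennreal \<bar>avg i (r / 2 ^ N) y\<bar> \<le> ennreal X + (\<Sum>k. ennreal (b k))" for N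
  proof -
    have "ennreal \<bar>avg i (r / 2 ^ N) y\<bar> \<le> ennreal (X + (\<Sum>k<N. b k))"
      using tele by (rule ennreal_leI)
    also have "\<dots> = ennreal X + (\<Sum>k<N. ennreal (b k))"
      using X0 b0 by (subst ennreal_plus) (auto intro: sum_nonneg simp: sum_ennreal)
    also have "\<dots> \<le> ennreal X + (\<Sum>k. ennreal (b k))"
      by (intro add_left_mono sum_le_suminf) auto
    finally show ?thesis .
  qed
  then have "ennreal ((LINT z|lborel. ker (z::'a)) * \<bar>Du y \<bullet> i\<bar>) \<le> ennreal X + (\<Sum>k. ennreal (b k))"
    by (intro LIMSEQ_le_const2[OF tendsto_ennrealI[OF avg_limit[OF y(2) i r(1)]]]) auto
  then show ?thesis unfolding b_def D_def .
qed

text \<open>Integrating \<open>tame_pointwise\<close> over a ball removes the dependence on small scales: by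
  \<open>nn_integral_average\<close> the average of the mass at scale \<open>r / 2\<^sup>k\<close> is controlled by the mass of the ball of radius
  \<open>2r\<close>, and the remaining factors \<open>(r / 2\<^sup>k)\<^sup>\<beta>\<close> form a geometric series.\<close>

lemma tame_ball_bound:
  assumes T: "tame \<beta> M V R" and i: "i \<in> Basis" and \<beta>: "0 < \<beta>" and r: "0 < r" "r \<le> R"
    and V: "cball x r \<subseteq> V" and X: "\<And>y. y \<in> cball x r \<Longrightarrow> \<bar>avg i r y\<bar> \<le> X"
  shows "(LINT z|lborel. ker (z::'a)) * (LINT z:cball x r|lebesgue. \<bar>Du z \<bullet> i\<bar>)
    \<le> measure lebesgue (cball (0::'a) 1) * (r ^ DIM('a) * X +
       C * M / lam * 2 ^ DIM('a) / \<beta> * r powr \<beta> * (1 / (1 - (1 / 2) powr \<beta>)) * (mass x (2 * r) + r ^ DIM('a)))"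
proof -
  define D where "D = C * M / lam * 2 ^ DIM('a) / \<beta>"
  have D: "0 \<le> D" using C_nonneg lam T \<beta> by (simp add: tame_def D_def)
  define n where "n = DIM('a)"
  define \<omega> where "\<omega> = measure lebesgue (cball (0::'a) 1)"
  have \<omega>: "0 \<le> \<omega>" by (simp add: \<omega>_def)
  define I where "I = (LINT z|lborel. ker (z::'a))"
  have I: "0 < I" unfolding I_def by (rule ker_integral_pos)
  define s where "s k = r / 2 ^ k" for k
  have s: "0 < s k" "s k \<le> r" for k using r by (auto simp: s_def divide_simps mult_le_cancel_left1)
  have x_in: "x \<in> cball x r" using r by simp
  have X0: "0 \<le> X" using X[OF x_in] by linarith
  have em: "emeasure lebesgue (cball x r) = ennreal (\<omega> * r ^ n)"
    unfolding \<omega>_def n_def using r by (intro ball_emeasure) simp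
  define m where "m y t = (\<integral>\<^sup>+z. ennreal (norm (Du z)) * indicator (cball y t) z \<partial>lebesgue)" for y t
  have m: "ennreal (mass y t) = m y t" for y t unfolding m_def by (rule mass_ennreal)
  have Dum: "(\<lambda>z. ennreal (norm (Du z))) \<in> borel_measurable lebesgue" using Du by simp
  have mm: "(\<lambda>y. m y t) \<in> borel_measurable lebesgue" if "0 \<le> t" for t
    unfolding m_def by (rule nn_integral_average(1)[OF Dum that])
  have mi: "(\<integral>\<^sup>+y. m y (s k) * indicator (cball x r) y \<partial>lebesgue) \<le> ennreal (\<omega> * s k ^ n * mass x (2 * r))" for k
  proof -
    have "(\<integral>\<^sup>+y. m y (s k) * indicator (cball x r) y \<partial>lebesgue) \<le> ennreal (\<omega> * s k ^ n) * m x (r + s k)"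
      unfolding m_def \<omega>_def n_def using s[of k] by (intro nn_integral_average(2)[OF Dum]) simp
    also have "\<dots> = ennreal (\<omega> * s k ^ n * mass x (r + s k))"
      unfolding m[symmetric] using \<omega> s[of k] mass_nonneg by (intro ennreal_mult[symmetric]) auto
    also have "\<dots> \<le> ennreal (\<omega> * s k ^ n * mass x (2 * r))"
      using \<omega> s[of k] by (intro ennreal_leI mult_left_mono mass_mono subset_cball) auto
    finally show ?thesis .
  qed
  define h where "h k y = ennreal (D * s k powr \<beta> / s k ^ n) * m y (s k) + ennreal (D * s k powr \<beta>)" for k y
  have hm: "h k \<in> borel_measurable lebesgue" for k
    unfolding h_def[abs_def] using mm[of "s k"] s[of k] by simp
  have hi: "(\<integral>\<^sup>+y. h k y * indicator (cball x r) y \<partial>lebesgue) \<le> ennreal (D * \<omega> * (mass x (2 * r) + r ^ n) * s k powr \<beta>)" for k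
  proof -
    have "(\<integral>\<^sup>+y. h k y * indicator (cball x r) y \<partial>lebesgue)
      = (\<integral>\<^sup>+y. ennreal (D * s k powr \<beta> / s k ^ n) * (m y (s k) * indicator (cball x r) y) + ennreal (D * s k powr \<beta>) * indicator (cball x r) y \<partial>lebesgue)"
      unfolding h_def by (intro nn_integral_cong) (simp add: distrib_right mult.assoc)
    also have "\<dots> = ennreal (D * s k powr \<beta> / s k ^ n) * (\<integral>\<^sup>+y. m y (s k) * indicator (cball x r) y \<partial>lebesgue)
       + ennreal (D * s k powr \<beta>) * ennreal (\<omega> * r ^ n)"
    proof -
      have "(\<lambda>y. m y (s k) * indicator (cball x r) y) \<in> borel_measurable lebesgue"
        using s[of k] by (intro borel_measurable_times_ennreal mm borel_measurable_indicator) auto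
      then have "(\<integral>\<^sup>+y. c1 * (m y (s k) * indicator (cball x r) y) + c2 * indicator (cball x r) y \<partial>lebesgue)
         = c1 * (\<integral>\<^sup>+y. m y (s k) * indicator (cball x r) y \<partial>lebesgue) + c2 * emeasure lebesgue (cball x r)" for c1 c2
        by (subst nn_integral_add) (auto simp: nn_integral_cmult nn_integral_cmult_indicator)
      then show ?thesis unfolding em .
    qed
    also have "\<dots> \<le> ennreal (D * s k powr \<beta> / s k ^ n) * ennreal (\<omega> * s k ^ n * mass x (2 * r)) + ennreal (D * s k powr \<beta>) * ennreal (\<omega> * r ^ n)"
      by (intro add_right_mono mult_left_mono mi) auto
    also have "\<dots> = ennreal (D * s k powr \<beta> / s k ^ n * (\<omega> * s k ^ n * mass x (2 * r)) + D * s k powr \<beta> * (\<omega> * r ^ n))"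
      using D \<omega> s[of k] r mass_nonneg by (intro ennreal_mult_add_mult) auto
    also have "D * s k powr \<beta> / s k ^ n * (\<omega> * s k ^ n * mass x (2 * r)) + D * s k powr \<beta> * (\<omega> * r ^ n)
        = D * \<omega> * (mass x (2 * r) + r ^ n) * s k powr \<beta>"
    proof -
      have gen: "D * S / P * (\<omega> * P * m') + D * S * (\<omega> * Q) = D * \<omega> * (m' + Q) * S" if "P \<noteq> 0" for P S Q m' :: real
        using that by (simp add: algebra_simps)
      show ?thesis using s[of k] by (intro gen) simp
    qed
    finally show ?thesis .
  qed
  define p where "p = (1 / 2) powr \<beta>"
  have p: "0 < p" "p < 1" using \<beta> by (auto simp: p_def powr_def mult_pos_neg)
  have sp: "s k powr \<beta> = r powr \<beta> * p ^ k" for k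
  proof -
    have "s k = r * (1 / 2) ^ k" by (simp add: s_def power_divide)
    then have "s k powr \<beta> = r powr \<beta> * ((1 / 2) ^ k) powr \<beta>" using r by (simp add: powr_mult)
    also have "((1 / 2 :: real) ^ k) powr \<beta> = p ^ k"
      unfolding p_def by (simp add: powr_powr mult.commute flip: powr_realpow)
    finally show ?thesis .
  qed
  have "ennreal (I * (LINT z:cball x r|lebesgue. \<bar>Du z \<bullet> i\<bar>)) = (\<integral>\<^sup>+z. ennreal (I * \<bar>Du z \<bullet> i\<bar>) * indicator (cball x r) z \<partial>lebesgue)"
  proof -
    have "set_integrable lebesgue (cball x r) (\<lambda>z. I * \<bar>Du z \<bullet> i\<bar>)"
      using Du_component[of i] by (intro integrable_imp_set_integrable) auto
    then have "(\<integral>\<^sup>+z. ennreal (indicator (cball x r) z *\<^sub>R (I * \<bar>Du z \<bullet> i\<bar>)) \<partial>lebesgue) = ennreal (LINT z:cball x r|lebesgue. I * \<bar>Du z \<bullet> i\<bar>)"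
      unfolding set_lebesgue_integral_def using I by (intro nn_integral_eq_integral) (auto simp: set_integrable_def)
    moreover have "(\<integral>\<^sup>+z. ennreal (indicator (cball x r) z *\<^sub>R (I * \<bar>Du z \<bullet> i\<bar>)) \<partial>lebesgue) = (\<integral>\<^sup>+z. ennreal (I * \<bar>Du z \<bullet> i\<bar>) * indicator (cball x r) z \<partial>lebesgue)"
      by (intro nn_integral_cong) (auto simp: indicator_def)
    ultimately show ?thesis by simp
  qed
  also have "\<dots> \<le> (\<integral>\<^sup>+y. ennreal X * indicator (cball x r) y + (\<Sum>k. h k y * indicator (cball x r) y) \<partial>lebesgue)"
  proof (rule nn_integral_mono_AE)
    show "AE y in lebesgue. ennreal (I * \<bar>Du y \<bullet> i\<bar>) * indicator (cball x r) y \<le> ennreal X * indicator (cball x r) y + (\<Sum>k. h k y * indicator (cball x r) y)"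
      using AE_good_point
    proof eventually_elim
      case y: (elim y)
      show ?case
      proof (cases "y \<in> cball x r")
        case True
        have "ennreal (I * \<bar>Du y \<bullet> i\<bar>) \<le> ennreal X + (\<Sum>k. ennreal (D * s k powr \<beta> * (mass y (s k) / s k ^ n + 1)))"
          unfolding I_def D_def s_def n_def using True V X by (intro tame_pointwise[OF T _ y i \<beta> r]) auto
        also have "(\<lambda>k. ennreal (D * s k powr \<beta> * (mass y (s k) / s k ^ n + 1))) = (\<lambda>k. h k y)"
        proof
          fix k
          have "ennreal (D * s k powr \<beta> * (mass y (s k) / s k ^ n + 1)) = ennreal (D * s k powr \<beta> / s k ^ n * mass y (s k) + D * s k powr \<beta>)"
            by (simp add: algebra_simps)
          also have "\<dots> = h k y"
            unfolding h_def m[symmetric]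
            using ennreal_mult_add_mult[of "D * s k powr \<beta> / s k ^ n" "mass y (s k)" "D * s k powr \<beta>" 1] D s[of k] mass_nonneg
            by simp
          finally show "ennreal (D * s k powr \<beta> * (mass y (s k) / s k ^ n + 1)) = h k y" .
        qed
        finally show ?thesis using True by simp
      qed simp
    qed
  qed
  also have "\<dots> = (\<integral>\<^sup>+y. ennreal X * indicator (cball x r) y \<partial>lebesgue) + (\<integral>\<^sup>+y. (\<Sum>k. h k y * indicator (cball x r) y) \<partial>lebesgue)"
    using hm by (intro nn_integral_add) auto
  also have "(\<integral>\<^sup>+y. (\<Sum>k. h k y * indicator (cball x r) y) \<partial>lebesgue) = (\<Sum>k. \<integral>\<^sup>+y. h k y * indicator (cball x r) y \<partial>lebesgue)"
    using hm by (intro nn_integral_suminf) auto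
  also have "(\<integral>\<^sup>+y. ennreal X * indicator (cball x r) y \<partial>lebesgue) = ennreal X * ennreal (\<omega> * r ^ n)"
    by (simp add: nn_integral_cmult_indicator em)
  finally have le1: "ennreal (I * (LINT z:cball x r|lebesgue. \<bar>Du z \<bullet> i\<bar>)) \<le> ennreal X * ennreal (\<omega> * r ^ n)
      + (\<Sum>k. \<integral>\<^sup>+y. h k y * indicator (cball x r) y \<partial>lebesgue)" .
  have "(\<Sum>k. \<integral>\<^sup>+y. h k y * indicator (cball x r) y \<partial>lebesgue) \<le> (\<Sum>k. ennreal (D * \<omega> * (mass x (2 * r) + r ^ n) * r powr \<beta> * p ^ k))"
    using hi by (intro suminf_le) (auto simp: sp mult.assoc)
  also have "\<dots> = ennreal (D * \<omega> * (mass x (2 * r) + r ^ n) * r powr \<beta> * (1 / (1 - p)))"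
  proof -
    have "(\<lambda>k. D * \<omega> * (mass x (2 * r) + r ^ n) * r powr \<beta> * p ^ k) sums (D * \<omega> * (mass x (2 * r) + r ^ n) * r powr \<beta> * (1 / (1 - p)))"
      using p by (intro sums_mult geometric_sums) auto
    then show ?thesis
      using D \<omega> p r mass_nonneg[of x "2 * r"] by (intro suminf_ennreal_eq) auto
  qed
  finally have "ennreal (I * (LINT z:cball x r|lebesgue. \<bar>Du z \<bullet> i\<bar>)) \<le> ennreal X * ennreal (\<omega> * r ^ n)
      + ennreal (D * \<omega> * (mass x (2 * r) + r ^ n) * r powr \<beta> * (1 / (1 - p)))"
    using add_left_mono order_trans[OF le1] by blast
  also have "\<dots> = ennreal (X * (\<omega> * r ^ n) + D * \<omega> * (mass x (2 * r) + r ^ n) * r powr \<beta> * (1 / (1 - p)))"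
    using X0 \<omega> r D p mass_nonneg[of x "2 * r"]
      ennreal_mult_add_mult[of X "\<omega> * r ^ n" "D * \<omega> * (mass x (2 * r) + r ^ n) * r powr \<beta> * (1 / (1 - p))" 1]
    by simp
  finally have "I * (LINT z:cball x r|lebesgue. \<bar>Du z \<bullet> i\<bar>) \<le> X * (\<omega> * r ^ n) + D * \<omega> * (mass x (2 * r) + r ^ n) * r powr \<beta> * (1 / (1 - p))"
    using X0 \<omega> r D p mass_nonneg[of x "2 * r"] by (subst (asm) ennreal_le_iff) auto
  also have "\<dots> = \<omega> * (r ^ n * X + D * r powr \<beta> * (1 / (1 - p)) * (mass x (2 * r) + r ^ n))"
    by (simp add: algebra_simps)
  finally show ?thesis unfolding I_def D_def \<omega>_def n_def p_def .
qed

end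

lemma content_cball_scale:
  fixes x :: "'a::euclidean_space"
  shows "0 \<le> r \<Longrightarrow> measure lborel (cball x r) = measure lborel (cball (0::'a) 1) * r ^ DIM('a)"
  using measure_cball[of r x] by simp

lemma dyadic_between:
  fixes t R :: real
  assumes "R / 2 ^ j \<le> t" "t \<le> R" "0 < j"
  shows "\<exists>k<j. R / 2 ^ Suc k \<le> t \<and> t \<le> R / 2 ^ k"
  using assms
proof (induction j)
  case (Suc j)
  show ?case
  proof (cases "t \<le> R / 2 ^ j")
    case True
    then show ?thesis using Suc.prems(1) by blast
  next
    case False
    then have "0 < j" using Suc.prems by (cases j) auto
    then show ?thesis using Suc.IH False Suc.prems less_SucI by (meson linorder_not_less order_less_imp_le)
  qed
qed simp

context frozen_equation
begin

lemma avg_bound: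
  assumes i: "i \<in> Basis" and r: "0 < r"
  shows "\<bar>avg i r y\<bar> \<le> C * (LINT z|lebesgue. norm (Du z)) / r ^ DIM('a)"
proof -
  have "\<bar>cint (\<lambda>z. Du z \<bullet> i) ker r y\<bar> \<le> C * (LINT z:cball y r|lebesgue. norm (Du z \<bullet> i))"
    by (intro cint_bound ker r integrable_imp_set_integrable[OF Du_component]) simp
  also have "\<dots> \<le> C * mass y r"
    unfolding mass_def
    by (intro mult_left_mono C_nonneg set_integral_mono set_integrable_norm Dun_set
        integrable_imp_set_integrable[OF Du_component]) (auto simp: Basis_le_norm i)
  also have "\<dots> \<le> C * (LINT z|lebesgue. norm (Du z))"
    by (intro mult_left_mono C_nonneg mass_le)
  finally show ?thesis
    unfolding avg_def using r by (simp add: divide_right_mono)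
qed

lemma mass_le_components:
  "mass x r \<le> (\<Sum>i\<in>Basis. LINT z:cball x r|lebesgue. \<bar>Du z \<bullet> i\<bar>)"
proof -
  have I: "set_integrable lebesgue (cball x r) (\<lambda>z. \<bar>Du z \<bullet> i\<bar>)" for i
    using Du_component[of i] by (intro integrable_imp_set_integrable) auto
  have "mass x r \<le> (LINT z:cball x r|lebesgue. (\<Sum>i\<in>Basis. \<bar>Du z \<bullet> i\<bar>))"
    unfolding mass_def
  proof (intro set_integral_mono Dun_set norm_le_l1)
    show "set_integrable lebesgue (cball x r) (\<lambda>z. \<Sum>i\<in>Basis. \<bar>Du z \<bullet> i\<bar>)"
      using I unfolding set_integrable_def scaleR_sum_right by (intro Bochner_Integration.integrable_sum) auto
  qed simp
  also have "\<dots> = (\<Sum>i\<in>Basis. LINT z:cball x r|lebesgue. \<bar>Du z \<bullet> i\<bar>)"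
    unfolding set_lebesgue_integral_def scaleR_sum_right
    using I by (intro Bochner_Integration.integral_sum) (simp add: set_integrable_def)
  finally show ?thesis .
qed

text \<open>By induction on \<open>j\<close>, balls of radius \<open>r j = R / 2\<^sup>j\<close> have mass at most \<open>B (r j)\<^sup>n\<close>. The step uses
  \<open>tame_ball_bound\<close>, whose average \<open>X\<close> and whose mass on the doubled ball are controlled by the
  previous scales. The bound \<open>B\<close> reappears multiplied by \<open>Z R\<^sup>\<beta>\<close>, and the initial scale \<open>R\<close> is so small that
  this is at most \<open>B / 2\<close>. The step needs the
  previous bounds at all points of the ball, which lie further away from \<open>U\<close> than its centre; hence the
  bound is proved on neighbourhoods \<open>near j\<close> of \<open>U\<close> that shrink with \<open>j\<close>. Once all balls are
  controlled, so are all averages, and their limits are the values of \<open>Du\<close>.\<close>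

lemma tame_bounded:
  assumes T: "tame \<beta> M V R0" and \<beta>: "0 < \<beta>" and R0: "0 < R0"
    and U: "\<And>x y. y \<in> U \<Longrightarrow> norm (x - y) \<le> R0 \<Longrightarrow> x \<in> V"
  shows "\<exists>B\<ge>0. \<forall>x\<in>U. good_point x \<longrightarrow> norm (Du x) \<le> B"
proof -
  define n where "n = DIM('a)"
  define D where "D = C * M / lam"
  have D: "0 \<le> D" using C_nonneg lam T by (simp add: tame_def D_def)
  define \<omega> where "\<omega> = measure lebesgue (cball (0::'a) 1)"
  have \<omega>: "0 \<le> \<omega>" by (simp add: \<omega>_def)
  define I where "I = (LINT z|lborel. ker (z::'a))"
  have I: "0 < I" unfolding I_def by (rule ker_integral_pos)
  define m where "m = (LINT z|lebesgue. norm (Du z))"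
  have m: "0 \<le> m" unfolding m_def by (intro Bochner_Integration.integral_nonneg) auto
  define S where "S = 1 / (1 - (1 / 2) powr \<beta>)"
  have S: "0 \<le> S" using \<beta> by (simp add: S_def powr_def mult_pos_neg less_imp_le)
  define \<kappa> where "\<kappa> = \<omega> * (D / \<beta> + D * 2 ^ n / \<beta> * S)"
  have \<kappa>: "0 \<le> \<kappa>" using \<omega> D \<beta> S by (simp add: \<kappa>_def)
  define nI where "nI = real n / I"
  have nI: "0 \<le> nI" using I by (simp add: nI_def)
  define Z where "Z = nI * \<kappa> * 2 ^ n"
  have Z: "0 \<le> Z" using nI \<kappa> by (simp add: Z_def)
  \<comment> \<open>chosen such that \<open>Z * R powr \<beta> \<le> 1 / 2\<close>, which allows to absorb \<open>B\<close> below\<close>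
  define R where "R = min R0 ((1 / (2 * (Z + 1))) powr (1 / \<beta>))"
  have R: "0 < R" "R \<le> R0" using R0 Z by (auto simp: R_def)
  have "R powr \<beta> \<le> ((1 / (2 * (Z + 1))) powr (1 / \<beta>)) powr \<beta>"
    using R \<beta> by (intro powr_mono2) (auto simp: R_def)
  also have "\<dots> = 1 / (2 * (Z + 1))" using \<beta> Z by (simp add: powr_powr)
  finally have "Z * R powr \<beta> \<le> Z * (1 / (2 * (Z + 1)))" using Z by (intro mult_left_mono)
  also have "\<dots> \<le> 1 / 2" using Z by (simp add: divide_simps)
  finally have small: "Z * R powr \<beta> \<le> 1 / 2" .
  define V0 where "V0 = C * m / R ^ n"
  have V0: "0 \<le> V0" using C_nonneg m R by (simp add: V0_def)
  \<comment> \<open>the first term starts the induction, the second is twice the inhomogeneous part of its step\<close>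
  define B where "B = m / R ^ n + 2 * nI * (\<omega> * V0 + \<kappa> * R powr \<beta>)"
  have B: "0 \<le> B" unfolding B_def using m R nI \<omega> V0 \<kappa> by auto
  define r where "r j = R / 2 ^ j" for j :: nat
  have r: "0 < r j" "r j \<le> R" for j using R by (auto simp: r_def divide_simps mult_le_cancel_left1)
  have r_anti: "r j \<le> r k" if "k \<le> j" for j k
    unfolding r_def using R that by (intro divide_left_mono) (auto intro: power_increasing)
  have r_Suc: "2 * r (Suc j) = r j" for j by (simp add: r_def)
  \<comment> \<open>points within \<open>r (Suc j)\<close> of a point that is \<open>near (Suc j)\<close> are \<open>near j\<close>, since \<open>2 * r (Suc j) = r j\<close>\<close>
  define near where "near j x \<longleftrightarrow> (\<exists>y\<in>U. norm (x - y) \<le> r j)" for j x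
  have near_V: "x \<in> V" if "near j x" for j x
    using that U r(2)[of j] R(2) unfolding near_def by (meson order_trans)
  define X where "X = V0 + D * (2 ^ n * B + 1) * R powr \<beta> / \<beta>"
  have avgX: "\<bar>avg i (r j) y\<bar> \<le> X"
    if i: "i \<in> Basis" and y: "\<And>k. k < j \<Longrightarrow> near k y" "y \<in> V"
      and P: "\<And>k x. k < j \<Longrightarrow> near k x \<Longrightarrow> mass x (r k) \<le> B * r k ^ n" for i j y
  proof -
    have "\<bar>avg i R y - avg i (r j) y\<bar> \<le> C * M / lam * (2 ^ n * B + 1) * R powr \<beta> / \<beta>"
    proof (rule tame_scale_bound[OF T y(2) i \<beta> r(1) r(2) R(2)])
      show "0 \<le> 2 ^ n * B" using B by simp
      fix t assume t: "r j \<le> t" "t \<le> R"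
      show "mass y t \<le> 2 ^ n * B * t ^ DIM('a)"
      proof (cases "j = 0")
        case True
        then have "t = R" using t by (simp add: r_def)
        have "m \<le> B * R ^ n"
        proof -
          have "m = m / R ^ n * R ^ n" using R by simp
          also have "\<dots> \<le> B * R ^ n"
            unfolding B_def using R nI \<omega> V0 \<kappa> by (intro mult_right_mono) auto
          finally show ?thesis .
        qed
        also have "\<dots> \<le> 2 ^ n * B * R ^ n"
          using B R by (intro mult_right_mono) (auto simp: mult_le_cancel_right1)
        finally show ?thesis using mass_le[of y t] by (simp add: m_def n_def \<open>t = R\<close>)
      next
        case False
        then obtain k where k: "k < j" "r (Suc k) \<le> t" "t \<le> r k"
          using dyadic_between[of R j t] t unfolding r_def by auto
        have "mass y t \<le> mass y (r k)" using k by (intro mass_mono subset_cball)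
        also have "\<dots> \<le> B * r k ^ n" using P y k by blast
        also have "\<dots> \<le> B * (2 * t) ^ n"
          using B k r(1)[of k] r_Suc[of k] by (intro mult_left_mono power_mono) auto
        finally show ?thesis by (simp add: n_def power_mult_distrib mult_ac)
      qed
    qed
    moreover have "\<bar>avg i R y\<bar> \<le> V0"
      using avg_bound[OF i R(1), of y] by (simp add: V0_def m_def n_def)
    ultimately show ?thesis by (simp add: X_def D_def)
  qed
  have X0: "0 \<le> X" using V0 D B \<beta> by (simp add: X_def)
  have P: "mass x (r j) \<le> B * r j ^ n" if "near j x" for j x
    using that
  proof (induction j arbitrary: x rule: less_induct)
    case (less j)
    show ?case
    proof (cases j)
      case 0
      have "m = m / R ^ n * R ^ n" using R by simp
      also have "\<dots> \<le> B * R ^ n"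
        unfolding B_def using R nI \<omega> V0 \<kappa> by (intro mult_right_mono) auto
      finally show ?thesis using mass_le[of x "r j"] 0 by (simp add: m_def r_def)
    next
      case (Suc j')
      have nb: "near k y" if y: "y \<in> cball x (r j)" and k: "k < j" for y k
      proof -
        obtain u where u: "u \<in> U" "norm (x - u) \<le> r j" using less.prems by (auto simp: near_def)
        have "norm (y - u) \<le> norm (y - x) + norm (x - u)"
          using norm_triangle_ineq[of "y - x" "x - u"] by simp
        also have "\<dots> \<le> r j + r j" using u y by (intro add_mono) (auto simp: dist_norm norm_minus_commute)
        also have "\<dots> = r j'" using r_Suc[of j'] Suc by simp
        also have "\<dots> \<le> r k" using k Suc by (intro r_anti) simp
        finally show ?thesis using u by (auto simp: near_def)
      qed
      have inV: "cball x (r j) \<subseteq> V" using nb[of _ 0] near_V Suc by blast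
      have mx: "mass x (2 * r j) \<le> B * 2 ^ n * r j ^ n"
      proof -
        have "mass x (2 * r j) \<le> B * r j' ^ n"
          using less.IH[of j' x] nb[of x j'] r(1)[of j] r_Suc[of j'] Suc by simp
        then show ?thesis
          by (simp add: r_Suc[symmetric, of j'] Suc power_mult_distrib mult.assoc)
      qed
      have one: "I * (LINT z:cball x (r j)|lebesgue. \<bar>Du z \<bullet> i\<bar>) \<le> r j ^ n * (\<omega> * V0 + \<kappa> * R powr \<beta> * (2 ^ n * B + 1))"
        if i: "i \<in> Basis" for i
      proof -
        have "I * (LINT z:cball x (r j)|lebesgue. \<bar>Du z \<bullet> i\<bar>)
          \<le> \<omega> * (r j ^ n * X + D * 2 ^ n / \<beta> * r j powr \<beta> * S * (mass x (2 * r j) + r j ^ n))"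
          unfolding I_def \<omega>_def D_def S_def n_def
        proof (rule tame_ball_bound[OF T i \<beta> r(1) _ inV])
          show "r j \<le> R0" using r(2)[of j] R(2) by simp
          fix y assume y: "y \<in> cball x (r j)"
          show "\<bar>avg i (r j) y\<bar> \<le> X"
            using nb[OF y] inV y less.IH by (intro avgX[OF i]) auto
        qed
        also have "\<dots> \<le> \<omega> * (r j ^ n * X + D * 2 ^ n / \<beta> * R powr \<beta> * S * (B * 2 ^ n * r j ^ n + r j ^ n))"
          using D \<beta> S \<omega> r[of j] mx mass_nonneg[of x "2 * r j"] B
          by (intro mult_left_mono add_left_mono mult_mono add_right_mono powr_mono2 mult_nonneg_nonneg add_nonneg_nonneg) auto
        also have "\<dots> = r j ^ n * (\<omega> * V0 + \<kappa> * R powr \<beta> * (2 ^ n * B + 1))"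
          unfolding X_def \<kappa>_def by (simp add: algebra_simps add_divide_distrib)
        finally show ?thesis .
      qed
      have "I * mass x (r j) \<le> (\<Sum>i\<in>Basis. I * (LINT z:cball x (r j)|lebesgue. \<bar>Du z \<bullet> i\<bar>))"
        unfolding sum_distrib_left[symmetric] using I by (intro mult_left_mono mass_le_components) simp
      also have "\<dots> \<le> (\<Sum>i\<in>(Basis::'a set). r j ^ n * (\<omega> * V0 + \<kappa> * R powr \<beta> * (2 ^ n * B + 1)))"
        by (intro sum_mono one)
      also have "\<dots> = real n * (r j ^ n * (\<omega> * V0 + \<kappa> * R powr \<beta> * (2 ^ n * B + 1)))"
        by (simp add: n_def)
      finally have "mass x (r j) \<le> real n * (r j ^ n * (\<omega> * V0 + \<kappa> * R powr \<beta> * (2 ^ n * B + 1))) / I"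
        using I by (simp add: pos_le_divide_eq mult.commute)
      also have "\<dots> = r j ^ n * (nI * (\<omega> * V0 + \<kappa> * R powr \<beta>) + Z * R powr \<beta> * B)"
        by (simp add: nI_def Z_def algebra_simps add_divide_distrib)
      also have "\<dots> \<le> r j ^ n * (nI * (\<omega> * V0 + \<kappa> * R powr \<beta>) + 1 / 2 * B)"
        using r(1)[of j] B by (intro mult_left_mono add_left_mono mult_right_mono small) auto
      also have "\<dots> \<le> r j ^ n * B"
      proof (rule mult_left_mono)
        show "nI * (\<omega> * V0 + \<kappa> * R powr \<beta>) + 1 / 2 * B \<le> B"
      proof -
        have "0 \<le> m / R ^ n" using m R by simp
        moreover have "nI * c + 1 / 2 * (b + 2 * nI * c) \<le> b + 2 * nI * c" if "0 \<le> b" for b c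
          using that by (simp add: algebra_simps)
        ultimately show ?thesis unfolding B_def by blast
      qed
      qed (use r(1)[of j] in simp)
      finally show ?thesis by (simp add: mult.commute)
    qed
  qed
  have comp: "\<bar>Du x \<bullet> i\<bar> \<le> X / I" if x: "x \<in> U" "good_point x" and i: "i \<in> Basis" for x i
  proof -
    have nx: "near k x" for k using x r(1)[of k] by (auto simp: near_def intro!: bexI[of _ x])
    have "\<bar>avg i (R / 2 ^ j) x\<bar> \<le> X" for j
      using avgX[OF i, of j x] nx near_V P unfolding r_def by blast
    then have "I * \<bar>Du x \<bullet> i\<bar> \<le> X"
      unfolding I_def by (intro LIMSEQ_le_const2[OF avg_limit[OF x(2) i R(1)]]) auto
    then show ?thesis using I by (simp add: pos_le_divide_eq mult.commute)
  qed
  have "norm (Du x) \<le> real n * (X / I)" if x: "x \<in> U" "good_point x" for x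
  proof -
    have "norm (Du x) \<le> (\<Sum>i\<in>Basis. \<bar>Du x \<bullet> i\<bar>)" by (rule norm_le_l1)
    also have "\<dots> \<le> (\<Sum>i\<in>(Basis::'a set). X / I)" by (intro sum_mono comp x)
    finally show ?thesis by (simp add: n_def)
  qed
  then show ?thesis using X0 I by (intro exI[of _ "real n * (X / I)"]) auto
qed

section \<open>Regularity from pinned data\<close>

lemma err_bound:
  assumes r: "0 < r" and M: "0 \<le> M" and B: "0 \<le> B"
    and a: "AE z in lebesgue. z \<in> cball x r \<longrightarrow> \<bar>a z - c\<bar> \<le> M * r powr \<gamma>"
    and f: "(LINT z:cball x r|lebesgue. norm (F z - f)) \<le> M * r powr (real DIM('a) + \<gamma>)"
    and D: "\<And>z. z \<in> cball x r \<Longrightarrow> good_point z \<Longrightarrow> norm (Du z) \<le> B"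
  shows "err c f (cball x r) \<le> (B * measure lebesgue (cball (0::'a) 1) + 1) * M * r powr (real DIM('a) + \<gamma>)"
proof -
  have Fi: "set_integrable lebesgue (cball x r) (\<lambda>z. norm (F z - f))"
    by (rule shift_norm_integrable[OF F]) simp
  have ci: "set_integrable lebesgue (cball x r) (\<lambda>_. M * r powr \<gamma> * B)"
    by (rule absolutely_integrable_on_const) simp
  have "err c f (cball x r) \<le> (LINT z:cball x r|lebesgue. M * r powr \<gamma> * B + norm (F z - f))"
    unfolding err_def
  proof (rule set_integral_mono_AE)
    show "AE z in lebesgue. z \<in> cball x r \<longrightarrow> \<bar>a z - c\<bar> * norm (Du z) + norm (F z - f) \<le> M * r powr \<gamma> * B + norm (F z - f)"
      using a AE_good_point by eventually_elim (use D M in \<open>auto intro!: mult_mono\<close>)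
  qed (intro flux_integrable set_integral_add ci Fi lmeasurable_cball)+
  also have "\<dots> = M * r powr \<gamma> * B * measure lebesgue (cball x r) + (LINT z:cball x r|lebesgue. norm (F z - f))"
    by (subst set_integral_add(2)[OF ci Fi]) (simp add: set_lebesgue_integral_def mult.commute)
  also have "\<dots> \<le> M * r powr \<gamma> * B * measure lebesgue (cball x r) + M * r powr (real DIM('a) + \<gamma>)"
    using f by simp
  also have "\<dots> = (B * measure lebesgue (cball (0::'a) 1) + 1) * M * r powr (real DIM('a) + \<gamma>)"
    using r by (simp add: content_cball_scale[of r x] powr_add powr_realpow algebra_simps)
  finally show ?thesis .
qed

text \<open>The frozen values are those of \<open>a\<close> and \<open>F\<close> at the centre.\<close>

definition pinned :: "real \<Rightarrow> real \<Rightarrow> real \<Rightarrow> 'a \<Rightarrow> bool"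
  where "pinned s H r w \<longleftrightarrow> lam \<le> a w \<and> 0 \<le> H \<and> cball w r \<subseteq> K \<and>
    (AE z in lebesgue. z \<in> cball w r \<longrightarrow> \<bar>a z - a w\<bar> \<le> H * norm (z - w) powr s) \<and>
    ball_growth (\<lambda>z. norm (F z - F w)) (real DIM('a) + s) H r w"

lemma pinned_tame_at:
  assumes p: "pinned s H r x" and s: "0 < s"
  shows "tame_at s H r x"
  unfolding tame_at_def
proof (intro conjI allI impI)
  have H: "0 \<le> H" using p by (simp add: pinned_def)
  then show "0 \<le> H" .
  fix t assume t: "0 < t \<and> t \<le> r"
  have sub: "cball x t \<subseteq> cball x r" using t by (intro subset_cball) simp
  then show "cball x t \<subseteq> K" using p by (auto simp: pinned_def)
  have "AE z in lebesgue. z \<in> cball x r \<longrightarrow> \<bar>a z - a x\<bar> \<le> H * norm (z - x) powr s"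
    using p by (simp add: pinned_def)
  then have "AE z in lebesgue. z \<in> cball x t \<longrightarrow> \<bar>a z - a x\<bar> \<le> H * t powr s"
  proof eventually_elim
    case (elim z)
    have "H * norm (z - x) powr s \<le> H * t powr s" if "z \<in> cball x t"
      using that H s by (intro mult_left_mono powr_mono2) (auto simp: dist_norm norm_minus_commute)
    then show ?case using elim sub by fastforce
  qed
  then show "\<exists>c\<ge>lam. \<exists>f. (AE z in lebesgue. z \<in> cball x t \<longrightarrow> \<bar>a z - c\<bar> \<le> H * t powr s) \<and>
      (LINT z:cball x t|lebesgue. norm (F z - f)) \<le> H * t powr (real DIM('a) + s)"
    using p t by (intro exI[of _ "a x"] exI[of _ "F x"]) (auto simp: pinned_def ball_growth_def)
qed

text \<open>Otherwise \<open>G\<close> would exceed its total integral on the ball alone.\<close>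

lemma exists_small_point:
  fixes G :: "'a \<Rightarrow> real"
  assumes G: "integrable lebesgue G" "\<And>z. 0 \<le> G z" and t: "0 < t"
    and P: "AE w in lebesgue. w \<in> cball x t \<longrightarrow> P w"
  shows "\<exists>w\<in>cball x t. P w \<and> G w \<le> ((LINT z|lebesgue. G z) + 1) / (measure lebesgue (cball (0::'a) 1) * t ^ DIM('a))"
proof (rule ccontr)
  define J where "J = (LINT z|lebesgue. G z)"
  have J: "0 \<le> J" unfolding J_def using G by simp
  define v where "v = measure lebesgue (cball x t)"
  have v: "0 < v" using t content_cball_pos[of t x] by (simp add: v_def)
  have v': "v = measure lebesgue (cball (0::'a) 1) * t ^ DIM('a)" using t by (simp add: v_def content_cball_scale[of t x])
  assume "\<not> ?thesis"
  then have neg: "\<not> (P w \<and> G w \<le> (J + 1) / v)" if "w \<in> cball x t" for w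
    using that unfolding J_def v' by blast
  have ci: "set_integrable lebesgue (cball x t) (\<lambda>_. (J + 1) / v)"
    by (rule absolutely_integrable_on_const) simp
  have gi: "set_integrable lebesgue S G" if "S \<in> sets lebesgue" for S
    by (intro integrable_imp_set_integrable G(1) that)
  have "(LINT z:cball x t|lebesgue. (J + 1) / v) \<le> (LINT z:cball x t|lebesgue. G z)"
  proof (rule set_integral_mono_AE)
    show "AE z in lebesgue. z \<in> cball x t \<longrightarrow> (J + 1) / v \<le> G z"
      using P by eventually_elim (use neg in force)
  qed (use ci gi[of "cball x t"] in auto)
  also have "\<dots> \<le> (LINT z:UNIV|lebesgue. G z)"
    by (intro set_integral_mono_set_nonneg gi G) auto
  also have "\<dots> = J" by (simp add: J_def set_lebesgue_integral_def)
  also have "(LINT z:cball x t|lebesgue. (J + 1) / v) = J + 1"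
    using v by (simp add: set_lebesgue_integral_def v_def)
  finally show False by simp
qed

text \<open>In a ball of radius \<open>t\<close> there is a pinned point \<open>w\<close> at which \<open>G w\<close> is of order \<open>t\<^sup>-\<^sup>n\<close>. Freezing at \<open>w\<close> instead
  of the centre gives uniform constants, at the price of \<open>n / q\<close> in the exponent.\<close>

lemma pinned_tame:
  assumes s: "0 < s" and q: "0 < q" and R: "0 < R"
    and G: "integrable lebesgue G" "\<And>z. 0 \<le> G z"
    and P: "AE w in lebesgue. w \<in> P \<longrightarrow> pinned s (G w powr (1 / q)) (2 * R) w"
    and V: "\<And>x. x \<in> V \<Longrightarrow> cball x R \<subseteq> P"
  shows "\<exists>M. tame (s - real DIM('a) / q) M V R"
proof -
  define n where "n = DIM('a)"
  define J where "J = (LINT z|lebesgue. G z)"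
  have J: "0 \<le> J" unfolding J_def using G by simp
  define \<omega> where "\<omega> = measure lebesgue (cball (0::'a) 1)"
  have \<omega>: "0 < \<omega>" using content_cball_pos[of 1 "0::'a"] by (simp add: \<omega>_def)
  define H0 where "H0 = ((J + 1) / \<omega>) powr (1 / q)"
  define M where "M = H0 * 2 powr (real n + s)"
  have H0: "0 \<le> H0" by (simp add: H0_def)
  have M: "0 \<le> M" by (simp add: M_def H0)
  have "tame (s - real n / q) M V R"
    unfolding tame_def tame_at_def n_def[symmetric]
  proof (intro conjI M ballI allI impI)
    fix x t assume x: "x \<in> V" and t: "0 < t \<and> t \<le> R"
    have sub: "cball x t \<subseteq> P" using V[OF x] t subset_cball[of t R x] by auto
    have "AE w in lebesgue. w \<in> cball x t \<longrightarrow> pinned s (G w powr (1 / q)) (2 * R) w"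
      using P by eventually_elim (use sub in auto)
    from exists_small_point[OF G _ this] obtain w where w: "w \<in> cball x t"
      and pin: "pinned s (G w powr (1 / q)) (2 * R) w" and Gw: "G w \<le> (J + 1) / (\<omega> * t ^ n)"
      using t unfolding J_def \<omega>_def n_def by blast
    define H where "H = G w powr (1 / q)"
    have H: "0 \<le> H" by (simp add: H_def)
    have HH: "H \<le> H0 * t powr (- real n / q)"
    proof -
      have "H \<le> ((J + 1) / (\<omega> * t ^ n)) powr (1 / q)"
        unfolding H_def using Gw G q by (intro powr_mono2) auto
      also have "(J + 1) / (\<omega> * t ^ n) = (J + 1) / \<omega> * t powr (- real n)"
        using t \<omega> by (simp add: powr_minus powr_realpow field_simps)
      also have "\<dots> powr (1 / q) = H0 * t powr (- real n / q)"
        using J \<omega> by (subst powr_mult) (auto simp: powr_powr H0_def)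
      finally show ?thesis .
    qed
    have sub2: "cball x t \<subseteq> cball w (2 * t)" "cball w (2 * t) \<subseteq> cball w (2 * R)"
    proof -
      show "cball x t \<subseteq> cball w (2 * t)"
      proof
        fix z assume "z \<in> cball x t"
        then show "z \<in> cball w (2 * t)" using w dist_triangle[of w z x] by (simp add: dist_commute)
      qed
      show "cball w (2 * t) \<subseteq> cball w (2 * R)" using t by (intro subset_cball) simp
    qed
    show "cball x t \<subseteq> K" using sub2 pin unfolding pinned_def by blast
    show "\<exists>c\<ge>lam. \<exists>f. (AE z in lebesgue. z \<in> cball x t \<longrightarrow> \<bar>a z - c\<bar> \<le> M * t powr (s - real n / q)) \<and>
       (LINT z:cball x t|lebesgue. norm (F z - f)) \<le> M * t powr (real n + (s - real n / q))"
    proof (intro exI[of _ "a w"] exI[of _ "F w"] conjI)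
      show "lam \<le> a w" using pin by (simp add: pinned_def)
      have e2: "H * (2 * t) powr p \<le> H0 * 2 powr p * t powr (p - real n / q)" for p
      proof -
        have "H * (2 * t) powr p \<le> H0 * t powr (- real n / q) * (2 * t) powr p"
          by (intro mult_right_mono HH) simp
        also have "\<dots> = H0 * 2 powr p * (t powr (- real n / q) * t powr p)"
          using t by (simp add: powr_mult mult_ac)
        also have "t powr (- real n / q) * t powr p = t powr (p - real n / q)"
          by (simp add: powr_add[symmetric])
        finally show ?thesis .
      qed
      have "AE z in lebesgue. z \<in> cball w (2 * R) \<longrightarrow> \<bar>a z - a w\<bar> \<le> H * norm (z - w) powr s"
        using pin by (simp add: pinned_def H_def)
      then show "AE z in lebesgue. z \<in> cball x t \<longrightarrow> \<bar>a z - a w\<bar> \<le> M * t powr (s - real n / q)"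
      proof eventually_elim
        case z: (elim z)
        show ?case
        proof
          assume "z \<in> cball x t"
          then have zw: "z \<in> cball w (2 * t)" using sub2 by blast
          then have "\<bar>a z - a w\<bar> \<le> H * norm (z - w) powr s" using z sub2 by blast
          also have "\<dots> \<le> H * (2 * t) powr s"
            using zw H s by (intro mult_left_mono powr_mono2) (auto simp: dist_norm norm_minus_commute)
          also have "\<dots> \<le> H0 * 2 powr s * t powr (s - real n / q)" by (rule e2)
          also have "\<dots> \<le> M * t powr (s - real n / q)"
            unfolding M_def using H0 by (intro mult_right_mono mult_left_mono powr_mono) auto
          finally show "\<bar>a z - a w\<bar> \<le> M * t powr (s - real n / q)" .
        qed
      qed
      have "(LINT z:cball x t|lebesgue. norm (F z - F w)) \<le> (LINT z:cball w (2 * t)|lebesgue. norm (F z - F w))"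
        using sub2 by (intro set_integral_mono_set_nonneg shift_norm_integrable[OF F]) auto
      also have "\<dots> \<le> H * (2 * t) powr (real n + s)"
        using pin t by (simp add: pinned_def ball_growth_def H_def n_def)
      also have "\<dots> \<le> M * t powr (real n + s - real n / q)" unfolding M_def by (rule e2)
      finally show "(LINT z:cball x t|lebesgue. norm (F z - F w)) \<le> M * t powr (real n + (s - real n / q))"
        by (simp add: add_diff_eq)
    qed
  qed
  then show ?thesis unfolding n_def by blast
qed

text \<open>For bounded \<open>Du\<close> the error is controlled by the oscillation of the data alone.\<close>

lemma tame_at_flat:
  assumes T: "tame_at \<beta> M r x" and \<beta>: "0 < \<beta>" and r: "0 < r" and B: "0 \<le> B"
    and D: "\<And>z. z \<in> cball x r \<Longrightarrow> good_point z \<Longrightarrow> norm (Du z) \<le> B"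
  shows "flat \<beta> (r / 2) ((B * measure lebesgue (cball (0::'a) 1) + 1) * 2 powr (real DIM('a) + \<beta>) * M) x"
  unfolding flat_def
proof (intro conjI allI impI)
  have M: "0 \<le> M" using T by (simp add: tame_at_def)
  show "0 \<le> (B * measure lebesgue (cball (0::'a) 1) + 1) * 2 powr (real DIM('a) + \<beta>) * M"
    using B M by simp
  have "cball x r \<subseteq> K" using T r unfolding tame_at_def by blast
  then show "cball x (2 * (r / 2)) \<subseteq> K" by simp
  fix t assume t: "0 < t \<and> t \<le> r / 2"
  have sub: "cball x (2 * t) \<subseteq> cball x r" using t by (intro subset_cball) simp
  have t2: "0 < 2 * t \<and> 2 * t \<le> r" using t by auto
  then obtain c f where c: "lam \<le> c" and ae: "AE z in lebesgue. z \<in> cball x (2 * t) \<longrightarrow> \<bar>a z - c\<bar> \<le> M * (2 * t) powr \<beta>"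
    and f: "(LINT z:cball x (2 * t)|lebesgue. norm (F z - f)) \<le> M * (2 * t) powr (real DIM('a) + \<beta>)"
    using T unfolding tame_at_def by blast
  have "err c f (cball x (2 * t)) \<le> (B * measure lebesgue (cball (0::'a) 1) + 1) * M * (2 * t) powr (real DIM('a) + \<beta>)"
    using t2 sub D by (intro err_bound[OF _ M B ae f]) auto
  also have "\<dots> = (B * measure lebesgue (cball (0::'a) 1) + 1) * 2 powr (real DIM('a) + \<beta>) * M * t powr (real DIM('a) + \<beta>)"
    using t by (simp add: powr_mult mult_ac)
  finally show "\<exists>c\<ge>lam. \<exists>f. err c f (cball x (2 * t)) \<le> (B * measure lebesgue (cball (0::'a) 1) + 1) * 2 powr (real DIM('a) + \<beta>) * M * t powr (real DIM('a) + \<beta>)"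
    using c by blast
qed

text \<open>The three radii serve three purposes: within \<open>3R\<close> of \<open>U\<close> all points are tame, within \<open>2R\<close> the function
  \<open>Du\<close> is bounded, and on \<open>U\<close> itself \<open>flat_holder\<close> applies. It is applied twice: with the exponent
  \<open>s - n/q\<close> and the uniform constants coming from \<open>pinned_tame\<close>, and with the better exponent \<open>s\<close> and
  constants proportional to \<open>G\<^sup>1\<^sup>/\<^sup>q\<close> at the two points.\<close>

lemma pinned_regularity:
  assumes s: "0 < s" "s < 1" and q: "0 < q" "real DIM('a) < s * q" and R: "0 < R" "R \<le> 1"
    and G: "integrable lebesgue G" "\<And>z. 0 \<le> G z"
    and P: "AE w in lebesgue. w \<in> P \<longrightarrow> pinned s (G w powr (1 / q)) (2 * R) w"
    and U: "\<And>u. u \<in> U \<Longrightarrow> cball u (4 * R) \<subseteq> P"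
  shows "\<exists>M\<ge>0. (\<forall>x\<in>U. good_point x \<longrightarrow> norm (Du x) \<le> M) \<and>
    (\<forall>x\<in>U. \<forall>y\<in>U. good_point x \<longrightarrow> good_point y \<longrightarrow> norm (x - y) \<le> R / 2 \<longrightarrow>
      norm (Du x - Du y) \<le> M * norm (x - y) powr (s - real DIM('a) / q)) \<and>
    (\<forall>x\<in>U. \<forall>y\<in>U. good_point x \<longrightarrow> good_point y \<longrightarrow>
      pinned s (G x powr (1 / q)) (2 * R) x \<longrightarrow> pinned s (G y powr (1 / q)) (2 * R) y \<longrightarrow> norm (x - y) \<le> R / 2 \<longrightarrow>
      norm (Du x - Du y) \<le> M * (G x powr (1 / q) + G y powr (1 / q) + 1) * norm (x - y) powr s)"
proof -
  define \<beta> where "\<beta> = s - real DIM('a) / q"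
  have \<beta>: "0 < \<beta>" "\<beta> < 1"
  proof -
    have "0 < real DIM('a) / q" using q by simp
    then show "\<beta> < 1" using s by (simp add: \<beta>_def)
    show "0 < \<beta>" using q by (simp add: \<beta>_def pos_divide_less_eq)
  qed
  define V where "V = {x. \<exists>u\<in>U. norm (x - u) \<le> 3 * R}"
  define W where "W = {x. \<exists>u\<in>U. norm (x - u) \<le> 2 * R}"
  have VP: "cball x R \<subseteq> P" if x: "x \<in> V" for x
  proof -
    obtain u where u: "u \<in> U" "norm (x - u) \<le> 3 * R" using x by (auto simp: V_def)
    have "cball x R \<subseteq> cball u (4 * R)"
    proof
      fix z assume "z \<in> cball x R"
      then show "z \<in> cball u (4 * R)"
        using u dist_triangle[of u z x] by (simp add: dist_norm norm_minus_commute)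
    qed
    then show ?thesis using U[OF u(1)] by blast
  qed
  obtain M1 where T: "tame \<beta> M1 V R"
    using pinned_tame[OF s(1) q(1) R(1) G P VP] unfolding \<beta>_def by blast
  have WV: "x \<in> V" if y: "y \<in> W" and xy: "norm (x - y) \<le> R" for x y
  proof -
    obtain u where u: "u \<in> U" "norm (y - u) \<le> 2 * R" using y by (auto simp: W_def)
    have "norm (x - u) \<le> 3 * R"
      using u xy norm_triangle_ineq[of "x - y" "y - u"] by simp
    then show ?thesis using u by (auto simp: V_def)
  qed
  have "\<exists>B\<ge>0. \<forall>x\<in>W. good_point x \<longrightarrow> norm (Du x) \<le> B"
    by (rule tame_bounded[OF T \<beta>(1) R(1)]) (rule WV)
  then obtain B where B: "0 \<le> B" "\<And>x. x \<in> W \<Longrightarrow> good_point x \<Longrightarrow> norm (Du x) \<le> B"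
    by auto
  have UW: "cball u (2 * R) \<subseteq> W" "cball u R \<subseteq> W" "u \<in> W" "u \<in> V" if "u \<in> U" for u
  proof -
    show "u \<in> W" "u \<in> V" using that R by (auto simp: W_def V_def intro!: bexI[of _ u])
    have "z \<in> W" if "z \<in> cball u (2 * R)" for z
      using that \<open>u \<in> U\<close> unfolding W_def by (auto simp: dist_norm norm_minus_commute intro!: bexI[of _ u])
    then show "cball u (2 * R) \<subseteq> W" by blast
    moreover have "cball u R \<subseteq> cball u (2 * R)" using R by (intro subset_cball) simp
    ultimately show "cball u R \<subseteq> W" by blast
  qed
  define A1 where "A1 = (B * measure lebesgue (cball (0::'a) 1) + 1) * 2 powr (real DIM('a) + \<beta>) * M1"
  have fl1: "flat \<beta> (R / 2) A1 u" if u: "u \<in> U" for u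
    unfolding A1_def using UW[OF u] B R T by (intro tame_at_flat[OF _ \<beta>(1)]) (auto simp: tame_def)
  define A2 where "A2 = (B * measure lebesgue (cball (0::'a) 1) + 1) * 2 powr (real DIM('a) + s)"
  have A2: "1 \<le> A2"
  proof -
    have "1 * 1 \<le> (B * measure lebesgue (cball (0::'a) 1) + 1) * 2 powr (real DIM('a) + s)"
      using B s by (intro mult_mono) (auto intro: ge_one_powr_ge_zero)
    then show ?thesis by (simp add: A2_def)
  qed
  have fl2: "flat s (R / 2) (A2 * G u powr (1 / q)) u" if u: "u \<in> U" and p: "pinned s (G u powr (1 / q)) (2 * R) u" for u
  proof -
    have "tame_at s (G u powr (1 / q)) R u"
      using pinned_tame_at[OF p s(1)] R unfolding tame_at_def by auto
    then show ?thesis unfolding A2_def using UW[OF u] B R s by (intro tame_at_flat) auto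
  qed
  define h1 where "h1 = max 0 (holder_const \<beta> (R / 2))"
  define h2 where "h2 = max 0 (holder_const s (R / 2))"
  define M where "M = B + h1 * (A1 + A1 + 1) + h2 * A2"
  have A1: "0 \<le> A1 \<or> U = {}" using fl1 by (auto simp: flat_def)
  show ?thesis
  proof (cases "U = {}")
    case True
    then show ?thesis by auto
  next
    case False
    then have A1: "0 \<le> A1" using A1 by simp
    have M0: "0 \<le> B" "0 \<le> h1 * (A1 + A1 + 1)" "0 \<le> h2 * A2"
      using B A1 A2 by (auto simp: h1_def h2_def)
    show ?thesis
    proof (intro exI[of _ M] conjI ballI impI)
      show "0 \<le> M" using M0 by (simp add: M_def)
      show "norm (Du x) \<le> M" if "x \<in> U" "good_point x" for x
        using B(2)[OF UW(3)[OF that(1)] that(2)] M0 by (simp add: M_def)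
      fix x y assume xy: "x \<in> U" "y \<in> U" "good_point x" "good_point y"
      {
        assume d: "norm (x - y) \<le> R / 2"
        have "norm (Du x - Du y) \<le> holder_const \<beta> (R / 2) * (A1 + A1 + 1) * norm (x - y) powr \<beta>"
          using xy d R \<beta> by (intro flat_holder fl1) auto
        also have "\<dots> \<le> M * norm (x - y) powr \<beta>"
        proof (rule mult_right_mono)
          have "holder_const \<beta> (R / 2) * (A1 + A1 + 1) \<le> h1 * (A1 + A1 + 1)"
            using A1 by (intro mult_right_mono) (auto simp: h1_def)
          then show "holder_const \<beta> (R / 2) * (A1 + A1 + 1) \<le> M" using M0 by (simp add: M_def)
        qed simp
        finally show "norm (Du x - Du y) \<le> M * norm (x - y) powr (s - real DIM('a) / q)"
          by (simp add: \<beta>_def)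
      }
      {
        assume p: "pinned s (G x powr (1 / q)) (2 * R) x" "pinned s (G y powr (1 / q)) (2 * R) y"
          and d: "norm (x - y) \<le> R / 2"
        define g where "g = G x powr (1 / q) + G y powr (1 / q)"
        have g: "0 \<le> g" by (simp add: g_def)
        have "norm (Du x - Du y) \<le> holder_const s (R / 2) * (A2 * G x powr (1 / q) + A2 * G y powr (1 / q) + 1) * norm (x - y) powr s"
          using xy d R s p by (intro flat_holder fl2) auto
        also have "\<dots> \<le> M * (g + 1) * norm (x - y) powr s"
        proof (rule mult_right_mono)
          have "holder_const s (R / 2) * (A2 * G x powr (1 / q) + A2 * G y powr (1 / q) + 1) \<le> h2 * (A2 * (g + 1))"
            using A2 g by (intro mult_mono) (auto simp: h2_def g_def algebra_simps)
          also have "\<dots> \<le> M * (g + 1)"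
            unfolding mult.assoc[symmetric] using M0 g by (intro mult_right_mono) (auto simp: M_def)
          finally show "holder_const s (R / 2) * (A2 * G x powr (1 / q) + A2 * G y powr (1 / q) + 1) \<le> M * (g + 1)" .
        qed simp
        finally show "norm (Du x - Du y) \<le> M * (G x powr (1 / q) + G y powr (1 / q) + 1) * norm (x - y) powr s"
          by (simp add: g_def)
      }
    qed
  qed
qed

end

section \<open>Fractional maximal estimates\<close>

text \<open>On a dyadic annulus the power is comparable to its value at the outer radius.\<close>

lemma riesz_kernel_pointwise:
  fixes t R :: real
  assumes t: "0 < t" "t \<le> R"
  shows "\<exists>k. t \<le> R / 2 ^ k \<and> t powr p \<le> 2 powr \<bar>p\<bar> * (R / 2 ^ k) powr p"
proof -
  have R: "0 < R" using t by simp
  obtain j where j: "R / t < 2 ^ j" using real_arch_pow[of 2 "R / t"] by auto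
  then have jt: "R / 2 ^ j \<le> t" using t by (simp add: field_simps)
  have j0: "0 < j"
  proof (rule ccontr)
    assume "\<not> 0 < j"
    then have "R / t < 1" using j by simp
    then show False using t by simp
  qed
  obtain k where k: "R / 2 ^ Suc k \<le> t" "t \<le> R / 2 ^ k"
    using dyadic_between[OF jt t(2) j0] by blast
  define s where "s = R / 2 ^ k"
  have s: "0 < s" "s / 2 \<le> t" "t \<le> s" using k R by (auto simp: s_def mult.commute)
  have "t powr p \<le> 2 powr \<bar>p\<bar> * s powr p"
  proof (cases "0 \<le> p")
    case True
    have "t powr p \<le> s powr p" using s t True by (intro powr_mono2) auto
    also have "\<dots> \<le> 2 powr \<bar>p\<bar> * s powr p"
      using mult_right_mono[of 1 "2 powr \<bar>p\<bar>" "s powr p"] by (simp add: ge_one_powr_ge_zero)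
    finally show ?thesis .
  next
    case False
    have "t powr p \<le> (s / 2) powr p" using s False by (intro powr_mono2') auto
    also have "\<dots> = 2 powr \<bar>p\<bar> * s powr p"
      using s False by (simp add: powr_divide powr_minus_divide[of 2 p, symmetric] abs_if) (simp add: powr_minus divide_inverse)
    finally show ?thesis .
  qed
  then show ?thesis using s by (intro exI[of _ k]) (simp add: s_def)
qed

text \<open>Dyadic annuli contribute a geometric series with ratio \<open>2\<^sup>-\<^sup>\<kappa>\<close>.\<close>

lemma riesz_kernel:
  assumes \<kappa>: "0 < \<kappa>" and R: "0 < R"
  shows "\<exists>c. \<forall>x::'a::euclidean_space.
    (\<integral>\<^sup>+y. ennreal (norm (x - y) powr (\<kappa> - real DIM('a))) * indicator (cball x R) y \<partial>lebesgue) \<le> ennreal c"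
proof -
  define n where "n = DIM('a)"
  define \<omega> where "\<omega> = measure lebesgue (cball (0::'a) 1)"
  have \<omega>: "0 \<le> \<omega>" by (simp add: \<omega>_def)
  define p where "p = \<kappa> - real n"
  define c0 where "c0 = 2 powr \<bar>p\<bar>"
  have c0: "0 < c0" by (simp add: c0_def)
  define s where "s k = R / 2 ^ k" for k :: nat
  have s: "0 < s k" for k using R by (simp add: s_def)
  define w where "w = (1 / 2) powr \<kappa>"
  have w: "0 < w" "w < 1" using \<kappa> by (auto simp: w_def powr_def mult_pos_neg)
  have sw: "s k powr \<kappa> = R powr \<kappa> * w ^ k" for k
  proof -
    have "s k = R * (1 / 2) ^ k" by (simp add: s_def power_divide)
    then have "s k powr \<kappa> = R powr \<kappa> * ((1 / 2) ^ k) powr \<kappa>" using R by (simp add: powr_mult)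
    also have "((1 / 2 :: real) ^ k) powr \<kappa> = w ^ k"
      unfolding w_def by (simp add: powr_powr mult.commute flip: powr_realpow)
    finally show ?thesis .
  qed
  have "(\<integral>\<^sup>+y. ennreal (norm (x - y) powr p) * indicator (cball x R) y \<partial>lebesgue)
      \<le> ennreal (c0 * \<omega> * R powr \<kappa> * (1 / (1 - w)))" for x :: 'a
  proof -
    have "(\<integral>\<^sup>+y. ennreal (norm (x - y) powr p) * indicator (cball x R) y \<partial>lebesgue)
      \<le> (\<integral>\<^sup>+y. (\<Sum>k. ennreal (c0 * s k powr p) * indicator (cball x (s k)) y) \<partial>lebesgue)"
    proof (rule nn_integral_mono)
      fix y
      show "ennreal (norm (x - y) powr p) * indicator (cball x R) y \<le> (\<Sum>k. ennreal (c0 * s k powr p) * indicator (cball x (s k)) y)"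
      proof (cases "x \<noteq> y \<and> y \<in> cball x R")
        case True
        then obtain k where k: "norm (x - y) \<le> s k" "norm (x - y) powr p \<le> c0 * s k powr p"
          using riesz_kernel_pointwise[of "norm (x - y)" R p] by (auto simp: s_def c0_def dist_norm)
        have "ennreal (norm (x - y) powr p) * indicator (cball x R) y \<le> (\<Sum>k\<in>{k}. ennreal (c0 * s k powr p) * indicator (cball x (s k)) y)"
          using k True by (simp add: dist_norm ennreal_leI)
        also have "\<dots> \<le> (\<Sum>k. ennreal (c0 * s k powr p) * indicator (cball x (s k)) y)"
          by (intro sum_le_suminf) auto
        finally show ?thesis .
      qed auto
    qed
    also have "\<dots> = (\<Sum>k. \<integral>\<^sup>+y. ennreal (c0 * s k powr p) * indicator (cball x (s k)) y \<partial>lebesgue)"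
      by (intro nn_integral_suminf) measurable
    also have "\<dots> = (\<Sum>k. ennreal (c0 * \<omega> * R powr \<kappa> * w ^ k))"
    proof (rule suminf_cong)
      fix k
      have "(\<integral>\<^sup>+y. ennreal (c0 * s k powr p) * indicator (cball x (s k)) y \<partial>lebesgue) = ennreal (c0 * s k powr p) * ennreal (\<omega> * s k ^ n)"
        unfolding \<omega>_def n_def using s[of k]
        by (subst ball_emeasure[symmetric]) (auto intro!: nn_integral_cmult_indicator simp del: emeasure_completion)
      also have "\<dots> = ennreal (c0 * s k powr p * (\<omega> * s k ^ n))"
        using c0 \<omega> s[of k] by (intro ennreal_mult[symmetric]) auto
      also have "c0 * s k powr p * (\<omega> * s k ^ n) = c0 * \<omega> * (s k powr p * s k powr real n)"
        using s[of k] by (simp add: powr_realpow)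
      also have "s k powr p * s k powr real n = R powr \<kappa> * w ^ k"
        by (simp add: powr_add[symmetric] p_def sw)
      finally show "(\<integral>\<^sup>+y. ennreal (c0 * s k powr p) * indicator (cball x (s k)) y \<partial>lebesgue) = ennreal (c0 * \<omega> * R powr \<kappa> * w ^ k)"
        by (simp add: mult.assoc)
    qed
    also have "\<dots> = ennreal (c0 * \<omega> * R powr \<kappa> * (1 / (1 - w)))"
    proof -
      have "(\<lambda>k. c0 * \<omega> * R powr \<kappa> * w ^ k) sums (c0 * \<omega> * R powr \<kappa> * (1 / (1 - w)))"
        using w by (intro sums_mult geometric_sums) auto
      then show ?thesis using c0 \<omega> w by (intro suminf_ennreal_eq) auto
    qed
    finally show ?thesis .
  qed
  then show ?thesis unfolding p_def n_def by blast
qed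

text \<open>With the optimal \<open>h\<close> this replaces Hoelder's inequality.\<close>

lemma young_power:
  fixes A h q :: real
  assumes "0 \<le> A" "0 < h" "1 \<le> q"
  shows "A \<le> h + A powr q * h powr (1 - q)"
proof (cases "A \<le> h")
  case False
  then have A: "0 < A" using assms by simp
  have "A = A powr q * A powr (1 - q)" using A by (simp add: powr_add[symmetric])
  also have "\<dots> \<le> A powr q * h powr (1 - q)"
    using False assms by (intro mult_left_mono powr_mono2') auto
  finally show ?thesis using assms by simp
qed (use assms in \<open>simp add: add_increasing2\<close>)

text \<open>Apply \<open>young_power\<close> pointwise with \<open>h = \<rho>\<^sup>\<sigma> G\<^sup>1\<^sup>/\<^sup>q\<close>, which balances the two terms after integration.\<close>

lemma holder_ball:
  fixes w :: "'a::euclidean_space \<Rightarrow> real"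
  assumes w: "set_integrable lebesgue (cball x \<rho>) w" "w \<in> borel_measurable lebesgue" "\<And>z. 0 \<le> w z"
    and q: "1 \<le> q" and G: "0 < G" and \<rho>: "0 < \<rho>"
    and b: "(\<integral>\<^sup>+z. ennreal (w z powr q) * indicator (cball x \<rho>) z \<partial>lebesgue) \<le> ennreal (\<rho> powr (\<sigma> * q + real DIM('a)) * G)"
  shows "(LINT z:cball x \<rho>|lebesgue. w z) \<le> (measure lebesgue (cball (0::'a) 1) + 1) * G powr (1 / q) * \<rho> powr (real DIM('a) + \<sigma>)"
proof -
  define n where "n = DIM('a)"
  define \<omega> where "\<omega> = measure lebesgue (cball (0::'a) 1)"
  have \<omega>: "0 \<le> \<omega>" by (simp add: \<omega>_def)
  define h where "h = \<rho> powr \<sigma> * G powr (1 / q)"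
  have h: "0 < h" using \<rho> G by (simp add: h_def)
  note w(2)[measurable]
  have "ennreal (LINT z:cball x \<rho>|lebesgue. w z) = (\<integral>\<^sup>+z. ennreal (indicator (cball x \<rho>) z *\<^sub>R w z) \<partial>lebesgue)"
    unfolding set_lebesgue_integral_def using w(1,3)
    by (intro nn_integral_eq_integral[symmetric]) (auto simp: set_integrable_def)
  also have "\<dots> \<le> (\<integral>\<^sup>+z. ennreal h * indicator (cball x \<rho>) z + ennreal (h powr (1 - q)) * (ennreal (w z powr q) * indicator (cball x \<rho>) z) \<partial>lebesgue)"
  proof (rule nn_integral_mono)
    fix z
    have "ennreal (w z) \<le> ennreal h + ennreal (h powr (1 - q)) * ennreal (w z powr q)"
      using young_power[OF w(3) h q, of z] h by (simp add: ennreal_mult[symmetric] ennreal_plus[symmetric] mult.commute ennreal_leI del: ennreal_plus)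
    then show "ennreal (indicator (cball x \<rho>) z *\<^sub>R w z) \<le> ennreal h * indicator (cball x \<rho>) z + ennreal (h powr (1 - q)) * (ennreal (w z powr q) * indicator (cball x \<rho>) z)"
      by (auto simp: indicator_def)
  qed
  also have "\<dots> = (\<integral>\<^sup>+z. ennreal h * indicator (cball x \<rho>) z \<partial>lebesgue) + (\<integral>\<^sup>+z. ennreal (h powr (1 - q)) * (ennreal (w z powr q) * indicator (cball x \<rho>) z) \<partial>lebesgue)"
    by (intro nn_integral_add) measurable
  also have "(\<integral>\<^sup>+z. ennreal (h powr (1 - q)) * (ennreal (w z powr q) * indicator (cball x \<rho>) z) \<partial>lebesgue)
      = ennreal (h powr (1 - q)) * (\<integral>\<^sup>+z. ennreal (w z powr q) * indicator (cball x \<rho>) z \<partial>lebesgue)"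
    by (intro nn_integral_cmult) measurable
  also have "(\<integral>\<^sup>+z. ennreal h * indicator (cball x \<rho>) z \<partial>lebesgue) = ennreal h * ennreal (\<omega> * \<rho> ^ n)"
    unfolding \<omega>_def n_def using \<rho>
    by (subst ball_emeasure[symmetric]) (auto intro!: nn_integral_cmult_indicator simp del: emeasure_completion)
  finally have "ennreal (LINT z:cball x \<rho>|lebesgue. w z) \<le> ennreal h * ennreal (\<omega> * \<rho> ^ n)
      + ennreal (h powr (1 - q)) * (\<integral>\<^sup>+z. ennreal (w z powr q) * indicator (cball x \<rho>) z \<partial>lebesgue)" .
  also have "\<dots> \<le> ennreal h * ennreal (\<omega> * \<rho> ^ n) + ennreal (h powr (1 - q)) * ennreal (\<rho> powr (\<sigma> * q + real n) * G)"
    using b unfolding n_def by (intro add_left_mono mult_left_mono) auto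
  also have "\<dots> = ennreal (h * (\<omega> * \<rho> ^ n) + h powr (1 - q) * (\<rho> powr (\<sigma> * q + real n) * G))"
    using h \<omega> \<rho> G by (intro ennreal_mult_add_mult) auto
  finally have "(LINT z:cball x \<rho>|lebesgue. w z) \<le> h * (\<omega> * \<rho> ^ n) + h powr (1 - q) * (\<rho> powr (\<sigma> * q + real n) * G)"
    using h \<omega> \<rho> G by (subst (asm) ennreal_le_iff) auto
  also have "h powr (1 - q) * (\<rho> powr (\<sigma> * q + real n) * G) = \<rho> powr (real n) * h"
  proof -
    have "h powr (1 - q) = h / h powr q" using h by (simp add: powr_diff)
    moreover have "h powr q = \<rho> powr (\<sigma> * q) * G"
      using \<rho> G q by (simp add: h_def powr_mult powr_powr)
    ultimately show ?thesis using \<rho> G by (simp add: powr_add)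
  qed
  also have "h * (\<omega> * \<rho> ^ n) + \<rho> powr (real n) * h = (\<omega> + 1) * G powr (1 / q) * \<rho> powr (real n + \<sigma>)"
    using \<rho> by (simp add: h_def powr_add powr_realpow algebra_simps)
  finally show ?thesis by (simp add: \<omega>_def n_def)
qed

lemma integrable_from_nn:
  fixes f :: "'a \<Rightarrow> ennreal"
  assumes "f \<in> borel_measurable M" "(\<integral>\<^sup>+x. f x \<partial>M) < \<infinity>"
  shows "integrable M (\<lambda>x. enn2real (f x))" and "AE x in M. ennreal (enn2real (f x)) = f x"
proof -
  have ae: "AE x in M. f x \<noteq> \<infinity>" using assms by (intro nn_integral_PInf_AE) auto
  then show e: "AE x in M. ennreal (enn2real (f x)) = f x"
    by eventually_elim (auto simp: top.not_eq_extremum less_top)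
  have "(\<integral>\<^sup>+x. ennreal (enn2real (f x)) \<partial>M) = (\<integral>\<^sup>+x. f x \<partial>M)"
    by (intro nn_integral_cong_AE e)
  then show "integrable M (\<lambda>x. enn2real (f x))"
    using assms by (intro integrableI_nonneg) auto
qed

text \<open>The supremum over radii is replaced by a Riesz potential: the integral of \<open>w\<^sup>q\<close> over the ball is at most
  \<open>\<rho>\<^sup>n\<^sup>-\<^sup>\<epsilon>\<^sup>q\<close> times the potential of \<open>w\<^sup>q\<close> with kernel \<open>|x - y|\<^sup>\<epsilon>\<^sup>q\<^sup>-\<^sup>n\<close>, and this potential is integrable because \<open>\<epsilon> > 0\<close>.
  Adding the indicator function of \<open>P\<close> makes \<open>G\<close> positive there, as \<open>holder_ball\<close> requires.\<close>

lemma fractional_maximal: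
  fixes w :: "'a::euclidean_space \<Rightarrow> real"
  assumes w: "integrable lebesgue w" "\<And>z. 0 \<le> w z" and wq: "integrable lebesgue (\<lambda>z. w z powr q)"
    and q: "1 \<le> q" and \<epsilon>: "0 < \<epsilon>" "\<epsilon> * q \<le> real DIM('a)" and R: "0 < R" and P: "P \<in> lmeasurable"
  shows "\<exists>G. integrable lebesgue G \<and> (\<forall>x. 0 \<le> G x) \<and> (\<forall>x\<in>P. 1 \<le> G x) \<and>
    (AE x in lebesgue. x \<in> P \<longrightarrow> ball_growth w (real DIM('a) - \<epsilon>) (G x powr (1 / q)) R x)"
proof -
  define n where "n = DIM('a)"
  define p where "p = \<epsilon> * q - real n"
  have p: "p \<le> 0" using \<epsilon> by (simp add: p_def n_def)
  obtain c where c: "\<And>x::'a. (\<integral>\<^sup>+y. ennreal (norm (x - y) powr p) * indicator (cball x R) y \<partial>lebesgue) \<le> ennreal c"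
    using riesz_kernel[of "\<epsilon> * q" R] \<epsilon> q R unfolding p_def n_def by auto
  define k where "k x y = ennreal (w y powr q) * (ennreal (norm (x - y) powr p) * indicator {p. norm (fst p - snd p) \<le> R} (x, y))" for x y :: 'a
  note norm_diff_measurable[where 'a = 'a, measurable]
  have wm[measurable]: "w \<in> borel_measurable lebesgue" using w by simp
  have km: "case_prod k \<in> borel_measurable (lebesgue \<Otimes>\<^sub>M (lebesgue :: 'a measure))"
  proof -
    have "(\<lambda>p. ennreal (w (snd p) powr q)) \<in> borel_measurable (lebesgue \<Otimes>\<^sub>M (lebesgue :: 'a measure))"
      by measurable
    moreover have "(\<lambda>p'. ennreal (norm (fst p' - snd p') powr p) * indicator {p. norm (fst p - snd p) \<le> R} p') \<in> borel_measurable (lebesgue \<Otimes>\<^sub>M (lebesgue :: 'a measure))"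
      by measurable
    ultimately show ?thesis unfolding k_def by (simp add: case_prod_beta')
  qed
  define g where "g x = (\<integral>\<^sup>+y. k x y \<partial>lebesgue)" for x
  have gm: "g \<in> borel_measurable lebesgue"
    unfolding g_def[abs_def] by (rule sigma_finite_measure.borel_measurable_nn_integral[OF sigma_finite_lebesgue km])
  have "(\<integral>\<^sup>+x. g x \<partial>lebesgue) = (\<integral>\<^sup>+y. \<integral>\<^sup>+x. k x y \<partial>lebesgue \<partial>lebesgue)"
    unfolding g_def using leb_pair.Fubini'[OF km] by simp
  also have "\<dots> \<le> (\<integral>\<^sup>+y. ennreal c * ennreal (w y powr q) \<partial>lebesgue)"
  proof (rule nn_integral_mono)
    fix y :: 'a
    have "(\<lambda>p'. ennreal (norm (fst p' - snd p') powr p) * indicator {p. norm (fst p - snd p) \<le> R} p') \<in> borel_measurable (lebesgue \<Otimes>\<^sub>M (lebesgue :: 'a measure))"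
      by measurable
    from measurable_compose[OF measurable_Pair2' this, of y]
    have m: "(\<lambda>x. ennreal (norm (x - y) powr p) * indicator {p. norm (fst p - snd p) \<le> R} (x, y)) \<in> borel_measurable lebesgue"
      by simp
    have "(\<integral>\<^sup>+x. k x y \<partial>lebesgue) = ennreal (w y powr q) * (\<integral>\<^sup>+x. ennreal (norm (x - y) powr p) * indicator {p. norm (fst p - snd p) \<le> R} (x, y) \<partial>lebesgue)"
      unfolding k_def by (rule nn_integral_cmult[OF m])
    also have "(\<integral>\<^sup>+x. ennreal (norm (x - y) powr p) * indicator {p. norm (fst p - snd p) \<le> R} (x, y) \<partial>lebesgue)
      = (\<integral>\<^sup>+x. ennreal (norm (y - x) powr p) * indicator (cball y R) x \<partial>lebesgue)"
      by (intro nn_integral_cong) (auto simp: indicator_def dist_norm norm_minus_commute)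
    finally have eq: "(\<integral>\<^sup>+x. k x y \<partial>lebesgue) = ennreal (w y powr q) * (\<integral>\<^sup>+x. ennreal (norm (y - x) powr p) * indicator (cball y R) x \<partial>lebesgue)" .
    show "(\<integral>\<^sup>+x. k x y \<partial>lebesgue) \<le> ennreal c * ennreal (w y powr q)"
      unfolding eq mult.commute[of "ennreal c"] by (intro mult_left_mono c) simp
  qed
  also have "\<dots> = ennreal c * ennreal (LINT y|lebesgue. w y powr q)"
    using wq by (subst nn_integral_cmult) (auto simp: nn_integral_eq_integral)
  also have "\<dots> < \<infinity>" by (simp add: ennreal_mult_less_top)
  finally have gf: "(\<integral>\<^sup>+x. g x \<partial>lebesgue) < \<infinity>" .
  define G where "G x = enn2real (g x) + indicator P x" for x
  define \<omega> where "\<omega> = measure lebesgue (cball (0::'a) 1) + 1"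
  have \<omega>: "1 \<le> \<omega>" by (simp add: \<omega>_def)
  have Gi: "integrable lebesgue (\<lambda>x. \<omega> powr q * G x)"
    unfolding G_def using integrable_from_nn(1)[OF gm gf] P
    by (intro integrable_mult_right Bochner_Integration.integrable_add integrable_real_indicator) (auto simp: fmeasurable_def)
  have main: "(LINT z:cball x \<rho>|lebesgue. w z) \<le> \<omega> * G x powr (1 / q) * \<rho> powr (real DIM('a) + - \<epsilon>)"
    if gx: "ennreal (enn2real (g x)) = g x" and x: "x \<in> P" and \<rho>: "0 < \<rho>" "\<rho> \<le> R" for x \<rho>
    unfolding \<omega>_def
  proof (rule holder_ball[OF integrable_imp_set_integrable[OF w(1)] wm w(2) q _ \<rho>(1)])
    show "0 < G x" using x by (simp add: G_def add_nonneg_pos)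
    have "(\<integral>\<^sup>+z. ennreal (w z powr q) * indicator (cball x \<rho>) z \<partial>lebesgue) \<le> (\<integral>\<^sup>+y. ennreal (\<rho> powr (- p)) * k x y \<partial>lebesgue)"
    proof (rule nn_integral_mono_AE)
      have "AE z in lebesgue. z \<noteq> x"
        by (intro AE_not_in[where N = "{x}", simplified]) (simp flip: negligible_iff_null_sets)
      then show "AE z in lebesgue. ennreal (w z powr q) * indicator (cball x \<rho>) z \<le> ennreal (\<rho> powr (- p)) * k x z"
      proof eventually_elim
        case zx: (elim z)
        show ?case
        proof (cases "z \<in> cball x \<rho>")
          case True
          have nz: "0 < norm (x - z)" "norm (x - z) \<le> \<rho>" using True zx by (auto simp: dist_norm)
          have "\<rho> powr p \<le> norm (x - z) powr p" using nz p by (intro powr_mono2') auto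
          then have "\<rho> powr (- p) * \<rho> powr p \<le> \<rho> powr (- p) * norm (x - z) powr p"
            by (intro mult_left_mono) auto
          then have one: "1 \<le> \<rho> powr (- p) * norm (x - z) powr p"
            using \<rho> by (simp add: powr_add[symmetric])
          have "ennreal (w z powr q) * 1 \<le> ennreal (w z powr q) * ennreal (\<rho> powr (- p) * norm (x - z) powr p)"
            using one by (intro mult_left_mono) (auto simp: ennreal_leI simp flip: ennreal_1)
          also have "\<dots> = ennreal (\<rho> powr (- p)) * k x z"
            using nz \<rho> by (simp add: k_def ennreal_mult mult_ac)
          finally show ?thesis using True by simp
        qed simp
      qed
    qed
    also have "\<dots> = ennreal (\<rho> powr (- p)) * g x"
    proof -
      have "(\<lambda>y. k x y) \<in> borel_measurable lebesgue"
        using measurable_compose[OF measurable_Pair1' km, of x] by simp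
      then show ?thesis unfolding g_def by (rule nn_integral_cmult)
    qed
    also have "\<dots> = ennreal (\<rho> powr (- p)) * ennreal (enn2real (g x))" by (simp add: gx)
    also have "\<dots> = ennreal (\<rho> powr (- p) * enn2real (g x))" by (intro ennreal_mult[symmetric]) auto
    also have "\<dots> \<le> ennreal (\<rho> powr (- p) * G x)"
      by (intro ennreal_leI mult_left_mono) (auto simp: G_def)
    also have "- p = - \<epsilon> * q + real DIM('a)" by (simp add: p_def n_def)
    finally show "(\<integral>\<^sup>+z. ennreal (w z powr q) * indicator (cball x \<rho>) z \<partial>lebesgue) \<le> ennreal (\<rho> powr (- \<epsilon> * q + real DIM('a)) * G x)" .
  qed simp
  show ?thesis
  proof (intro exI[of _ "\<lambda>x. \<omega> powr q * G x"] conjI Gi allI ballI)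
    have 1: "1 \<le> \<omega> powr q" using \<omega> q by (simp add: ge_one_powr_ge_zero)
    show "0 \<le> \<omega> powr q * G x" for x by (simp add: G_def)
    show "1 \<le> \<omega> powr q * G x" if "x \<in> P" for x
      using mult_mono[OF 1, of 1 "G x"] that by (simp add: G_def)
    have "(\<omega> powr q * G x) powr (1 / q) = \<omega> * G x powr (1 / q)" for x
      using \<omega> q by (simp add: G_def powr_mult powr_powr)
    with main show "AE x in lebesgue. x \<in> P \<longrightarrow> ball_growth w (real DIM('a) - \<epsilon>) ((\<omega> powr q * G x) powr (1 / q)) R x"
      using integrable_from_nn(2)[OF gm gf] by (auto simp: ball_growth_def elim: eventually_mono)
  qed
qed

section \<open>Mean oscillation of weakly differentiable functions\<close>

text \<open>This is the condition on \<open>F\<close> that \<open>pinned\<close> demands, with \<open>H = G\<^sup>1\<^sup>/\<^sup>q\<close>, at almost every point of \<open>P\<close>. Every kind of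
  smoothness of \<open>F\<close> is reduced to it.\<close>

definition osc :: "('a::euclidean_space \<Rightarrow> 'b::euclidean_space) \<Rightarrow> real \<Rightarrow> real \<Rightarrow> 'a set \<Rightarrow> real \<Rightarrow> ('a \<Rightarrow> real) \<Rightarrow> bool"
  where "osc F s q P R G \<longleftrightarrow> integrable lebesgue G \<and> (\<forall>x. 0 \<le> G x) \<and>
    (AE x in lebesgue. x \<in> P \<longrightarrow> ball_growth (\<lambda>z. norm (F z - F x)) (real DIM('a) + s) (G x powr (1 / q)) R x)"

lemma sum_powr_le:
  fixes f :: "'i \<Rightarrow> real"
  assumes I: "finite I" "I \<noteq> {}" and f: "\<And>i. i \<in> I \<Longrightarrow> 0 \<le> f i" and q: "0 \<le> q"
  shows "(\<Sum>i\<in>I. f i) powr q \<le> real (card I) powr q * (\<Sum>i\<in>I. f i powr q)"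
proof -
  obtain j where j: "j \<in> I" "\<And>i. i \<in> I \<Longrightarrow> f i \<le> f j"
  proof -
    have "Max (f ` I) \<in> f ` I" using I by (intro Max_in) auto
    then obtain j where "j \<in> I" "Max (f ` I) = f j" by auto
    moreover have "f i \<le> Max (f ` I)" if "i \<in> I" for i using I that by (intro Max_ge) auto
    ultimately show ?thesis using that by metis
  qed
  have "(\<Sum>i\<in>I. f i) \<le> real (card I) * f j" using j by (intro sum_bounded_above) auto
  then have "(\<Sum>i\<in>I. f i) powr q \<le> (real (card I) * f j) powr q"
    using q f by (intro powr_mono2) (auto intro: sum_nonneg)
  also have "\<dots> = real (card I) powr q * f j powr q" using f j by (simp add: powr_mult)
  also have "\<dots> \<le> real (card I) powr q * (\<Sum>i\<in>I. f i powr q)"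
    using I j by (intro mult_left_mono member_le_sum) auto
  finally show ?thesis .
qed

text \<open>Integration by parts (the hypothesis \<open>id\<close>) bounds the scale derivative of the averages of \<open>v\<close> by the
  mass of its weak derivatives, and \<open>fractional_maximal\<close> bounds this mass; \<open>kernel_holder\<close> then
  applies. The loss \<open>e\<close> is the \<open>\<epsilon>\<close> of \<open>fractional_maximal\<close>.\<close>

lemma weakly_differentiable_hajlasz:
  fixes v :: "'a::euclidean_space \<Rightarrow> real" and w :: "'a \<Rightarrow> 'a \<Rightarrow> real"
  assumes v: "integrable lebesgue v" and w: "\<And>b. b \<in> Basis \<Longrightarrow> integrable lebesgue (w b)"
    and wq: "integrable lebesgue (\<lambda>z. (\<Sum>b\<in>Basis. \<bar>w b z\<bar>) powr q)"
    and id: "\<And>x t. 0 < t \<Longrightarrow> cball x t \<subseteq> K \<Longrightarrow> cint v lker t x = - t * (\<Sum>b\<in>Basis. cint (w b) (prof b) t x)"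
    and q: "1 \<le> q" and e: "0 < e" "e < 1" "e * q \<le> real DIM('a)" and R: "0 < R" "R \<le> 1"
    and P: "P \<in> lmeasurable" "\<And>x. x \<in> P \<Longrightarrow> cball x (2 * R) \<subseteq> K"
  shows "\<exists>G M. integrable lebesgue G \<and> (\<forall>x. 0 \<le> G x) \<and> 0 \<le> M \<and> (\<exists>N. N \<in> null_sets lebesgue \<and>
    (\<forall>x y. x \<in> P - N \<longrightarrow> y \<in> P - N \<longrightarrow> norm (x - y) \<le> R \<longrightarrow>
      \<bar>v x - v y\<bar> \<le> M * (G x powr (1 / q) + G y powr (1 / q) + 1) * norm (x - y) powr (1 - e)))"
proof -
  define n where "n = DIM('a)"
  define W where "W z = (\<Sum>b\<in>Basis. \<bar>w b z\<bar>)" for z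
  have W: "integrable lebesgue W" "\<And>z. 0 \<le> W z"
    unfolding W_def using w by (auto intro: sum_nonneg)
  have wS: "set_integrable lebesgue (cball x t) (w b)" if "b \<in> Basis" for b x t
    by (intro integrable_imp_set_integrable w that) simp
  obtain C where C: "0 < C" and Ck: "lip_kernel C (ker :: 'a \<Rightarrow> real)"
    and Cp: "\<And>b. b \<in> Basis \<Longrightarrow> lip_kernel C (prof b :: 'a \<Rightarrow> real)"
    using ex_lip_kernel_const[where 'a = 'a] by blast
  have R2: "0 < 2 * R" using R by simp
  have wq': "integrable lebesgue (\<lambda>z. W z powr q)" using wq by (simp add: W_def)
  obtain G where G: "integrable lebesgue G" "\<And>x. 0 \<le> G x"
    and GM: "AE x in lebesgue. x \<in> P \<longrightarrow> ball_growth W (real n - e) (G x powr (1 / q)) (2 * R) x"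
    using fractional_maximal[OF W wq' q e(1,3) R2 P(1)] unfolding n_def by blast
  define H where "H x = G x powr (1 / q)" for x
  have H: "0 \<le> H x" for x by (simp add: H_def)
  define s where "s = 1 - e"
  have s: "0 < s" "s < 1" using e by (auto simp: s_def)
  define pt where "pt x \<longleftrightarrow> leb_point v x \<and> ball_growth W (real n - e) (H x) (2 * R) x" for x
  have "AE x in lebesgue. x \<in> P \<longrightarrow> pt x"
    using GM AE_leb_point[OF v] by eventually_elim (auto simp: pt_def H_def)
  then obtain N where N: "N \<in> null_sets lebesgue" "\<And>x. x \<in> P - N \<Longrightarrow> pt x"
    by (auto elim!: AE_E3 simp: subset_eq)
  have sumW: "(\<Sum>b\<in>Basis. C * (LINT z:cball x t|lebesgue. norm (w b z))) = C * (LINT z:cball x t|lebesgue. W z)" for x t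
  proof -
    have "(LINT z:cball x t|lebesgue. W z) = (\<Sum>b\<in>Basis. LINT z:cball x t|lebesgue. norm (w b z))"
      unfolding W_def set_lebesgue_integral_def scaleR_sum_right
      using set_integrable_norm[OF wS[of _ x t]]
      by (subst Bochner_Integration.integral_sum) (auto simp: set_integrable_def)
    then show ?thesis by (simp add: sum_distrib_left)
  qed
  have lb: "\<bar>cint v lker t x\<bar> \<le> (C * H x) * t powr (real DIM('a) + s)"
    if x: "x \<in> P - N" and t: "0 < t" "t \<le> R" for x t
  proof -
    have sub: "cball x t \<subseteq> K" using P(2)[of x] x t subset_cball[of t "2 * R" x] R by auto
    have "\<bar>cint v lker t x\<bar> = t * \<bar>\<Sum>b\<in>Basis. cint (w b) (prof b) t x\<bar>"
      unfolding id[OF t(1) sub] using t by (simp add: abs_mult)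
    also have "\<dots> \<le> t * (\<Sum>b\<in>Basis. C * (LINT z:cball x t|lebesgue. norm (w b z)))"
      using t by (intro mult_left_mono order_trans[OF sum_abs] sum_mono cint_bound Cp wS) auto
    also have "\<dots> = t * (C * (LINT z:cball x t|lebesgue. W z))" by (simp only: sumW)
    also have "\<dots> \<le> t * (C * (H x * t powr (real n - e)))"
      using t C N(2)[OF x] R by (intro mult_left_mono) (auto simp: pt_def ball_growth_def)
    also have "\<dots> = (C * H x) * (t powr 1 * t powr (real n - e))" using t by simp
    also have "t powr 1 * t powr (real n - e) = t powr (real DIM('a) + s)"
      by (simp only: powr_add[symmetric]) (simp add: s_def n_def algebra_simps)
    finally show ?thesis .
  qed
  have ld: "\<bar>cint v lker t x - cint v lker t y\<bar> \<le> (C * 2 powr (real n - e) * H x) * norm (x - y) * t powr (real DIM('a) + s - 1)"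
    if x: "x \<in> P - N" and y: "y \<in> P - N" and t: "0 < t" "norm (x - y) \<le> t" "t \<le> R" for x y t
  proof -
    have subx: "cball x t \<subseteq> K" using P(2)[of x] x t subset_cball[of t "2 * R" x] R by auto
    have suby: "cball y t \<subseteq> K" using P(2)[of y] y t subset_cball[of t "2 * R" y] R by auto
    have "\<bar>cint v lker t x - cint v lker t y\<bar> = \<bar>t * (\<Sum>b\<in>Basis. cint (w b) (prof b) t x - cint (w b) (prof b) t y)\<bar>"
      unfolding id[OF t(1) subx] id[OF t(1) suby] by (simp add: sum_subtractf right_diff_distrib)
    also have "\<dots> = t * \<bar>\<Sum>b\<in>Basis. cint (w b) (prof b) t x - cint (w b) (prof b) t y\<bar>"
      using t by (simp add: abs_mult)
    also have "\<dots> \<le> t * (\<Sum>b\<in>Basis. C * (norm (x - y) / t) * (LINT z:cball x (2 * t)|lebesgue. norm (w b z)))"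
      using t by (intro mult_left_mono order_trans[OF sum_abs] sum_mono cint_diff_bound Cp wS) auto
    also have "\<dots> = norm (x - y) * (\<Sum>b\<in>Basis. C * (LINT z:cball x (2 * t)|lebesgue. norm (w b z)))"
      using t by (simp add: sum_distrib_left mult_ac)
    also have "\<dots> = norm (x - y) * (C * (LINT z:cball x (2 * t)|lebesgue. W z))" by (simp only: sumW)
    also have "\<dots> \<le> norm (x - y) * (C * (H x * (2 * t) powr (real n - e)))"
      using t C N(2)[OF x] R by (intro mult_left_mono) (auto simp: pt_def ball_growth_def)
    also have "\<dots> = (C * 2 powr (real n - e) * H x) * norm (x - y) * t powr (real n - e)"
      using t by (simp add: powr_mult mult_ac)
    also have "real n - e = real DIM('a) + s - 1" by (simp add: s_def n_def)
    finally show ?thesis by (simp add: s_def n_def)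
  qed
  define I where "I = (LINT z|lborel. ker (z::'a))"
  have I: "0 < I" unfolding I_def by (rule ker_integral_pos)
  define A where "A = C"
  define B where "B = C * 2 powr (real n - e)"
  define E where "E = C / R ^ (DIM('a) + 1) * (LINT z|lebesgue. \<bar>v z\<bar>)"
  have ABE: "0 \<le> A" "0 \<le> B" "0 \<le> E" using C R by (auto simp: A_def B_def E_def)
  define M where "M = (A / s + B / (1 - s) + E) / I"
  have M: "0 \<le> M" using ABE I s by (simp add: M_def)
  have main: "\<bar>v x - v y\<bar> \<le> M * (H x + H y + 1) * norm (x - y) powr s"
    if x: "x \<in> P - N" and y: "y \<in> P - N" and xy: "norm (x - y) \<le> R" for x y
  proof -
    have "I * \<bar>v x - v y\<bar> \<le> ((A * H x) / s + (A * H y) / s + (B * H x) / (1 - s) + E) * norm (x - y) powr s"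
      unfolding I_def E_def
    proof (rule kernel_holder[OF v _ _ s R xy Ck])
      show "leb_point v x" "leb_point v y" using N(2) x y by (auto simp: pt_def)
      show "0 \<le> A * H x" "0 \<le> A * H y" "0 \<le> B * H x" using ABE H by auto
      show "\<bar>cint v lker t x\<bar> \<le> A * H x * t powr (real DIM('a) + s)" if "0 < t" "t \<le> R" for t
        using lb[OF x that] by (simp add: A_def)
      show "\<bar>cint v lker t y\<bar> \<le> A * H y * t powr (real DIM('a) + s)" if "0 < t" "t \<le> R" for t
        using lb[OF y that] by (simp add: A_def)
      show "\<bar>cint v lker t x - cint v lker t y\<bar> \<le> B * H x * norm (x - y) * t powr (real DIM('a) + s - 1)"
        if "0 < t" "norm (x - y) \<le> t" "t \<le> R" for t
        using ld[OF x y that] by (simp add: B_def)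
    qed
    also have "\<dots> \<le> (A / s + B / (1 - s) + E) * (H x + H y + 1) * norm (x - y) powr s"
    proof (rule mult_right_mono)
      have "0 \<le> A / s" "0 \<le> B / (1 - s)" using ABE s by auto
      then have "(A / s) * H x + (A / s) * H y + (B / (1 - s)) * H x + E \<le> (A / s + B / (1 - s) + E) * (H x + H y + 1)"
        using H[of x] H[of y] ABE by (simp add: algebra_simps del: times_divide_eq_left times_divide_eq_right)
      then show "(A * H x) / s + (A * H y) / s + (B * H x) / (1 - s) + E \<le> (A / s + B / (1 - s) + E) * (H x + H y + 1)"
        by simp
    qed simp
    finally have "\<bar>v x - v y\<bar> \<le> (A / s + B / (1 - s) + E) * (H x + H y + 1) * norm (x - y) powr s / I"
      using I by (simp only: pos_le_divide_eq mult.commute[of _ I])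
    then show ?thesis by (simp add: M_def)
  qed
  show ?thesis
    using G M N(1) main unfolding H_def s_def by blast
qed

text \<open>Averaging the pointwise inequality \<open>weakly_differentiable_hajlasz\<close> over \<open>z\<close> leaves the mean of \<open>H\<close> around
  \<open>x\<close>, to which \<open>fractional_maximal\<close> is applied once more. Either step loses \<open>(1 - s) / 2\<close>.\<close>

lemma weakly_differentiable_osc:
  fixes v :: "'a::euclidean_space \<Rightarrow> real" and w :: "'a \<Rightarrow> 'a \<Rightarrow> real"
  assumes v: "integrable lebesgue v" and w: "\<And>b. b \<in> Basis \<Longrightarrow> integrable lebesgue (w b)"
    and wq: "integrable lebesgue (\<lambda>z. (\<Sum>b\<in>Basis. \<bar>w b z\<bar>) powr q)"
    and id: "\<And>x t. 0 < t \<Longrightarrow> cball x t \<subseteq> K \<Longrightarrow> cint v lker t x = - t * (\<Sum>b\<in>Basis. cint (w b) (prof b) t x)"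
    and q: "1 \<le> q" and s: "0 < s" "s < 1" "(1 - s) / 2 * q \<le> real DIM('a)" and R: "0 < R" "R \<le> 1"
    and P: "P \<in> lmeasurable" "\<And>x. x \<in> P \<Longrightarrow> cball x (2 * R) \<subseteq> K"
    and P2: "P2 \<subseteq> P" "\<And>x. x \<in> P2 \<Longrightarrow> cball x R \<subseteq> P"
  shows "\<exists>G. osc v s q P2 R G"
proof -
  define n where "n = DIM('a)"
  define e where "e = (1 - s) / 2"
  have e: "0 < e" "e < 1" "e * q \<le> real DIM('a)" using s by (auto simp: e_def)
  obtain G M N where G: "integrable lebesgue G" "\<And>x. 0 \<le> G x" and M: "0 \<le> M" and N: "N \<in> null_sets lebesgue"
    and h: "\<And>x y. x \<in> P - N \<Longrightarrow> y \<in> P - N \<Longrightarrow> norm (x - y) \<le> R \<Longrightarrow>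
      \<bar>v x - v y\<bar> \<le> M * (G x powr (1 / q) + G y powr (1 / q) + 1) * norm (x - y) powr (1 - e)"
    using weakly_differentiable_hajlasz[OF v w wq id q e R P] by blast
  define H where "H x = indicator P x * G x powr (1 / q)" for x
  have Hm: "H \<in> borel_measurable lebesgue"
    unfolding H_def using G(1) P(1) by (intro borel_measurable_times borel_measurable_indicator) auto
  have H0: "0 \<le> H x" for x by (simp add: H_def)
  have Hi: "integrable lebesgue H"
  proof (rule Bochner_Integration.integrable_bound[OF _ Hm])
    show "integrable lebesgue (\<lambda>x. indicator P x + G x)"
      using G P(1) by (intro Bochner_Integration.integrable_add integrable_real_indicator) (auto simp: fmeasurable_def)
    show "AE x in lebesgue. norm (H x) \<le> norm (indicator P x + G x)"
    proof (rule AE_I2)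
      fix x
      have "G x powr (1 / q) \<le> 1 + G x"
      proof (cases "G x \<le> 1")
        case True
        then have "G x powr (1 / q) \<le> 1" using G(2)[of x] q by (intro powr_le1) auto
        then show ?thesis using G(2)[of x] by simp
      next
        case False
        then have "G x powr (1 / q) \<le> G x powr 1" using q by (intro powr_mono) auto
        then show ?thesis using False by simp
      qed
      then show "norm (H x) \<le> norm (indicator P x + G x)"
        using G(2)[of x] by (simp add: H_def indicator_def)
    qed
  qed
  have Hq: "integrable lebesgue (\<lambda>x. H x powr q)"
  proof -
    have "H x powr q = indicator P x *\<^sub>R G x" for x
      using G(2)[of x] q by (simp add: H_def indicator_def powr_powr)
    then show ?thesis using integrable_mult_indicator[of P lebesgue G] G P(1) by simp
  qed
  define \<omega> where "\<omega> = measure lebesgue (cball (0::'a) 1) + 1"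
  have \<omega>: "1 \<le> \<omega>" by (simp add: \<omega>_def)
  obtain G2 where G2: "integrable lebesgue G2" "\<And>x. 0 \<le> G2 x" "\<And>x. x \<in> P \<Longrightarrow> 1 \<le> G2 x"
    and GM: "AE x in lebesgue. x \<in> P \<longrightarrow> ball_growth H (real n - e) (G2 x powr (1 / q)) R x"
    using fractional_maximal[OF Hi H0 Hq q e(1,3) R(1) P(1)] unfolding n_def by blast
  \<comment> \<open>its \<open>q\<close>-th root dominates \<open>M * \<omega> * (g + 1 + g2)\<close> below, because \<open>1 \<le> g2\<close>\<close>
  define G3 where "G3 x = (3 * M * \<omega>) powr q * (G x + G2 x)" for x
  have "AE x in lebesgue. x \<notin> N" using N by (rule AE_not_in)
  with GM have "AE x in lebesgue. x \<in> P2 \<longrightarrow> ball_growth (\<lambda>z. norm (v z - v x)) (real n + s) (G3 x powr (1 / q)) R x"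
  proof eventually_elim
    case (elim x)
    note gm = elim(1) and xN = elim(2)
    show ?case
      unfolding ball_growth_def
    proof (intro impI allI)
      fix \<rho> assume x2: "x \<in> P2" and \<rho>: "0 < \<rho> \<and> \<rho> \<le> R"
      have xP: "x \<in> P" using x2 P2 by blast
      have sub: "cball x \<rho> \<subseteq> P" using P2(2)[OF x2] \<rho> subset_cball[of \<rho> R x] by auto
      define g where "g = G x powr (1 / q)"
      define g2 where "g2 = G2 x powr (1 / q)"
      have g: "0 \<le> g" by (simp add: g_def)
      have g2: "1 \<le> g2" using G2(3)[OF xP] q by (simp add: g2_def ge_one_powr_ge_zero)
      have vi: "set_integrable lebesgue (cball x \<rho>) (\<lambda>z. norm (v z - v x))"
        by (rule shift_norm_integrable[OF v]) simp
      have ci: "set_integrable lebesgue (cball x \<rho>) (\<lambda>_. M * \<rho> powr (1 - e) * (g + 1))"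
        by (rule absolutely_integrable_on_const) simp
      have hi: "set_integrable lebesgue (cball x \<rho>) (\<lambda>z. M * \<rho> powr (1 - e) * H z)"
        using Hi by (intro integrable_imp_set_integrable) auto
      have "(LINT z:cball x \<rho>|lebesgue. norm (v z - v x)) \<le> (LINT z:cball x \<rho>|lebesgue. M * \<rho> powr (1 - e) * (g + 1) + M * \<rho> powr (1 - e) * H z)"
      proof (rule set_integral_mono_AE[OF vi set_integral_add(1)[OF ci hi]])
        have "AE z in lebesgue. z \<notin> N" using N by (rule AE_not_in)
        then show "AE z in lebesgue. z \<in> cball x \<rho> \<longrightarrow> norm (v z - v x) \<le> M * \<rho> powr (1 - e) * (g + 1) + M * \<rho> powr (1 - e) * H z"
        proof eventually_elim
          case zN: (elim z)
          show ?case
          proof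
            assume z: "z \<in> cball x \<rho>"
            then have zP: "z \<in> P" using sub by blast
            have d: "norm (z - x) \<le> \<rho>" using z by (simp add: dist_norm norm_minus_commute)
            have "\<bar>v z - v x\<bar> \<le> M * (G z powr (1 / q) + G x powr (1 / q) + 1) * norm (z - x) powr (1 - e)"
              using h[of z x] zP zN xP xN d \<rho> by auto
            also have "\<dots> \<le> M * (G z powr (1 / q) + G x powr (1 / q) + 1) * \<rho> powr (1 - e)"
              using M e d by (intro mult_left_mono powr_mono2) auto
            also have "\<dots> = M * \<rho> powr (1 - e) * (g + 1) + M * \<rho> powr (1 - e) * H z"
              using zP by (simp add: H_def g_def algebra_simps)
            finally show "norm (v z - v x) \<le> M * \<rho> powr (1 - e) * (g + 1) + M * \<rho> powr (1 - e) * H z" by simp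
          qed
        qed
      qed
      also have "\<dots> = M * \<rho> powr (1 - e) * (g + 1) * measure lebesgue (cball x \<rho>) + M * \<rho> powr (1 - e) * (LINT z:cball x \<rho>|lebesgue. H z)"
        using set_integral_add(2)[OF ci hi] by (simp add: set_lebesgue_integral_def mult.commute mult.left_commute)
      also have "\<dots> \<le> M * \<rho> powr (1 - e) * (g + 1) * (\<omega> * \<rho> powr (real n - e)) + M * \<rho> powr (1 - e) * (\<omega> * g2 * \<rho> powr (real n - e))"
      proof (intro add_mono mult_left_mono)
        have "measure lebesgue (cball x \<rho>) = measure lebesgue (cball (0::'a) 1) * \<rho> ^ n"
          unfolding n_def using \<rho> by (intro measure_cball) simp
        also have "\<dots> \<le> \<omega> * \<rho> powr real n"
          using \<rho> by (simp add: \<omega>_def powr_realpow)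
        also have "\<dots> \<le> \<omega> * \<rho> powr (real n - e)"
          using \<rho> R e \<omega> by (intro mult_left_mono powr_mono') auto
        finally show "measure lebesgue (cball x \<rho>) \<le> \<omega> * \<rho> powr (real n - e)" .
        show "(LINT z:cball x \<rho>|lebesgue. H z) \<le> \<omega> * g2 * \<rho> powr (real n - e)"
        proof -
          have "(LINT z:cball x \<rho>|lebesgue. H z) \<le> 1 * (g2 * \<rho> powr (real n - e))"
            using gm xP \<rho> by (simp add: g2_def ball_growth_def)
          also have "\<dots> \<le> \<omega> * (g2 * \<rho> powr (real n - e))"
            using \<omega> g2 by (intro mult_right_mono) auto
          finally show ?thesis by (simp add: mult.assoc)
        qed
      qed (use M g in auto)
      also have "\<dots> = M * \<omega> * (g + 1 + g2) * (\<rho> powr (1 - e) * \<rho> powr (real n - e))"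
        by (simp add: algebra_simps)
      also have "\<rho> powr (1 - e) * \<rho> powr (real n - e) = \<rho> powr (real n + s)"
        unfolding powr_add[symmetric] by (simp add: e_def add_divide_distrib diff_divide_distrib add.commute)
      also have "M * \<omega> * (g + 1 + g2) * \<rho> powr (real n + s) \<le> G3 x powr (1 / q) * \<rho> powr (real n + s)"
      proof (rule mult_right_mono)
        have "g \<le> (G x + G2 x) powr (1 / q)" "g2 \<le> (G x + G2 x) powr (1 / q)"
          unfolding g_def g2_def using G(2)[of x] G2(2)[of x] q by (auto intro!: powr_mono2)
        then have "M * \<omega> * (g + 1 + g2) \<le> M * \<omega> * (3 * (G x + G2 x) powr (1 / q))"
          using M \<omega> g2 by (intro mult_left_mono) auto
        also have "\<dots> = G3 x powr (1 / q)"
          using M \<omega> q G(2)[of x] G2(2)[of x] by (simp add: G3_def powr_mult powr_powr)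
        finally show "M * \<omega> * (g + 1 + g2) \<le> G3 x powr (1 / q)" .
      qed simp
      finally show "(LINT z:cball x \<rho>|lebesgue. norm (v z - v x)) \<le> G3 x powr (1 / q) * \<rho> powr (real n + s)" .
    qed
  qed
  moreover have "integrable lebesgue G3" unfolding G3_def using G G2 by simp
  moreover have "0 \<le> G3 x" for x using G(2)[of x] G2(2)[of x] by (simp add: G3_def)
  ultimately show ?thesis unfolding osc_def n_def by blast
qed

lemma osc_components:
  fixes F :: "'a::euclidean_space \<Rightarrow> 'b::euclidean_space"
  assumes F: "integrable lebesgue F" and q: "1 \<le> q"
    and o: "\<And>e. e \<in> Basis \<Longrightarrow> osc (\<lambda>z. F z \<bullet> e) s q P R (G e)"
  shows "\<exists>G. osc F s q P R G"
proof -
  define m where "m = DIM('b)"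
  define G' where "G' x = real m powr q * (\<Sum>e\<in>Basis. G e x)" for x
  have "AE x in lebesgue. \<forall>e\<in>Basis. x \<in> P \<longrightarrow>
      ball_growth (\<lambda>z. norm (F z \<bullet> e - F x \<bullet> e)) (real DIM('a) + s) (G e x powr (1 / q)) R x"
    using o by (intro AE_finite_allI) (auto simp: osc_def)
  then have "AE x in lebesgue. x \<in> P \<longrightarrow> ball_growth (\<lambda>z. norm (F z - F x)) (real DIM('a) + s) (G' x powr (1 / q)) R x"
  proof eventually_elim
    case h: (elim x)
    show ?case
      unfolding ball_growth_def
    proof (intro impI allI)
      fix \<rho> assume x: "x \<in> P" and \<rho>: "0 < \<rho> \<and> \<rho> \<le> R"
      have Fi: "set_integrable lebesgue (cball x \<rho>) (\<lambda>z. F z - F x)"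
        by (intro set_integral_diff integrable_imp_set_integrable[OF F] absolutely_integrable_on_const) auto
      have ei: "set_integrable lebesgue (cball x \<rho>) (\<lambda>z. norm (F z \<bullet> e - F x \<bullet> e))" for e
        using set_integrable_norm[OF set_integrable_inner_left[OF Fi, of e]] by (simp add: inner_diff_left)
      have si: "set_integrable lebesgue (cball x \<rho>) (\<lambda>z. \<Sum>e\<in>Basis. norm (F z \<bullet> e - F x \<bullet> e))"
        using ei unfolding set_integrable_def scaleR_sum_right by (intro Bochner_Integration.integrable_sum) auto
      have "(LINT z:cball x \<rho>|lebesgue. norm (F z - F x)) \<le> (LINT z:cball x \<rho>|lebesgue. \<Sum>e\<in>Basis. norm (F z \<bullet> e - F x \<bullet> e))"
      proof (rule set_integral_mono[OF set_integrable_norm[OF Fi] si])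
        show "norm (F z - F x) \<le> (\<Sum>e\<in>Basis. norm (F z \<bullet> e - F x \<bullet> e))" for z
          using norm_le_l1[of "F z - F x"] by (simp add: inner_diff_left)
      qed
      also have "\<dots> = (\<Sum>e\<in>Basis. LINT z:cball x \<rho>|lebesgue. norm (F z \<bullet> e - F x \<bullet> e))"
        unfolding set_lebesgue_integral_def scaleR_sum_right
        using ei by (intro Bochner_Integration.integral_sum) (simp add: set_integrable_def)
      also have "\<dots> \<le> (\<Sum>e\<in>(Basis::'b set). (\<Sum>e\<in>Basis. G e x) powr (1 / q) * \<rho> powr (real DIM('a) + s))"
      proof (rule sum_mono)
        fix e :: 'b assume e: "e \<in> Basis"
        have G0: "0 \<le> G e x" if "e \<in> Basis" for e using o[OF that] by (simp add: osc_def)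
        have "(LINT z:cball x \<rho>|lebesgue. norm (F z \<bullet> e - F x \<bullet> e)) \<le> G e x powr (1 / q) * \<rho> powr (real DIM('a) + s)"
          using h e x \<rho> by (simp add: ball_growth_def)
        also have "\<dots> \<le> (\<Sum>e\<in>Basis. G e x) powr (1 / q) * \<rho> powr (real DIM('a) + s)"
          using e G0 q by (intro mult_right_mono powr_mono2 member_le_sum) auto
        finally show "(LINT z:cball x \<rho>|lebesgue. norm (F z \<bullet> e - F x \<bullet> e)) \<le> (\<Sum>e\<in>Basis. G e x) powr (1 / q) * \<rho> powr (real DIM('a) + s)" .
      qed
      also have "\<dots> = real m * (\<Sum>e\<in>Basis. G e x) powr (1 / q) * \<rho> powr (real DIM('a) + s)" by (simp add: m_def)
      also have "real m * (\<Sum>e\<in>Basis. G e x) powr (1 / q) = G' x powr (1 / q)"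
        using q o by (simp add: G'_def powr_mult powr_powr osc_def sum_nonneg)
      finally show "(LINT z:cball x \<rho>|lebesgue. norm (F z - F x)) \<le> G' x powr (1 / q) * \<rho> powr (real DIM('a) + s)" .
    qed
  qed
  moreover have "integrable lebesgue G'"
    unfolding G'_def using o by (intro integrable_mult_right Bochner_Integration.integrable_sum) (auto simp: osc_def)
  moreover have "0 \<le> G' x" for x unfolding G'_def using o by (intro mult_nonneg_nonneg sum_nonneg) (auto simp: osc_def)
  ultimately show ?thesis unfolding osc_def by blast
qed

section \<open>Sobolev--Slobodeckij seminorms\<close>

lemma sigma_finite_lebesgue_on: "D \<in> sets lebesgue \<Longrightarrow> sigma_finite_measure (lebesgue_on D)"
  by (rule sigma_finite_measure_restrict_space[OF sigma_finite_lebesgue])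

lemma pair_sigma_finite_lebesgue_on:
  "D \<in> sets lebesgue \<Longrightarrow> pair_sigma_finite (lebesgue_on D) (lebesgue_on D)"
  by (intro pair_sigma_finite.intro sigma_finite_lebesgue_on)

lemma AE_lebesgue_on_iff:
  "D \<in> sets lebesgue \<Longrightarrow> (AE x in lebesgue_on D. Q x) \<longleftrightarrow> (AE x in lebesgue. x \<in> D \<longrightarrow> Q x)"
  by (rule AE_restrict_space_iff) simp

lemma AE_pair_lebesgue_on:
  assumes D: "D \<in> sets lebesgue" and ae: "AE (x, y) in lebesgue_on D \<Otimes>\<^sub>M lebesgue_on D. Q x y"
  shows "AE x in lebesgue. x \<in> D \<longrightarrow> (AE y in lebesgue. y \<in> D \<longrightarrow> Q x y)"
proof -
  have "AE x in lebesgue_on D. AE y in lebesgue_on D. Q x y"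
    using pair_sigma_finite.AE_pair[OF pair_sigma_finite_lebesgue_on[OF D] ae] by simp
  then show ?thesis by (simp add: AE_lebesgue_on_iff D)
qed

lemma quotient_measurable:
  fixes v :: "'a::euclidean_space \<Rightarrow> 'b::euclidean_space"
  assumes v: "v \<in> borel_measurable (lebesgue_on D)"
  shows "(\<lambda>(x, y). norm (v x - v y) / norm (x - y) powr p) \<in> borel_measurable (lebesgue_on D \<Otimes>\<^sub>M lebesgue_on D)"
proof -
  have id: "(\<lambda>x::'a. x) \<in> borel_measurable (lebesgue_on D)"
    by (intro measurable_restrict_space1) (simp add: measurable_completion)
  have v1: "(\<lambda>p. v (fst p)) \<in> borel_measurable (lebesgue_on D \<Otimes>\<^sub>M lebesgue_on D)"
    by (rule measurable_compose[OF measurable_fst v])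
  have v2: "(\<lambda>p. v (snd p)) \<in> borel_measurable (lebesgue_on D \<Otimes>\<^sub>M lebesgue_on D)"
    by (rule measurable_compose[OF measurable_snd v])
  have x1: "(\<lambda>p. fst p) \<in> borel_measurable (lebesgue_on D \<Otimes>\<^sub>M lebesgue_on D)"
    by (rule measurable_compose[OF measurable_fst id])
  have x2: "(\<lambda>p. snd p) \<in> borel_measurable (lebesgue_on D \<Otimes>\<^sub>M lebesgue_on D)"
    by (rule measurable_compose[OF measurable_snd id])
  show ?thesis
    unfolding case_prod_beta' using v1 v2 x1 x2
    by (intro borel_measurable_divide borel_measurable_norm borel_measurable_diff powr_real_measurable) auto
qed

text \<open>The constant \<open>G x\<close> is, up to a factor, the integral over \<open>y\<close> of the \<open>q\<close>-th power of the Slobodeckij quotient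
  at \<open>(x, y)\<close>. On the ball of radius \<open>\<rho>\<close> around \<open>x\<close> the denominator of this power is at most \<open>\<rho>\<^sup>s\<^sup>q\<^sup>+\<^sup>n\<close>, so that \<open>holder_ball\<close> applies.\<close>

lemma slobodeckij_osc:
  fixes F F1 :: "'a::euclidean_space \<Rightarrow> 'b::euclidean_space"
  assumes D: "D \<in> sets lebesgue" and F1: "integrable lebesgue F1" and K: "K \<subseteq> D" "\<And>z. z \<in> K \<Longrightarrow> F1 z = F z"
    and int: "integrable (lebesgue_on D \<Otimes>\<^sub>M lebesgue_on D)
      (\<lambda>(x, y). (norm (F x - F y) / norm (x - y) powr (s + real DIM('a) / q)) powr q)"
    and s: "0 < s" and q: "1 \<le> q"
    and P: "P \<in> lmeasurable" "\<And>x. x \<in> P \<Longrightarrow> cball x R \<subseteq> K" and R: "0 < R"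
  shows "\<exists>G. osc F1 s q P R G"
proof -
  define k where "k x y = (norm (F x - F y) / norm (x - y) powr (s + real DIM('a) / q)) powr q" for x y
  define \<omega> where "\<omega> = measure lebesgue (cball (0::'a) 1) + 1"
  have \<omega>: "0 < \<omega>" by (simp add: \<omega>_def add_nonneg_pos)
  interpret D: pair_sigma_finite "lebesgue_on D" "lebesgue_on D" by (rule pair_sigma_finite_lebesgue_on[OF D])
  have int': "integrable (lebesgue_on D \<Otimes>\<^sub>M lebesgue_on D) (case_prod k)"
    using int unfolding k_def .
  define g where "g x = (LINT y|lebesgue_on D. k x y)" for x
  have g0: "0 \<le> g x" for x unfolding g_def k_def by (intro Bochner_Integration.integral_nonneg) auto
  have gi: "integrable (lebesgue_on D) g"
    unfolding g_def using D.integrable_fst'[OF int'] by simp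
  have sec: "AE x in lebesgue. x \<in> D \<longrightarrow> integrable (lebesgue_on D) (k x)"
    using D.AE_integrable_fst'[OF int'] by (simp add: AE_lebesgue_on_iff D)
  define G0 where "G0 x = indicator D x *\<^sub>R g x + indicator P x" for x
  define G where "G x = \<omega> powr q * G0 x" for x
  have "integrable lebesgue (\<lambda>x. indicator D x *\<^sub>R g x)"
    using gi D by (subst (asm) integrable_restrict_space) auto
  then have Gi: "integrable lebesgue G"
    unfolding G_def G0_def using P
    by (intro integrable_mult_right Bochner_Integration.integrable_add integrable_real_indicator) (auto simp: fmeasurable_def)
  have G0: "0 \<le> G0 x" for x using g0[of x] by (simp add: G0_def)
  have "AE x in lebesgue. x \<in> P \<longrightarrow> ball_growth (\<lambda>z. norm (F1 z - F1 x)) (real DIM('a) + s) (G x powr (1 / q)) R x"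
    using sec
  proof eventually_elim
    case sx: (elim x)
    show ?case
      unfolding ball_growth_def
    proof (intro impI allI)
      fix \<rho> assume x: "x \<in> P" and \<rho>: "0 < \<rho> \<and> \<rho> \<le> R"
      have sub: "cball x \<rho> \<subseteq> K" using P(2)[OF x] \<rho> subset_cball[of \<rho> R x] by auto
      have xK: "x \<in> K" using sub \<rho> by auto
      then have xD: "x \<in> D" using K by blast
      define p where "p = s * q + real DIM('a)"
      have p: "0 < p" using s q by (simp add: p_def add_pos_pos)
      have "(LINT z:cball x \<rho>|lebesgue. norm (F1 z - F1 x)) \<le> \<omega> * G0 x powr (1 / q) * \<rho> powr (real DIM('a) + s)"
        unfolding \<omega>_def
      proof (rule holder_ball[OF _ _ _ q])
        show "set_integrable lebesgue (cball x \<rho>) (\<lambda>z. norm (F1 z - F1 x))"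
          by (rule shift_norm_integrable[OF F1]) simp
        show "(\<lambda>z. norm (F1 z - F1 x)) \<in> borel_measurable lebesgue" using F1 by measurable
        show "0 < G0 x" using x g0[of x] by (simp add: G0_def add_nonneg_pos)
        have "(\<integral>\<^sup>+z. ennreal (norm (F1 z - F1 x) powr q) * indicator (cball x \<rho>) z \<partial>lebesgue)
          \<le> (\<integral>\<^sup>+z. ennreal (\<rho> powr p) * (ennreal (k x z) * indicator D z) \<partial>lebesgue)"
        proof (rule nn_integral_mono)
          fix z
          show "ennreal (norm (F1 z - F1 x) powr q) * indicator (cball x \<rho>) z \<le> ennreal (\<rho> powr p) * (ennreal (k x z) * indicator D z)"
          proof (cases "z \<in> cball x \<rho> \<and> z \<noteq> x")
            case True
            then have zK: "z \<in> K" using sub by blast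
            have d: "0 < norm (x - z)" "norm (x - z) \<le> \<rho>" using True by (auto simp: dist_norm)
            have "(norm (x - z) powr (s + real DIM('a) / q)) powr q = norm (x - z) powr p"
              using q by (simp add: powr_powr p_def distrib_right)
            then have kk: "k x z = norm (F x - F z) powr q / norm (x - z) powr p"
              using d by (simp add: k_def powr_divide)
            have "norm (F1 z - F1 x) powr q = norm (x - z) powr p * k x z"
              using d zK xK K by (simp add: kk norm_minus_commute)
            also have "\<dots> \<le> \<rho> powr p * k x z"
              using d p by (intro mult_right_mono powr_mono2) (auto simp: k_def)
            finally show ?thesis
              using True zK K by (auto simp: ennreal_mult'[symmetric] ennreal_leI)
          next
            case False
            then have "z = x \<or> z \<notin> cball x \<rho>" by blast
            then show ?thesis by (auto simp: indicator_def)
          qed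
        qed
        also have "\<dots> = ennreal (\<rho> powr p) * (\<integral>\<^sup>+z. ennreal (k x z) * indicator D z \<partial>lebesgue)"
        proof (rule nn_integral_cmult)
          have "integrable lebesgue (\<lambda>z. indicator D z *\<^sub>R k x z)"
            using sx xD D by (subst (asm) integrable_restrict_space) auto
          then have "(\<lambda>z. ennreal (indicator D z *\<^sub>R k x z)) \<in> borel_measurable lebesgue" by simp
          moreover have "ennreal (indicator D z *\<^sub>R k x z) = ennreal (k x z) * indicator D z" for z
            by (auto simp: indicator_def)
          ultimately show "(\<lambda>z. ennreal (k x z) * indicator D z) \<in> borel_measurable lebesgue" by simp
        qed
        also have "(\<integral>\<^sup>+z. ennreal (k x z) * indicator D z \<partial>lebesgue) = (\<integral>\<^sup>+z. ennreal (k x z) \<partial>lebesgue_on D)"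
          using D by (intro nn_integral_restrict_space[symmetric]) simp
        also have "\<dots> = ennreal (g x)"
          unfolding g_def
        proof (rule nn_integral_eq_integral)
          show "integrable (lebesgue_on D) (k x)" using sx xD by blast
        qed (simp add: k_def)
        also have "ennreal (\<rho> powr p) * ennreal (g x) \<le> ennreal (\<rho> powr p * G0 x)"
          using xD g0 by (auto simp: ennreal_mult'[symmetric] G0_def intro!: ennreal_leI mult_left_mono)
        finally show "(\<integral>\<^sup>+z. ennreal (norm (F1 z - F1 x) powr q) * indicator (cball x \<rho>) z \<partial>lebesgue) \<le> ennreal (\<rho> powr (s * q + real DIM('a)) * G0 x)"
          by (simp add: p_def)
      qed (use \<rho> in auto)
      also have "\<omega> * G0 x powr (1 / q) = G x powr (1 / q)"
        using \<omega> q G0 by (simp add: G_def powr_mult powr_powr)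
      finally show "(LINT z:cball x \<rho>|lebesgue. norm (F1 z - F1 x)) \<le> G x powr (1 / q) * \<rho> powr (real DIM('a) + s)" .
    qed
  qed
  then show ?thesis
    using Gi G0 \<omega> unfolding osc_def by (intro exI[of _ G]) (auto simp: G_def)
qed

text \<open>The counterpart for \<open>q = \<infinity>\<close>; the exponent \<open>q\<close> is free here because the constants are uniform.\<close>

lemma uniform_osc:
  fixes F F1 :: "'a::euclidean_space \<Rightarrow> 'b::euclidean_space"
  assumes F1: "integrable lebesgue F1" and K: "K \<subseteq> D" "\<And>z. z \<in> K \<Longrightarrow> F1 z = F z"
    and ae: "AE x in lebesgue. x \<in> D \<longrightarrow> (AE y in lebesgue. y \<in> D \<longrightarrow> norm (F x - F y) \<le> c * norm (x - y) powr s)"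
    and c: "0 \<le> c" and s: "0 < s" and q: "1 \<le> q"
    and P: "P \<in> lmeasurable" "\<And>x. x \<in> P \<Longrightarrow> cball x R \<subseteq> K" and R: "0 < R"
  shows "\<exists>G. osc F1 s q P R G"
proof -
  define \<omega> where "\<omega> = measure lebesgue (cball (0::'a) 1)"
  have \<omega>: "0 \<le> \<omega>" by (simp add: \<omega>_def)
  define G where "G x = (c * \<omega>) powr q * indicator P x" for x :: 'a
  have "AE x in lebesgue. x \<in> P \<longrightarrow> ball_growth (\<lambda>z. norm (F1 z - F1 x)) (real DIM('a) + s) (G x powr (1 / q)) R x"
    using ae
  proof eventually_elim
    case sx: (elim x)
    show ?case
      unfolding ball_growth_def
    proof (intro impI allI)
      fix \<rho> assume x: "x \<in> P" and \<rho>: "0 < \<rho> \<and> \<rho> \<le> R"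
      have sub: "cball x \<rho> \<subseteq> K" using P(2)[OF x] \<rho> subset_cball[of \<rho> R x] by auto
      have xK: "x \<in> K" using sub \<rho> by auto
      have ci: "set_integrable lebesgue (cball x \<rho>) (\<lambda>_. c * \<rho> powr s)"
        by (rule absolutely_integrable_on_const) simp
      have "(LINT z:cball x \<rho>|lebesgue. norm (F1 z - F1 x)) \<le> (LINT z:cball x \<rho>|lebesgue. c * \<rho> powr s)"
      proof (rule set_integral_mono_AE[OF _ ci])
        show "set_integrable lebesgue (cball x \<rho>) (\<lambda>z. norm (F1 z - F1 x))"
          by (rule shift_norm_integrable[OF F1]) simp
        have "AE y in lebesgue. y \<in> D \<longrightarrow> norm (F x - F y) \<le> c * norm (x - y) powr s" using sx xK K by blast
        then show "AE z in lebesgue. z \<in> cball x \<rho> \<longrightarrow> norm (F1 z - F1 x) \<le> c * \<rho> powr s"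
        proof eventually_elim
          case z: (elim z)
          show ?case
          proof
            assume zc: "z \<in> cball x \<rho>"
            then have zK: "z \<in> K" using sub by blast
            have "norm (F1 z - F1 x) \<le> c * norm (x - z) powr s"
              using z zK xK K by (auto simp: norm_minus_commute)
            also have "\<dots> \<le> c * \<rho> powr s"
              using zc c s by (intro mult_left_mono powr_mono2) (auto simp: dist_norm)
            finally show "norm (F1 z - F1 x) \<le> c * \<rho> powr s" .
          qed
        qed
      qed
      also have "\<dots> = c * \<rho> powr s * measure lebesgue (cball x \<rho>)"
        by (simp add: set_lebesgue_integral_def mult.commute)
      also have "\<dots> = c * \<omega> * \<rho> powr (real DIM('a) + s)"
      proof -
        have "measure lebesgue (cball x \<rho>) = \<omega> * \<rho> powr real DIM('a)"
          using measure_cball[of \<rho> x] \<rho> by (simp add: \<omega>_def powr_realpow)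
        then show ?thesis by (simp only: powr_add) (simp add: mult_ac)
      qed
      also have "c * \<omega> = G x powr (1 / q)"
        using x c \<omega> q by (simp add: G_def powr_powr)
      finally show "(LINT z:cball x \<rho>|lebesgue. norm (F1 z - F1 x)) \<le> G x powr (1 / q) * \<rho> powr (real DIM('a) + s)" .
    qed
  qed
  moreover have "integrable lebesgue G"
    unfolding G_def using P by (intro integrable_mult_right integrable_real_indicator) (auto simp: fmeasurable_def)
  ultimately show ?thesis
    unfolding osc_def by (intro exI[of _ G]) (auto simp: G_def)
qed

text \<open>Tonelli's theorem and \<open>riesz_kernel\<close>, with \<open>f\<close> depending on either of the two variables.\<close>

lemma riesz_product_finite:
  fixes f :: "'a::euclidean_space \<Rightarrow> real"
  assumes f: "integrable lebesgue f" "\<And>x. 0 \<le> f x" and \<kappa>: "0 < \<kappa>" and r: "0 < r"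
  defines "k \<equiv> \<lambda>x y. ennreal (norm (x - y) powr (\<kappa> - real DIM('a))) * indicator {p. norm (fst p - snd p) \<le> r} (x, y)"
  shows "(\<lambda>(x, y). ennreal (f x) * k x y) \<in> borel_measurable (lebesgue \<Otimes>\<^sub>M (lebesgue :: 'a measure))"
    and "(\<lambda>(x, y). ennreal (f y) * k x y) \<in> borel_measurable (lebesgue \<Otimes>\<^sub>M (lebesgue :: 'a measure))"
    and "(\<integral>\<^sup>+x. \<integral>\<^sup>+y. ennreal (f x) * k x y \<partial>lebesgue \<partial>lebesgue) < \<infinity>"
    and "(\<integral>\<^sup>+x. \<integral>\<^sup>+y. ennreal (f y) * k x y \<partial>lebesgue \<partial>lebesgue) < \<infinity>"
proof -
  note norm_diff_measurable[where 'a = 'a, measurable]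
  have fm[measurable]: "f \<in> borel_measurable lebesgue" using f by simp
  have km: "(\<lambda>p. k (fst p) (snd p)) \<in> borel_measurable (lebesgue \<Otimes>\<^sub>M (lebesgue :: 'a measure))"
    unfolding k_def prod.collapse by measurable
  have f1: "(\<lambda>p. ennreal (f (fst p))) \<in> borel_measurable (lebesgue \<Otimes>\<^sub>M (lebesgue :: 'a measure))"
    and f2: "(\<lambda>p. ennreal (f (snd p))) \<in> borel_measurable (lebesgue \<Otimes>\<^sub>M (lebesgue :: 'a measure))"
    by measurable
  show m1: "(\<lambda>(x, y). ennreal (f x) * k x y) \<in> borel_measurable (lebesgue \<Otimes>\<^sub>M (lebesgue :: 'a measure))"
    unfolding case_prod_beta' by (intro borel_measurable_times_ennreal f1 km)
  show m2: "(\<lambda>(x, y). ennreal (f y) * k x y) \<in> borel_measurable (lebesgue \<Otimes>\<^sub>M (lebesgue :: 'a measure))"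
    unfolding case_prod_beta' by (intro borel_measurable_times_ennreal f2 km)
  obtain c where c: "\<And>x::'a. (\<integral>\<^sup>+y. ennreal (norm (x - y) powr (\<kappa> - real DIM('a))) * indicator (cball x r) y \<partial>lebesgue) \<le> ennreal c"
    using riesz_kernel[OF \<kappa> r] by blast
  have sym: "k x y = k y x" for x y by (simp add: k_def indicator_def norm_minus_commute[of x y])
  have kx: "(\<lambda>y. k x y) \<in> borel_measurable lebesgue" for x
    using measurable_compose[OF measurable_Pair1' km, of x] by simp
  have kc: "(\<integral>\<^sup>+y. k x y \<partial>lebesgue) \<le> ennreal c" for x
  proof -
    have "(\<integral>\<^sup>+y. k x y \<partial>lebesgue) = (\<integral>\<^sup>+y. ennreal (norm (x - y) powr (\<kappa> - real DIM('a))) * indicator (cball x r) y \<partial>lebesgue)"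
      by (intro nn_integral_cong) (auto simp: k_def indicator_def dist_norm)
    then show ?thesis using c by simp
  qed
  have fin: "(\<integral>\<^sup>+x. ennreal (f x) * ennreal c \<partial>lebesgue) < \<infinity>"
  proof -
    have "(\<integral>\<^sup>+x. ennreal (f x) * ennreal c \<partial>lebesgue) = ennreal (LINT x|lebesgue. f x) * ennreal c"
      using f by (subst nn_integral_multc) (auto simp: nn_integral_eq_integral)
    then show ?thesis by (simp add: ennreal_mult_less_top)
  qed
  have "(\<integral>\<^sup>+x. \<integral>\<^sup>+y. ennreal (f x) * k x y \<partial>lebesgue \<partial>lebesgue) \<le> (\<integral>\<^sup>+x. ennreal (f x) * ennreal c \<partial>lebesgue)"
    by (intro nn_integral_mono) (auto simp: nn_integral_cmult[OF kx] intro!: mult_left_mono kc)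
  then show 1: "(\<integral>\<^sup>+x. \<integral>\<^sup>+y. ennreal (f x) * k x y \<partial>lebesgue \<partial>lebesgue) < \<infinity>" using fin by (rule le_less_trans)
  have "(\<integral>\<^sup>+x. \<integral>\<^sup>+y. ennreal (f y) * k x y \<partial>lebesgue \<partial>lebesgue) = (\<integral>\<^sup>+y. \<integral>\<^sup>+x. ennreal (f y) * k x y \<partial>lebesgue \<partial>lebesgue)"
    using leb_pair.Fubini'[OF m2] by simp
  also have "\<dots> = (\<integral>\<^sup>+y. \<integral>\<^sup>+x. ennreal (f y) * k y x \<partial>lebesgue \<partial>lebesgue)"
    by (simp add: sym)
  finally show "(\<integral>\<^sup>+x. \<integral>\<^sup>+y. ennreal (f y) * k x y \<partial>lebesgue \<partial>lebesgue) < \<infinity>" using 1 by simp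
qed

text \<open>Near the diagonal the \<open>q\<close>-th power of the quotient is dominated by
  \<open>(G x + G y + 1) |x - y|\<^sup>\<kappa>\<^sup>-\<^sup>n\<close> with \<open>\<kappa> = (s - s') q > 0\<close>, which \<open>riesz_product_finite\<close> integrates. Away from
  the diagonal the quotient is bounded, since \<open>v\<close> is.\<close>

lemma hajlasz_slobodeckij:
  fixes v :: "'a::euclidean_space \<Rightarrow> 'b::euclidean_space"
  assumes D: "D \<in> lmeasurable" and v: "v \<in> borel_measurable (lebesgue_on D)"
    and G: "integrable lebesgue G" "\<And>x. 0 \<le> G x" and M: "0 \<le> M" and r: "0 < r" and q: "1 \<le> q"
    and s: "0 < s'" "s' < s" and N: "N \<in> null_sets lebesgue" and B: "0 \<le> B" "\<And>x. x \<in> D - N \<Longrightarrow> norm (v x) \<le> B"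
    and h: "\<And>x y. x \<in> D - N \<Longrightarrow> y \<in> D - N \<Longrightarrow> norm (x - y) \<le> r \<Longrightarrow>
      norm (v x - v y) \<le> M * (G x powr (1 / q) + G y powr (1 / q) + 1) * norm (x - y) powr s"
  shows "integrable (lebesgue_on D \<Otimes>\<^sub>M lebesgue_on D)
    (\<lambda>(x, y). norm (norm (v x - v y) / norm (x - y) powr (s' + real DIM('a) / q)) powr q)"
proof -
  have Ds: "D \<in> sets lebesgue" using D by auto
  define p where "p = s' + real DIM('a) / q"
  define \<kappa> where "\<kappa> = (s - s') * q"
  have \<kappa>: "0 < \<kappa>" using s q by (simp add: \<kappa>_def)
  define H where "H x y = (norm (v x - v y) / norm (x - y) powr p) powr q" for x y
  define f where "f x = G x + indicator D x" for x
  have f: "integrable lebesgue f" "0 \<le> f x" for x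
    unfolding f_def using G D
    by (auto intro!: Bochner_Integration.integrable_add integrable_real_indicator simp: fmeasurable_def)
  define k where "k x y = ennreal (norm (x - y) powr (\<kappa> - real DIM('a))) * indicator {p. norm (fst p - snd p) \<le> r} (x, y)" for x y :: 'a
  note RP = riesz_product_finite[OF f \<kappa> r, folded k_def]
  define c1 where "c1 = (M * 3) powr q"
  define c2 where "c2 = (2 * B / r powr p) powr q"
  have c: "0 \<le> c1" "0 \<le> c2" by (auto simp: c1_def c2_def)
  have p: "0 < p" using s q by (simp add: p_def add_pos_nonneg)
  have bound: "ennreal (H x y) \<le> ennreal c1 * (ennreal (f x) * k x y) + ennreal c1 * (ennreal (f y) * k x y) + ennreal c2 * indicator D x * indicator D y"
    if x: "x \<in> D - N" and y: "y \<in> D - N" for x y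
  proof (cases "norm (x - y) \<le> r")
    case True
    show ?thesis
    proof (cases "x = y")
      case False
      define d where "d = norm (x - y)"
      have d: "0 < d" using False by (simp add: d_def)
      define gx where "gx = G x powr (1 / q)"
      define gy where "gy = G y powr (1 / q)"
      have gxy: "0 \<le> gx" "0 \<le> gy" by (auto simp: gx_def gy_def)
      have "(gx + gy + 1) powr q \<le> 3 powr q * (gx powr q + gy powr q + 1)"
      proof -
        have "gx + gy + 1 \<le> 3 * max gx (max gy 1)" by simp
        then have "(gx + gy + 1) powr q \<le> (3 * max gx (max gy 1)) powr q"
          using gxy q by (intro powr_mono2) auto
        also have "\<dots> = 3 powr q * max gx (max gy 1) powr q" using gxy by (subst powr_mult) auto
        also have "max gx (max gy 1) powr q \<le> gx powr q + gy powr q + 1"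
          by (auto simp: max_def)
        finally show ?thesis by simp
      qed
      also have "gx powr q = G x" using G(2)[of x] q by (simp add: gx_def powr_powr)
      also have "gy powr q = G y" using G(2)[of y] q by (simp add: gy_def powr_powr)
      finally have pw: "(gx + gy + 1) powr q \<le> 3 powr q * (G x + G y + 1)" .
      have "norm (v x - v y) \<le> M * (gx + gy + 1) * d powr s"
        using h[OF x y True] by (simp add: gx_def gy_def d_def)
      then have "norm (v x - v y) / d powr p \<le> M * (gx + gy + 1) * d powr s / d powr p"
        by (intro divide_right_mono) auto
      also have "\<dots> = M * (gx + gy + 1) * d powr (s - p)" using d by (simp add: powr_diff)
      finally have "H x y \<le> (M * (gx + gy + 1) * d powr (s - p)) powr q"
        unfolding H_def d_def[symmetric] using q by (intro powr_mono2) auto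
      also have "\<dots> = M powr q * (gx + gy + 1) powr q * d powr ((s - p) * q)"
        using M gxy by (simp add: powr_mult powr_powr)
      also have "(s - p) * q = \<kappa> - real DIM('a)"
        using q by (simp add: p_def \<kappa>_def field_simps)
      also have "M powr q * (gx + gy + 1) powr q * d powr (\<kappa> - real DIM('a)) \<le> M powr q * (3 powr q * (G x + G y + 1)) * d powr (\<kappa> - real DIM('a))"
        by (intro mult_right_mono mult_left_mono pw) auto
      also have "\<dots> = c1 * (G x + G y + 1) * d powr (\<kappa> - real DIM('a))"
        using M by (simp add: c1_def powr_mult)
      also have "\<dots> \<le> c1 * (f x + f y) * d powr (\<kappa> - real DIM('a))"
        using x y c by (intro mult_right_mono mult_left_mono) (auto simp: f_def)
      finally have "ennreal (H x y) \<le> ennreal (c1 * (f x + f y) * d powr (\<kappa> - real DIM('a)))" by (rule ennreal_leI)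
      also have "\<dots> = ennreal c1 * (ennreal (f x) * k x y) + ennreal c1 * (ennreal (f y) * k x y)"
        using True c f(2)[of x] f(2)[of y] by (simp add: k_def d_def ennreal_mult ennreal_plus distrib_left distrib_right mult.assoc)
      finally show ?thesis by (rule order_trans) simp
    qed (simp add: H_def)
  next
    case False
    have "norm (v x - v y) \<le> 2 * B"
      using norm_triangle_ineq4[of "v x" "v y"] B(2)[OF x] B(2)[OF y] by simp
    moreover have "r powr p \<le> norm (x - y) powr p" using False r p by (intro powr_mono2) auto
    ultimately have "norm (v x - v y) / norm (x - y) powr p \<le> 2 * B / r powr p"
      using r B by (intro frac_le) auto
    then have "H x y \<le> c2" unfolding H_def c2_def using q by (intro powr_mono2) auto
    then have "ennreal (H x y) \<le> ennreal c2 * indicator D x * indicator D y"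
      using x y by (simp add: ennreal_leI)
    then show ?thesis by (rule order_trans) simp
  qed
  interpret D: pair_sigma_finite "lebesgue_on D" "lebesgue_on D" by (rule pair_sigma_finite_lebesgue_on[OF Ds])
  have Hm: "case_prod H \<in> borel_measurable (lebesgue_on D \<Otimes>\<^sub>M lebesgue_on D)"
  proof -
    have "(\<lambda>z. (case z of (x, y) \<Rightarrow> norm (v x - v y) / norm (x - y) powr p) powr q) \<in> borel_measurable (lebesgue_on D \<Otimes>\<^sub>M lebesgue_on D)"
      by (intro powr_real_measurable quotient_measurable v) auto
    then show ?thesis by (simp add: H_def case_prod_beta')
  qed
  have AEN: "AE x in lebesgue. x \<notin> N" using N by (rule AE_not_in)
  have k1m: "(\<lambda>y. ennreal (f x) * k x y) \<in> borel_measurable lebesgue" for x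
    using measurable_compose[OF measurable_Pair1' RP(1), of x] by simp
  have k2m: "(\<lambda>y. ennreal (f y) * k x y) \<in> borel_measurable lebesgue" for x
    using measurable_compose[OF measurable_Pair1' RP(2), of x] by simp
  note k1c = borel_measurable_times_ennreal[OF borel_measurable_const[of "ennreal c1"] k1m]
    and k2c = borel_measurable_times_ennreal[OF borel_measurable_const[of "ennreal c1"] k2m]
  have i1m: "(\<lambda>x. \<integral>\<^sup>+y. ennreal (f x) * k x y \<partial>lebesgue) \<in> borel_measurable lebesgue"
    using sigma_finite_measure.borel_measurable_nn_integral[OF sigma_finite_lebesgue RP(1)] .
  have i2m: "(\<lambda>x. \<integral>\<^sup>+y. ennreal (f y) * k x y \<partial>lebesgue) \<in> borel_measurable lebesgue"
    using sigma_finite_measure.borel_measurable_nn_integral[OF sigma_finite_lebesgue RP(2)] .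
  have Di: "(\<lambda>x. indicator D x :: ennreal) \<in> borel_measurable lebesgue" using Ds by simp
  have Hn: "(\<integral>\<^sup>+z. ennreal (case_prod H z) \<partial>(lebesgue_on D \<Otimes>\<^sub>M lebesgue_on D))
      = (\<integral>\<^sup>+x. \<integral>\<^sup>+y. ennreal (H x y) \<partial>lebesgue_on D \<partial>lebesgue_on D)"
    using sigma_finite_measure.nn_integral_fst[OF sigma_finite_lebesgue_on[OF Ds], of "\<lambda>z. ennreal (case_prod H z)" "lebesgue_on D"] Hm by simp
  also have "\<dots> = (\<integral>\<^sup>+x. (\<integral>\<^sup>+y. ennreal (H x y) * indicator D y \<partial>lebesgue) * indicator D x \<partial>lebesgue)"
    using Ds by (simp add: nn_integral_restrict_space)
  also have "\<dots> \<le> (\<integral>\<^sup>+x. ennreal c1 * (\<integral>\<^sup>+y. ennreal (f x) * k x y \<partial>lebesgue)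
      + ennreal c1 * (\<integral>\<^sup>+y. ennreal (f y) * k x y \<partial>lebesgue) + ennreal c2 * emeasure lebesgue D * indicator D x \<partial>lebesgue)"
  proof (rule nn_integral_mono_AE)
    show "AE x in lebesgue. (\<integral>\<^sup>+y. ennreal (H x y) * indicator D y \<partial>lebesgue) * indicator D x
      \<le> ennreal c1 * (\<integral>\<^sup>+y. ennreal (f x) * k x y \<partial>lebesgue)
      + ennreal c1 * (\<integral>\<^sup>+y. ennreal (f y) * k x y \<partial>lebesgue) + ennreal c2 * emeasure lebesgue D * indicator D x"
      using AEN
    proof eventually_elim
      case xN: (elim x)
      show ?case
      proof (cases "x \<in> D")
        case True
        have "(\<integral>\<^sup>+y. ennreal (H x y) * indicator D y \<partial>lebesgue)
          \<le> (\<integral>\<^sup>+y. (ennreal c1 * (ennreal (f x) * k x y) + ennreal c1 * (ennreal (f y) * k x y)) + ennreal c2 * indicator D y \<partial>lebesgue)"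
        proof (rule nn_integral_mono_AE)
          show "AE y in lebesgue. ennreal (H x y) * indicator D y \<le> (ennreal c1 * (ennreal (f x) * k x y) + ennreal c1 * (ennreal (f y) * k x y)) + ennreal c2 * indicator D y"
            using AEN
          proof eventually_elim
            case yN: (elim y)
            show ?case
              using bound[of x y] True xN yN by (cases "y \<in> D") auto
          qed
        qed
        also have "\<dots> = (\<integral>\<^sup>+y. ennreal c1 * (ennreal (f x) * k x y) + ennreal c1 * (ennreal (f y) * k x y) \<partial>lebesgue) + (\<integral>\<^sup>+y. ennreal c2 * indicator D y \<partial>lebesgue)"
          by (intro nn_integral_add borel_measurable_add[OF k1c k2c] borel_measurable_times_ennreal borel_measurable_const Di)
        also have "(\<integral>\<^sup>+y. ennreal c1 * (ennreal (f x) * k x y) + ennreal c1 * (ennreal (f y) * k x y) \<partial>lebesgue)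
           = (\<integral>\<^sup>+y. ennreal c1 * (ennreal (f x) * k x y) \<partial>lebesgue) + (\<integral>\<^sup>+y. ennreal c1 * (ennreal (f y) * k x y) \<partial>lebesgue)"
          by (rule nn_integral_add[OF k1c k2c])
        also have "(\<integral>\<^sup>+y. ennreal c1 * (ennreal (f x) * k x y) \<partial>lebesgue) = ennreal c1 * (\<integral>\<^sup>+y. ennreal (f x) * k x y \<partial>lebesgue)"
          by (rule nn_integral_cmult[OF k1m])
        also have "(\<integral>\<^sup>+y. ennreal c1 * (ennreal (f y) * k x y) \<partial>lebesgue) = ennreal c1 * (\<integral>\<^sup>+y. ennreal (f y) * k x y \<partial>lebesgue)"
          by (rule nn_integral_cmult[OF k2m])
        also have "(\<integral>\<^sup>+y. ennreal c2 * indicator D y \<partial>lebesgue) = ennreal c2 * emeasure lebesgue D"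
          using Ds by (rule nn_integral_cmult_indicator)
        finally show ?thesis using True by simp
      qed simp
    qed
  qed
  also have "\<dots> = ennreal c1 * (\<integral>\<^sup>+x. \<integral>\<^sup>+y. ennreal (f x) * k x y \<partial>lebesgue \<partial>lebesgue)
      + ennreal c1 * (\<integral>\<^sup>+x. \<integral>\<^sup>+y. ennreal (f y) * k x y \<partial>lebesgue \<partial>lebesgue) + ennreal c2 * emeasure lebesgue D * emeasure lebesgue D"
  proof -
    have a1: "(\<lambda>x. ennreal c1 * (\<integral>\<^sup>+y. ennreal (f x) * k x y \<partial>lebesgue)) \<in> borel_measurable lebesgue"
      and a2: "(\<lambda>x. ennreal c1 * (\<integral>\<^sup>+y. ennreal (f y) * k x y \<partial>lebesgue)) \<in> borel_measurable lebesgue"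
      and a3: "(\<lambda>x. ennreal c2 * emeasure lebesgue D * indicator D x) \<in> borel_measurable lebesgue"
      by (intro borel_measurable_times_ennreal borel_measurable_const i1m i2m Di)+
    show ?thesis
      by (simp only: nn_integral_add[OF borel_measurable_add[OF a1 a2] a3] nn_integral_add[OF a1 a2]
          nn_integral_cmult[OF i1m] nn_integral_cmult[OF i2m] nn_integral_cmult_indicator[OF Ds])
  qed
  also have "\<dots> < \<infinity>"
    using RP(3,4) fmeasurableD2[OF D] by (simp add: ennreal_mult_less_top less_top ennreal_mult_eq_top_iff del: emeasure_completion)
  finally have fin: "(\<integral>\<^sup>+z. ennreal (case_prod H z) \<partial>(lebesgue_on D \<Otimes>\<^sub>M lebesgue_on D)) < \<infinity>" .
  have "integrable (lebesgue_on D \<Otimes>\<^sub>M lebesgue_on D) (case_prod H)"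
    by (rule integrableI_nonneg[OF Hm _ fin]) (auto simp: H_def)
  then show ?thesis unfolding H_def p_def by simp
qed

lemma holder_slobodeckij:
  fixes v :: "'a::euclidean_space \<Rightarrow> 'b::euclidean_space"
  assumes Ds: "D \<in> sets lebesgue" and v: "v \<in> borel_measurable (lebesgue_on D)"
    and M: "0 \<le> M" and r: "0 < r" "r \<le> 1"
    and s: "0 < s'" "s' < s" and N: "N \<in> null_sets lebesgue" and B: "0 \<le> B" "\<And>x. x \<in> D - N \<Longrightarrow> norm (v x) \<le> B"
    and h: "\<And>x y. x \<in> D - N \<Longrightarrow> y \<in> D - N \<Longrightarrow> norm (x - y) \<le> r \<Longrightarrow> norm (v x - v y) \<le> M * norm (x - y) powr s"
  shows "\<exists>C. AE (x, y) in lebesgue_on D \<Otimes>\<^sub>M lebesgue_on D. norm (norm (v x - v y) / norm (x - y) powr s') \<le> C"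
proof -
  interpret D: pair_sigma_finite "lebesgue_on D" "lebesgue_on D" by (rule pair_sigma_finite_lebesgue_on[OF Ds])
  define C where "C = M + 2 * B / r powr s'"
  have bound: "norm (norm (v x - v y) / norm (x - y) powr s') \<le> C" if x: "x \<in> D - N" and y: "y \<in> D - N" for x y
  proof (cases "norm (x - y) \<le> r")
    case True
    show ?thesis
    proof (cases "x = y")
      case False
      define d where "d = norm (x - y)"
      have d: "0 < d" "d \<le> 1" using False True r by (auto simp: d_def)
      have "norm (v x - v y) / d powr s' \<le> M * d powr s / d powr s'"
        using h[OF x y True] by (intro divide_right_mono) (auto simp: d_def)
      also have "\<dots> = M * d powr (s - s')" using d by (simp add: powr_diff)
      also have "\<dots> \<le> M * 1" using d s M by (intro mult_left_mono powr_le1) auto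
      also have "\<dots> \<le> C" using B by (simp add: C_def)
      finally show ?thesis by (simp add: d_def)
    qed (use M B in \<open>simp add: C_def\<close>)
  next
    case False
    have "norm (v x - v y) \<le> 2 * B"
      using norm_triangle_ineq4[of "v x" "v y"] B(2)[OF x] B(2)[OF y] by simp
    moreover have "r powr s' \<le> norm (x - y) powr s'" using False r s by (intro powr_mono2) auto
    ultimately have "norm (v x - v y) / norm (x - y) powr s' \<le> 2 * B / r powr s'"
      using r B by (intro frac_le) auto
    then show ?thesis using M by (simp add: C_def)
  qed
  have ND: "AE x in lebesgue_on D. x \<notin> N"
  proof -
    have "AE x in lebesgue. x \<notin> N" using N by (rule AE_not_in)
    then have "AE x in lebesgue. x \<in> D \<longrightarrow> x \<notin> N" by eventually_elim simp
    then show ?thesis by (simp add: AE_lebesgue_on_iff Ds)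
  qed
  have ND2: "AE x in lebesgue_on D. x \<in> D - N"
    using ND AE_space by eventually_elim auto
  have "AE x in lebesgue_on D. AE y in lebesgue_on D. norm (norm (v x - v y) / norm (x - y) powr s') \<le> C"
    using ND2
  proof eventually_elim
    case (elim x)
    show ?case using ND2 by eventually_elim (rule bound[OF elim])
  qed
  moreover have "{z \<in> space (lebesgue_on D \<Otimes>\<^sub>M lebesgue_on D). norm (case z of (x, y) \<Rightarrow> norm (v x - v y) / norm (x - y) powr s') \<le> C}
     \<in> sets (lebesgue_on D \<Otimes>\<^sub>M lebesgue_on D)"
  proof -
    define f where "f = (\<lambda>(x, y). norm (v x - v y) / norm (x - y) powr s')"
    have [measurable]: "f \<in> borel_measurable (lebesgue_on D \<Otimes>\<^sub>M lebesgue_on D)"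
      unfolding f_def by (rule quotient_measurable[OF v])
    have "{z \<in> space (lebesgue_on D \<Otimes>\<^sub>M lebesgue_on D). norm (f z) \<le> C} \<in> sets (lebesgue_on D \<Otimes>\<^sub>M lebesgue_on D)"
      by measurable
    then show ?thesis by (simp only: f_def)
  qed
  ultimately have "AE z in lebesgue_on D \<Otimes>\<^sub>M lebesgue_on D. norm (case z of (x, y) \<Rightarrow> norm (v x - v y) / norm (x - y) powr s') \<le> C"
    by (intro D.AE_pair_measure) auto
  then show ?thesis by (intro exI[of _ C]) (auto simp: case_prod_beta')
qed

section \<open>Function spaces on bounded domains\<close>

lemma Lq_real_iff:
  "q \<noteq> \<infinity> \<Longrightarrow> f \<in> Lq q M \<longleftrightarrow> f \<in> borel_measurable M \<and> integrable M (\<lambda>x. norm (f x) powr enn2real q)"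
  by (simp add: Lq_def)

lemma bounded_powr_integrable:
  fixes f :: "'a::euclidean_space \<Rightarrow> 'b::euclidean_space"
  assumes D: "D \<in> lmeasurable" and f: "f \<in> borel_measurable (lebesgue_on D)"
    and b: "AE x in lebesgue_on D. norm (f x) \<le> C" and q: "0 < q"
  shows "integrable (lebesgue_on D) (\<lambda>x. norm (f x) powr q)"
proof (rule Bochner_Integration.integrable_bound)
  show "integrable (lebesgue_on D) (\<lambda>x. \<bar>C\<bar> powr q)"
    using D by (simp add: finite_measure.integrable_const finite_measure_lebesgue_on)
  show "(\<lambda>x. norm (f x) powr q) \<in> borel_measurable (lebesgue_on D)"
    using f by measurable
  show "AE x in lebesgue_on D. norm (norm (f x) powr q) \<le> norm (\<bar>C\<bar> powr q)"
    using b by eventually_elim (use q in \<open>auto intro!: powr_mono2\<close>)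
qed

lemma Lq_imp_integrable:
  fixes f :: "'a::euclidean_space \<Rightarrow> 'b::euclidean_space"
  assumes D: "D \<in> lmeasurable" and f: "f \<in> borel_measurable (lebesgue_on D)"
    and fq: "integrable (lebesgue_on D) (\<lambda>x. norm (f x) powr q)" and q: "1 \<le> q"
  shows "integrable (lebesgue_on D) f"
proof (rule Bochner_Integration.integrable_bound[OF _ f])
  show "integrable (lebesgue_on D) (\<lambda>x. 1 + norm (f x) powr q)"
    using fq D by (intro Bochner_Integration.integrable_add) (simp_all add: finite_measure.integrable_const finite_measure_lebesgue_on)
  show "AE x in lebesgue_on D. norm (f x) \<le> norm (1 + norm (f x) powr q)"
  proof (rule AE_I2)
    fix x
    show "norm (f x) \<le> norm (1 + norm (f x) powr q)"
    proof (cases "norm (f x) \<le> 1")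
      case False
      then have "norm (f x) powr 1 \<le> norm (f x) powr q" using q by (intro powr_mono) auto
      then show ?thesis using False by simp
    qed (simp add: add_increasing2)
  qed
qed

text \<open>For \<open>q = \<infinity>\<close> any finite exponent \<open>r\<close> may be used instead, as \<open>D\<close> has finite measure.\<close>

lemma Lq_real_integrable:
  fixes f :: "'a::euclidean_space \<Rightarrow> 'b::euclidean_space"
  assumes D: "D \<in> lmeasurable" and f: "f \<in> Lq q (lebesgue_on D)" and r: "0 < r" "q \<noteq> \<infinity> \<Longrightarrow> r = enn2real q"
  shows "f \<in> borel_measurable (lebesgue_on D)" and "integrable (lebesgue_on D) (\<lambda>x. norm (f x) powr r)"
proof -
  show m: "f \<in> borel_measurable (lebesgue_on D)" using f by (simp add: Lq_def)
  show "integrable (lebesgue_on D) (\<lambda>x. norm (f x) powr r)"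
  proof (cases "q = \<infinity>")
    case True
    then obtain C where "AE x in lebesgue_on D. norm (f x) \<le> C" using f by (auto simp: Lq_def)
    then show ?thesis using bounded_powr_integrable[OF D m _ r(1)] by blast
  qed (use f r in \<open>simp add: Lq_def\<close>)
qed

lemma Lq_integrable:
  fixes f :: "'a::euclidean_space \<Rightarrow> 'b::euclidean_space"
  assumes D: "D \<in> lmeasurable" and f: "f \<in> Lq q (lebesgue_on D)" and r: "1 \<le> r" "q \<noteq> \<infinity> \<Longrightarrow> r = enn2real q"
  shows "integrable (lebesgue_on D) f"
proof -
  have r0: "0 < r" using r by simp
  show ?thesis
    by (rule Lq_imp_integrable[OF D Lq_real_integrable(1)[OF D f r0 r(2)] Lq_real_integrable(2)[OF D f r0 r(2)] r(1)])
qed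

text \<open>The closed neighbourhood of radius \<open>r\<close>. In the form of a sum it is compact for bounded \<open>S\<close>.\<close>

definition nbhd :: "'a::euclidean_space set \<Rightarrow> real \<Rightarrow> 'a set"
  where "nbhd S r = {x + y |x y. x \<in> closure S \<and> y \<in> cball 0 r}"

lemma nbhd_cball: "x \<in> nbhd S r \<Longrightarrow> cball x d \<subseteq> nbhd S (r + d)"
proof
  fix z assume "x \<in> nbhd S r" and z: "z \<in> cball x d"
  then obtain p y where p: "x = p + y" "p \<in> closure S" "norm y \<le> r" by (auto simp: nbhd_def)
  have "norm (y + (z - x)) \<le> r + d"
    using norm_triangle_ineq[of y "z - x"] p(3) z by (simp add: dist_norm norm_minus_commute)
  moreover have "z = p + (y + (z - x))" using p by simp
  ultimately show "z \<in> nbhd S (r + d)" unfolding nbhd_def using p(2) mem_cball_0 by blast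
qed

lemma nbhd_mono: "r \<le> r' \<Longrightarrow> nbhd S r \<subseteq> nbhd S r'"
  unfolding nbhd_def by force

lemma nbhd_cball_subset: "x \<in> nbhd S r \<Longrightarrow> r + d \<le> r' \<Longrightarrow> cball x d \<subseteq> nbhd S r'"
  using nbhd_cball nbhd_mono by blast

lemma subset_nbhd: "0 \<le> r \<Longrightarrow> S \<subseteq> nbhd S r"
proof
  fix x assume "0 \<le> r" "x \<in> S"
  then have "x = x + 0 \<and> x \<in> closure S \<and> (0::'a) \<in> cball 0 r" using closure_subset by auto
  then show "x \<in> nbhd S r" unfolding nbhd_def by blast
qed

lemma compact_nbhd: "bounded S \<Longrightarrow> compact (nbhd S r)"
  unfolding nbhd_def by (intro compact_sums) auto

text \<open>A ball around a point of \<open>D'\<close> that leaves \<open>D\<close> has to meet the frontier, by connectedness.\<close>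

lemma compactly_inside_neighbourhood:
  fixes D D' :: "'a::euclidean_space set"
  assumes D: "open D" and sub: "D' \<Subset> D"
  shows "\<exists>R. 0 < R \<and> R \<le> 1 / 2 \<and> nbhd D' (10 * R) \<subseteq> D"
proof -
  define d where "d = setdist D' (frontier D)"
  have d: "0 < d" "D' \<subseteq> D" using sub by (auto simp: compactly_inside_def d_def)
  define R where "R = min (1 / 2) (d / 20)"
  have R: "0 < R" "R \<le> 1 / 2" "10 * R < d" using d by (auto simp: R_def min_def)
  have "x + y \<in> D" if x: "x \<in> closure D'" and y: "y \<in> cball 0 (10 * R)" for x y
  proof -
    obtain x' where x': "x' \<in> D'" "dist x' x < d - 10 * R"
      using x R(3) unfolding closure_approachable by (metis diff_gt_0_iff_gt)
    have "dist x' (x + y) \<le> dist x' x + dist x (x + y)" by (rule dist_triangle)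
    also have "dist x (x + y) = norm y" by (simp add: dist_norm)
    finally have b: "x + y \<in> ball x' d" using x' y by simp
    have "ball x' d \<inter> frontier D = {}"
    proof (rule ccontr)
      assume "ball x' d \<inter> frontier D \<noteq> {}"
      then obtain z where z: "z \<in> frontier D" "dist x' z < d" by auto
      have "d \<le> dist x' z" unfolding d_def using x' z by (intro setdist_le_dist)
      then show False using z by simp
    qed
    moreover have "x' \<in> ball x' d \<inter> D" using x' d by auto
    ultimately have "ball x' d \<subseteq> D"
      using connected_Int_frontier[OF connected_ball, of x' d D] by blast
    then show ?thesis using b by blast
  qed
  then have "nbhd D' (10 * R) \<subseteq> D" unfolding nbhd_def by blast
  with R show ?thesis by blast
qed

lemma locally_integrable_indicator:
  fixes f :: "'a::euclidean_space \<Rightarrow> 'b::euclidean_space"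
  assumes "locally_integrable D f" "compact K" "K \<subseteq> D"
  shows "integrable lebesgue (\<lambda>z. indicator K z *\<^sub>R f z)"
  using assms unfolding locally_integrable_def set_integrable_def by blast

lemma weak_gradient_indicator_integrable:
  fixes Du :: "'a::euclidean_space \<Rightarrow> 'a"
  assumes u: "weak_gradient D u Du" and K: "compact K" "K \<subseteq> D"
  shows "integrable lebesgue (\<lambda>z. indicator K z *\<^sub>R Du z)"
proof -
  have "integrable lebesgue (\<lambda>z. indicator K z *\<^sub>R (Du z \<bullet> b))" if "b \<in> Basis" for b
    using u that K by (intro locally_integrable_indicator) (auto simp: weak_gradient_def weak_partial_def)
  then have "integrable lebesgue (\<lambda>z. \<Sum>b\<in>Basis. (indicator K z *\<^sub>R (Du z \<bullet> b)) *\<^sub>R b)"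
    by (intro Bochner_Integration.integrable_sum integrable_scaleR_left) auto
  moreover have "(\<Sum>b\<in>Basis. (indicator K z *\<^sub>R (Du z \<bullet> b)) *\<^sub>R b) = indicator K z *\<^sub>R Du z" for z
    by (simp add: scaleR_scaleR[symmetric] scaleR_sum_right[symmetric] euclidean_representation del: scaleR_scaleR)
  ultimately show ?thesis by simp
qed

lemma integrable_restrict_indicator:
  fixes f :: "'a::euclidean_space \<Rightarrow> 'b::euclidean_space"
  assumes D: "D \<in> sets lebesgue" and f: "integrable (lebesgue_on D) f" and K: "K \<in> sets lebesgue" "K \<subseteq> D"
  shows "integrable lebesgue (\<lambda>z. indicator K z *\<^sub>R f z)"
proof -
  have "integrable lebesgue (\<lambda>z. indicator D z *\<^sub>R f z)"
    using f D by (subst (asm) integrable_restrict_space) auto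
  from integrable_mult_indicator[OF K(1) this]
  have "integrable lebesgue (\<lambda>z. indicator K z *\<^sub>R (indicator D z *\<^sub>R f z))" .
  moreover have "(\<lambda>z. indicator K z *\<^sub>R (indicator D z *\<^sub>R f z)) = (\<lambda>z. indicator K z *\<^sub>R f z)"
    using K by (intro ext) (auto simp: indicator_def)
  ultimately show ?thesis by (simp only:)
qed

text \<open>Both \<open>F\<close> and its weak derivatives are cut off to \<open>K\<close>, which does not affect integrals over balls in \<open>K\<close>. The
  components of \<open>F\<close> are treated one by one.\<close>

lemma sobolev1_osc:
  fixes F :: "'a::euclidean_space \<Rightarrow> 'b::euclidean_space"
  assumes D: "D \<in> lmeasurable" "open D" and F: "F \<in> sobolev1 q D"
    and r: "1 \<le> r" "q \<noteq> \<infinity> \<Longrightarrow> r = enn2real q"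
    and s: "0 < s" "s < 1" "(1 - s) / 2 * r \<le> real DIM('a)" and R: "0 < R" "R \<le> 1"
    and K: "compact K" "K \<subseteq> D" and P: "P \<in> lmeasurable" "\<And>x. x \<in> P \<Longrightarrow> cball x (2 * R) \<subseteq> K"
    and P2: "P2 \<subseteq> P" "\<And>x. x \<in> P2 \<Longrightarrow> cball x R \<subseteq> P"
  shows "\<exists>G. osc (\<lambda>z. indicator K z *\<^sub>R F z) s r P2 R G"
proof -
  have Ds: "D \<in> sets lebesgue" using D by auto
  have Ks: "K \<in> sets lebesgue" using K by (simp add: lmeasurable_compact fmeasurableD)
  have r0: "0 < r" using r by simp
  have "\<forall>b\<in>Basis. \<exists>w. w \<in> Lq q (lebesgue_on D) \<and> weak_partial D b F w"
    using F by (auto simp: sobolev1_def)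
  then obtain w where w: "\<And>b. b \<in> Basis \<Longrightarrow> w b \<in> Lq q (lebesgue_on D)" "\<And>b. b \<in> Basis \<Longrightarrow> weak_partial D b F (w b)"
    by metis
  have FL: "F \<in> Lq q (lebesgue_on D)" using F by (simp add: sobolev1_def)
  have Fi: "integrable lebesgue (\<lambda>z. indicator K z *\<^sub>R F z)"
    by (rule integrable_restrict_indicator[OF Ds Lq_integrable[OF D(1) FL r] Ks K(2)])
  have "\<exists>G. osc (\<lambda>z. (indicator K z *\<^sub>R F z) \<bullet> e) s r P2 R G" if e: "e \<in> Basis" for e
  proof (rule weakly_differentiable_osc[where w = "\<lambda>b z. indicator K z * (w b z \<bullet> e)" and K = K, OF _ _ _ _ r(1) s R P P2])
    show "integrable lebesgue (\<lambda>z. (indicator K z *\<^sub>R F z) \<bullet> e)" by (rule integrable_inner_left[OF Fi])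
    have wi: "integrable lebesgue (\<lambda>z. indicator K z *\<^sub>R w b z)" if b: "b \<in> Basis" for b
      by (rule integrable_restrict_indicator[OF Ds Lq_integrable[OF D(1) w(1)[OF b] r] Ks K(2)])
    show wi': "integrable lebesgue (\<lambda>z. indicator K z * (w b z \<bullet> e))" if b: "b \<in> Basis" for b
      using integrable_inner_left[OF wi[OF b], of e] by simp
    show "integrable lebesgue (\<lambda>z. (\<Sum>b\<in>Basis. \<bar>indicator K z * (w b z \<bullet> e)\<bar>) powr r)"
    proof (rule Bochner_Integration.integrable_bound)
      have "integrable lebesgue (\<lambda>z. indicator K z *\<^sub>R (norm (w b z) powr r))" if b: "b \<in> Basis" for b
        by (rule integrable_restrict_indicator[OF Ds Lq_real_integrable(2)[OF D(1) w(1)[OF b] r0 r(2)] Ks K(2)])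
      then show "integrable lebesgue (\<lambda>z. real DIM('a) powr r * (\<Sum>b\<in>Basis. indicator K z *\<^sub>R (norm (w b z) powr r)))"
        by (intro integrable_mult_right Bochner_Integration.integrable_sum) auto
      have "(\<lambda>z. \<Sum>b\<in>Basis. \<bar>indicator K z * (w b z \<bullet> e)\<bar>) \<in> borel_measurable lebesgue"
        using wi' by (intro borel_measurable_sum borel_measurable_abs borel_measurable_integrable) auto
      then show "(\<lambda>z. (\<Sum>b\<in>Basis. \<bar>indicator K z * (w b z \<bullet> e)\<bar>) powr r) \<in> borel_measurable lebesgue"
        by measurable
      show "AE z in lebesgue. norm ((\<Sum>b\<in>Basis. \<bar>indicator K z * (w b z \<bullet> e)\<bar>) powr r)
        \<le> norm (real DIM('a) powr r * (\<Sum>b\<in>Basis. indicator K z *\<^sub>R (norm (w b z) powr r)))"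
      proof (rule AE_I2)
        fix z
        have "(\<Sum>b\<in>Basis. \<bar>indicator K z * (w b z \<bullet> e)\<bar>) powr r \<le> real DIM('a) powr r * (\<Sum>b\<in>Basis. \<bar>indicator K z * (w b z \<bullet> e)\<bar> powr r)"
          using r0 by (intro sum_powr_le) auto
        also have "\<dots> \<le> real DIM('a) powr r * (\<Sum>b\<in>Basis. indicator K z *\<^sub>R (norm (w b z) powr r))"
          using e r0 by (intro mult_left_mono sum_mono) (auto simp: indicator_def Basis_le_norm intro!: powr_mono2)
        finally show "norm ((\<Sum>b\<in>Basis. \<bar>indicator K z * (w b z \<bullet> e)\<bar>) powr r)
          \<le> norm (real DIM('a) powr r * (\<Sum>b\<in>Basis. indicator K z *\<^sub>R (norm (w b z) powr r)))"
          by (simp add: sum_nonneg)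
      qed
    qed
    fix x t assume t: "0 < t" and sub: "cball x t \<subseteq> K"
    obtain C where Cl: "lip_kernel C (lker :: 'a \<Rightarrow> real)" and Cp: "\<And>b. b \<in> Basis \<Longrightarrow> lip_kernel C (prof b :: 'a \<Rightarrow> real)"
      using ex_lip_kernel_const[where 'a = 'a] by blast
    have "cint (\<lambda>z. (indicator K z *\<^sub>R F z) \<bullet> e) lker t x = cint (\<lambda>z. F z \<bullet> e) lker t x"
      using sub by (intro cint_cong_ball[OF Cl t]) auto
    also have "\<dots> = - t * (\<Sum>b\<in>Basis. cint (\<lambda>z. w b z \<bullet> e) (prof b) t x)"
      using sub K by (intro weak_partials_lker[OF w(2) D(2) t]) auto
    also have "(\<Sum>b\<in>Basis. cint (\<lambda>z. w b z \<bullet> e) (prof b) t x) = (\<Sum>b\<in>Basis. cint (\<lambda>z. indicator K z * (w b z \<bullet> e)) (prof b) t x)"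
      using sub by (intro sum.cong refl cint_cong_ball[OF Cp t]) auto
    finally show "cint (\<lambda>z. (indicator K z *\<^sub>R F z) \<bullet> e) lker t x = - t * (\<Sum>b\<in>Basis. cint (\<lambda>z. indicator K z * (w b z \<bullet> e)) (prof b) t x)" .
  qed
  then obtain G where "\<And>e. e \<in> Basis \<Longrightarrow> osc (\<lambda>z. (indicator K z *\<^sub>R F z) \<bullet> e) s r P2 R (G e)"
    by metis
  from osc_components[OF Fi r(1) this] show ?thesis by blast
qed

section \<open>The regularity theorem\<close>

lemma L2_integrable:
  fixes f :: "'a::euclidean_space \<Rightarrow> 'b::euclidean_space"
  assumes "D \<in> lmeasurable" "f \<in> Lq 2 (lebesgue_on D)"
  shows "integrable (lebesgue_on D) f"
proof (rule Lq_integrable[OF assms, of 2])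
  have "enn2real 2 = 2" using enn2real_ennreal[of 2] by (simp only: ennreal_numeral)
  then show "2 = enn2real 2" by simp
qed simp

text \<open>The equation is restricted to a compact neighbourhood of \<open>D'\<close> in \<open>D\<close>, where \<open>Du\<close> and \<open>F\<close> are integrable,
  and the data are summarised in the single function \<open>G = Ga + GF\<close>. The neighbourhood of radius \<open>10R\<close> leaves
  room for the balls of radius \<open>2R\<close> around pinned points in the neighbourhood of radius \<open>4R\<close>.\<close>

lemma local_regularity:
  fixes D D' :: "'a::euclidean_space set" and a u Ga GF :: "'a \<Rightarrow> real" and F Du :: "'a \<Rightarrow> 'a"
  assumes D: "bounded D" "open D" and a: "a \<in> Lq \<infinity> (lebesgue_on D)"
    and lam: "0 < lam" "AE x in lebesgue_on D. lam \<le> a x"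
    and sol: "weak_solution D a F u Du"
    and D': "D' \<subseteq> D" and R: "0 < R" "R \<le> 1 / 2" and K: "nbhd D' (10 * R) \<subseteq> D"
    and s: "0 < s" "s < 1" "s \<le> \<alpha>" and r: "1 \<le> r" "real DIM('a) < s * r"
    and Ga: "integrable lebesgue Ga" "\<And>x. 0 \<le> Ga x"
    and aG: "AE x in lebesgue. x \<in> D \<longrightarrow> (AE y in lebesgue. y \<in> D \<longrightarrow> \<bar>a x - a y\<bar> \<le> Ga x powr (1 / r) * norm (x - y) powr \<alpha>)"
    and GF: "osc (\<lambda>z. indicator (nbhd D' (10 * R)) z *\<^sub>R F z) s r (nbhd D' (4 * R)) (2 * R) GF"
  shows "\<exists>G M N. integrable lebesgue G \<and> (\<forall>x. 0 \<le> G x) \<and> 0 \<le> M \<and> N \<in> null_sets lebesgue \<and>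
    (\<forall>x\<in>D' - N. norm (Du x) \<le> M) \<and>
    (\<forall>x\<in>D' - N. \<forall>y\<in>D' - N. norm (x - y) \<le> R / 2 \<longrightarrow>
      norm (Du x - Du y) \<le> M * norm (x - y) powr (s - real DIM('a) / r)) \<and>
    (\<forall>x\<in>D' - N. \<forall>y\<in>D' - N. norm (x - y) \<le> R / 2 \<longrightarrow>
      norm (Du x - Du y) \<le> M * (G x powr (1 / r) + G y powr (1 / r) + 1) * norm (x - y) powr s)"
proof -
  define K' where "K' = nbhd D' (10 * R)"
  have "bounded D'" using D D' by (meson bounded_subset)
  then have Kc: "compact K'" unfolding K'_def by (rule compact_nbhd)
  have KD: "K' \<subseteq> D" using K by (simp add: K'_def)
  have Ks: "K' \<in> sets lebesgue" using Kc by (simp add: lmeasurable_compact fmeasurableD)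
  have Ds: "D \<in> sets lebesgue" using D by simp
  have Dl: "D \<in> lmeasurable" using D by (simp add: lmeasurable_open)
  define Du1 where "Du1 z = indicator K' z *\<^sub>R Du z" for z
  define F1 where "F1 z = indicator K' z *\<^sub>R F z" for z
  have Du1: "integrable lebesgue Du1"
    unfolding Du1_def using sol by (intro weak_gradient_indicator_integrable[OF _ Kc KD]) (auto simp: weak_solution_def)
  have "F \<in> Lq 2 (lebesgue_on D)" using sol by (simp add: weak_solution_def)
  then have "integrable (lebesgue_on D) F" by (rule L2_integrable[OF Dl])
  from integrable_restrict_indicator[OF Ds this Ks KD] have F1: "integrable lebesgue F1" unfolding F1_def .
  have aDu1: "integrable lebesgue (\<lambda>z. a z *\<^sub>R Du1 z)"
  proof -
    obtain A where am: "a \<in> borel_measurable (lebesgue_on D)" and A: "AE x in lebesgue_on D. norm (a x) \<le> A"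
      using a by (auto simp: Lq_def)
    have am1: "(\<lambda>z. indicator D z *\<^sub>R a z) \<in> borel_measurable lebesgue"
      using am Ds by (subst (asm) borel_measurable_restrict_space_iff) auto
    have "integrable lebesgue (\<lambda>z. (indicator D z *\<^sub>R a z) *\<^sub>R Du1 z)"
    proof (rule Bochner_Integration.integrable_bound[OF integrable_scaleR_right[OF integrable_norm[OF Du1], of "\<bar>A\<bar>"]])
      show "(\<lambda>z. (indicator D z *\<^sub>R a z) *\<^sub>R Du1 z) \<in> borel_measurable lebesgue"
        by (rule borel_measurable_scaleR[OF am1 borel_measurable_integrable[OF Du1]])
      have "AE x in lebesgue. x \<in> D \<longrightarrow> norm (a x) \<le> A" using A by (simp add: AE_lebesgue_on_iff Ds)
      then show "AE z in lebesgue. norm ((indicator D z *\<^sub>R a z) *\<^sub>R Du1 z) \<le> norm (\<bar>A\<bar> *\<^sub>R norm (Du1 z))"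
      proof eventually_elim
        case z: (elim z)
        show ?case
        proof (cases "z \<in> D")
          case True
          then have "\<bar>a z\<bar> \<le> \<bar>A\<bar>" using z by simp
          then show ?thesis using True by (simp add: abs_mult mult_right_mono)
        qed simp
      qed
    qed
    moreover have "(\<lambda>z. (indicator D z *\<^sub>R a z) *\<^sub>R Du1 z) = (\<lambda>z. a z *\<^sub>R Du1 z)"
      using KD by (intro ext) (auto simp: Du1_def indicator_def)
    ultimately show ?thesis by (simp only:)
  qed
  obtain C where C: "lip_kernel C (ker :: 'a \<Rightarrow> real)" "lip_kernel C (lker :: 'a \<Rightarrow> real)"
    "\<And>i. i \<in> Basis \<Longrightarrow> lip_kernel C (gprof i :: 'a \<Rightarrow> 'a)"
    using ex_lip_kernel_const[where 'a = 'a] by blast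
  interpret E: frozen_equation K' a Du1 F1 lam C
  proof
    fix i x t c f assume i: "(i::'a) \<in> Basis" and t: "0 < t" and sub: "cball x t \<subseteq> K'"
    have si: "set_integrable lebesgue (cball x t) h" if "integrable lebesgue (\<lambda>z. indicator K' z *\<^sub>R h z)" for h :: "'a \<Rightarrow> 'a"
      using set_integrable_subset[OF _ _ sub, of lebesgue h] that by (simp add: set_integrable_def)
    have DuI: "set_integrable lebesgue (cball x t) Du" using Du1 by (intro si) (simp add: Du1_def[abs_def])
    have FI: "set_integrable lebesgue (cball x t) F" using F1 by (intro si) (simp add: F1_def[abs_def])
    have aI: "set_integrable lebesgue (cball x t) (\<lambda>z. a z *\<^sub>R Du z)"
    proof (rule si)
      have "(\<lambda>z. indicator K' z *\<^sub>R (a z *\<^sub>R Du z)) = (\<lambda>z. a z *\<^sub>R Du1 z)"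
        by (simp add: Du1_def mult.commute)
      then show "integrable lebesgue (\<lambda>z. indicator K' z *\<^sub>R (a z *\<^sub>R Du z))" using aDu1 by (simp only:)
    qed
    have "c * cint (\<lambda>z. Du z \<bullet> i) lker t x = - cint (\<lambda>z. (a z - c) *\<^sub>R Du z + (F z - f)) (gprof i) t x"
      using sub KD by (intro frozen_identity[OF sol D(2) t _ i DuI aI FI]) auto
    also have "cint (\<lambda>z. Du z \<bullet> i) lker t x = cint (\<lambda>z. Du1 z \<bullet> i) lker t x"
      using sub by (intro cint_cong_ball[OF C(2) t]) (auto simp: Du1_def)
    also have "cint (\<lambda>z. (a z - c) *\<^sub>R Du z + (F z - f)) (gprof i) t x
       = cint (\<lambda>z. (a z - c) *\<^sub>R Du1 z + (F1 z - f)) (gprof i) t x"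
      using sub by (intro cint_cong_ball[OF C(3)[OF i] t]) (auto simp: Du1_def F1_def)
    finally show "c * cint (\<lambda>z. Du1 z \<bullet> i) lker t x = - cint (\<lambda>z. (a z - c) *\<^sub>R Du1 z + (F1 z - f)) (gprof i) t x" .
  qed (use Du1 F1 aDu1 lam C in auto)
  define P where "P = nbhd D' (4 * R)"
  define G where "G x = Ga x + GF x" for x
  have oF: "integrable lebesgue GF" "\<And>x. 0 \<le> GF x" 
      "AE x in lebesgue. x \<in> P \<longrightarrow> ball_growth (\<lambda>z. norm (F1 z - F1 x)) (real DIM('a) + s) (GF x powr (1 / r)) (2 * R) x"
    using GF by (auto simp: osc_def F1_def P_def K'_def)
  have G: "integrable lebesgue G" "\<And>x. 0 \<le> G x"
    unfolding G_def using Ga oF by auto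
  have la: "AE x in lebesgue. x \<in> D \<longrightarrow> lam \<le> a x" using lam by (simp add: AE_lebesgue_on_iff Ds)
  have PK: "cball x (2 * R) \<subseteq> K'" if "x \<in> P" for x
    using that R unfolding P_def K'_def by (intro nbhd_cball_subset) auto
  have pin: "AE w in lebesgue. w \<in> P \<longrightarrow> E.pinned s (G w powr (1 / r)) (2 * R) w"
    using aG la oF(3)
  proof eventually_elim
    case (elim w)
    note h1 = elim(1) and h2 = elim(2) and h3 = elim(3)
    show ?case
    proof
      assume w: "w \<in> P"
      have "w \<in> cball w (2 * R)" using R by simp
      then have wD: "w \<in> D" using PK[OF w] KD by blast
      have g1: "Ga w powr (1 / r) \<le> G w powr (1 / r)" "GF w powr (1 / r) \<le> G w powr (1 / r)"
        using r Ga(2)[of w] oF(2)[of w] by (auto simp: G_def intro!: powr_mono2)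
      show "E.pinned s (G w powr (1 / r)) (2 * R) w"
        unfolding E.pinned_def
      proof (intro conjI allI impI)
        show "lam \<le> a w" using h2 wD by simp
        show "cball w (2 * R) \<subseteq> K'" by (rule PK[OF w])
        have "AE y in lebesgue. y \<in> D \<longrightarrow> \<bar>a w - a y\<bar> \<le> Ga w powr (1 / r) * norm (w - y) powr \<alpha>"
          using h1 wD by blast
        then show "AE z in lebesgue. z \<in> cball w (2 * R) \<longrightarrow> \<bar>a z - a w\<bar> \<le> G w powr (1 / r) * norm (z - w) powr s"
        proof eventually_elim
          case z: (elim z)
          show ?case
          proof
            assume zc: "z \<in> cball w (2 * R)"
            then have "z \<in> D" using PK[OF w] KD by blast
            then have "\<bar>a z - a w\<bar> \<le> Ga w powr (1 / r) * norm (z - w) powr \<alpha>"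
              using z by (simp add: abs_minus_commute norm_minus_commute)
            also have "\<dots> \<le> G w powr (1 / r) * norm (z - w) powr s"
              using zc R s g1 by (intro mult_mono powr_mono') (auto simp: dist_norm norm_minus_commute)
            finally show "\<bar>a z - a w\<bar> \<le> G w powr (1 / r) * norm (z - w) powr s" .
          qed
        qed
        show "ball_growth (\<lambda>z. norm (F1 z - F1 w)) (real DIM('a) + s) (G w powr (1 / r)) (2 * R) w"
          using h3 w g1(2) ball_growth_mono by blast
      qed simp
    qed
  qed
  have DP: "D' \<subseteq> P" "D' \<subseteq> K'"
    using R by (auto simp: P_def K'_def intro!: subsetD[OF subset_nbhd])
  have UP: "cball x (4 * R) \<subseteq> P" if "x \<in> D'" for x
  proof -
    have "x \<in> nbhd D' 0" using that subset_nbhd[of 0 D'] by auto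
    then show ?thesis unfolding P_def by (rule nbhd_cball_subset) simp
  qed
  have r0: "0 < r" using r by simp
  have R1: "R \<le> 1" using R by simp
  obtain M where M: "0 \<le> M" "\<forall>x\<in>D'. E.good_point x \<longrightarrow> norm (Du1 x) \<le> M"
    "\<forall>x\<in>D'. \<forall>y\<in>D'. E.good_point x \<longrightarrow> E.good_point y \<longrightarrow> norm (x - y) \<le> R / 2 \<longrightarrow>
      norm (Du1 x - Du1 y) \<le> M * norm (x - y) powr (s - real DIM('a) / r)"
    "\<forall>x\<in>D'. \<forall>y\<in>D'. E.good_point x \<longrightarrow> E.good_point y \<longrightarrow>
      E.pinned s (G x powr (1 / r)) (2 * R) x \<longrightarrow> E.pinned s (G y powr (1 / r)) (2 * R) y \<longrightarrow> norm (x - y) \<le> R / 2 \<longrightarrow>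
      norm (Du1 x - Du1 y) \<le> M * (G x powr (1 / r) + G y powr (1 / r) + 1) * norm (x - y) powr s"
    by (rule exE[OF E.pinned_regularity[where U = D', OF s(1,2) r0 r(2) R(1) R1 G pin UP]])
      (assumption, elim conjE, rule that, assumption+)
  have "AE x in lebesgue. E.good_point x \<and> (x \<in> P \<longrightarrow> E.pinned s (G x powr (1 / r)) (2 * R) x)"
    using E.AE_good_point pin by eventually_elim simp
  then obtain N where N: "\<And>x. x \<in> space lebesgue - N \<Longrightarrow> E.good_point x \<and> (x \<in> P \<longrightarrow> E.pinned s (G x powr (1 / r)) (2 * R) x)"
    "N \<in> null_sets lebesgue"
    by (rule AE_E3) blast
  have eq: "Du1 x = Du x" if "x \<in> D'" for x using that DP by (auto simp: Du1_def)
  show ?thesis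
  proof (intro exI[of _ G] exI[of _ M] exI[of _ N] conjI ballI impI allI G N(2) M(1))
    show "norm (Du x) \<le> M" if "x \<in> D' - N" for x
      using M(2) N(1)[of x] eq[of x] that by auto
    fix x y assume x: "x \<in> D' - N" and y: "y \<in> D' - N" and xy: "norm (x - y) \<le> R / 2"
    have gp: "x \<in> D'" "y \<in> D'" "E.good_point x" "E.good_point y"
      "E.pinned s (G x powr (1 / r)) (2 * R) x" "E.pinned s (G y powr (1 / r)) (2 * R) y"
      using x y N(1)[of x] N(1)[of y] DP by auto
    show "norm (Du x - Du y) \<le> M * norm (x - y) powr (s - real DIM('a) / r)"
      using M(3) gp xy eq by metis
    show "norm (Du x - Du y) \<le> M * (G x powr (1 / r) + G y powr (1 / r) + 1) * norm (x - y) powr s"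
      using M(4) gp xy eq by metis
  qed
qed

text \<open>For \<open>q < \<infinity>\<close> the integrability exponent is \<open>q\<close> itself; for \<open>q = \<infinity>\<close> it is a finite number so large that
  the loss \<open>d / r\<close> does not matter. The smoothness exponent is \<open>\<alpha>\<close> for \<open>\<alpha> < 1\<close>. For \<open>\<alpha> = 1\<close> it has to be smaller
  than \<open>1\<close>, because \<open>kernel_holder\<close> needs this, and close to \<open>1\<close>.\<close>

lemma admissible_exponents:
  fixes \<alpha> \<alpha>' d :: real and q :: ennreal
  assumes \<alpha>: "0 < \<alpha>" "\<alpha> \<le> 1" and \<alpha>': "0 \<le> \<alpha>'" "\<alpha>' < \<alpha>" and d: "1 \<le> d" and q: "2 \<le> q" "ennreal d < ennreal \<alpha> * q"
  shows "\<exists>r s. 1 \<le> r \<and> 0 < s \<and> s < 1 \<and> \<alpha>' < s \<and> s \<le> \<alpha> \<and> d < s * r \<and> (q \<noteq> \<infinity> \<longrightarrow> r = enn2real q) \<and>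
    (q = \<infinity> \<longrightarrow> \<alpha>' < s - d / r) \<and> (\<alpha> = 1 \<longrightarrow> (1 - s) / 2 * r \<le> d) \<and> (\<alpha> < 1 \<longrightarrow> s = \<alpha>)"
proof (cases "q = \<infinity>")
  case True
  show ?thesis
  proof (cases "\<alpha> = 1")
    case False
    \<comment> \<open>then \<open>d / r\<close> is half the gap between \<open>\<alpha>'\<close> and \<open>\<alpha>\<close>\<close>
    define r where "r = 2 * d / (\<alpha> - \<alpha>')"
    have gap: "0 < \<alpha> - \<alpha>'" "\<alpha> - \<alpha>' \<le> \<alpha>" "\<alpha> - \<alpha>' \<le> 1" using \<alpha> \<alpha>' by auto
    have "d / r = (\<alpha> - \<alpha>') / 2" using d gap by (simp add: r_def)
    then have "\<alpha>' < \<alpha> - d / r" using gap by (simp add: diff_divide_distrib)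
    moreover have r1: "1 \<le> r"
    proof -
      have "1 * (\<alpha> - \<alpha>') \<le> 2 * d" using gap d by simp
      then show ?thesis using gap by (simp add: r_def pos_le_divide_eq)
    qed
    moreover have "d < \<alpha> * r"
    proof -
      have "d * (\<alpha> - \<alpha>') \<le> d * \<alpha>" using gap d by (intro mult_left_mono) auto
      also have "\<dots> < 2 * d * \<alpha>" using d \<alpha> by simp
      finally show ?thesis using gap by (simp add: r_def field_simps)
    qed
    ultimately show ?thesis using True \<alpha> \<alpha>' False by (intro exI[of _ r] exI[of _ \<alpha>]) auto
  next
    case al: True
    define e where "e = 1 - \<alpha>'"
    have e: "0 < e" "e \<le> 1" using \<alpha>' al by (auto simp: e_def)
    \<comment> \<open>half the gap is spent on \<open>s < 1\<close>, a quarter on \<open>d / r\<close>\<close>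
    define r where "r = 4 * d / e"
    define s where "s = 1 - e / 2"
    have dr: "d / r = e / 4" using d e by (simp add: r_def)
    have "1 \<le> r" using d e by (simp add: r_def pos_le_divide_eq)
    moreover have "0 < s" "s < 1" "s \<le> 1" using e by (auto simp: s_def)
    moreover have "\<alpha>' < s" using e by (simp add: s_def e_def field_simps)
    moreover have "d < s * r"
    proof -
      have r4: "4 * d \<le> r" using d e by (simp add: r_def pos_le_divide_eq)
      have "1 / 2 * r \<le> s * r" using e d by (intro mult_right_mono) (auto simp: s_def r_def)
      then show ?thesis using r4 d by linarith
    qed
    moreover have "\<alpha>' < s - d / r" unfolding dr using e by (simp add: s_def e_def field_simps)
    moreover have "(1 - s) / 2 * r \<le> d" using d e by (simp add: s_def r_def)
    ultimately show ?thesis using True al by (intro exI[of _ r] exI[of _ s]) auto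
  qed
next
  case False
  define r where "r = enn2real q"
  have qr: "q = ennreal r" using False by (simp add: r_def less_top top.not_eq_extremum)
  have r2: "2 \<le> r"
  proof -
    have "ennreal 2 \<le> ennreal r" using q(1) qr by simp
    then show ?thesis by (subst (asm) ennreal_le_iff) (auto simp: r_def)
  qed
  have dr: "d < \<alpha> * r"
  proof -
    have "ennreal d < ennreal (\<alpha> * r)" using q(2) \<alpha> r2 by (simp add: qr ennreal_mult)
    then show ?thesis using d by (subst (asm) ennreal_less_iff) auto
  qed
  show ?thesis
  proof (cases "\<alpha> = 1")
    case al: False
    then show ?thesis using \<alpha> \<alpha>' dr r2 False by (intro exI[of _ r] exI[of _ \<alpha>]) (auto simp: r_def)
  next
    case al: True
    \<comment> \<open>the three bounds give \<open>\<alpha>' < s\<close>, \<open>d < s * r\<close> and the restriction of \<open>weakly_differentiable_osc\<close>\<close>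
    define e where "e = min ((1 - \<alpha>') / 2) (min ((r - d) / (2 * r)) (d / r))"
    have rd: "0 < r - d" "0 < d" "0 < r" using dr al d by auto
    have e: "0 < e" "e \<le> (1 - \<alpha>') / 2" "e \<le> (r - d) / (2 * r)" "e \<le> d / r"
    proof -
      show "0 < e" using \<alpha>' al rd by (simp add: e_def)
      show "e \<le> (1 - \<alpha>') / 2" "e \<le> (r - d) / (2 * r)" "e \<le> d / r"
        unfolding e_def by linarith+
    qed
    define s where "s = 1 - e"
    have "e * r \<le> (r - d) / 2" using e(3) rd by (simp add: field_simps)
    then have "d < s * r" using rd by (simp add: s_def left_diff_distrib)
    moreover have "e * r \<le> d" using e(4) rd by (simp add: field_simps)
    then have "(1 - s) / 2 * r \<le> d" using rd by (simp add: s_def)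
    moreover have "\<alpha>' < s" "0 < s" "s < 1" using e \<alpha>' al by (auto simp: s_def)
    ultimately show ?thesis using al False r2 by (intro exI[of _ r] exI[of _ s]) (auto simp: r_def)
  qed
qed

theorem corollary5p3:
  fixes \<Omega> \<Omega>' :: "'a::euclidean_space set"
    and a g u :: "'a \<Rightarrow> real"
    and F Du :: "'a \<Rightarrow> 'a"
    and a_low \<alpha> \<theta> :: real
    and q :: ennreal
  assumes "bounded \<Omega>" and "open \<Omega>"
    and "a \<in> Lq \<infinity> (lebesgue_on \<Omega>)"
    and "a_low > 0" and "AE x in lebesgue_on \<Omega>. a x \<ge> a_low"
    and "q \<ge> 2"
    and "0 < \<alpha>" and "\<alpha> \<le> 1" and "ennreal \<alpha> * q > of_nat DIM('a)"
    and "g \<in> Lq q (lebesgue_on \<Omega>)"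
    and "AE (x, y) in lebesgue_on \<Omega> \<Otimes>\<^sub>M lebesgue_on \<Omega>.
           \<bar>a x - a y\<bar> \<le> g x * norm (x - y) powr \<alpha>"
    and "u \<in> H1 \<Omega>" and "weak_solution \<Omega> a F u Du"
    and "\<Omega>' \<Subset> \<Omega>"
    and "\<theta> > 0" and "theta_smooth \<theta> \<Omega>'"
  shows "F \<in> W \<alpha> q \<Omega> \<longrightarrow> (\<forall>\<alpha>'. 0 \<le> \<alpha>' \<and> \<alpha>' < \<alpha> \<longrightarrow> Du \<in> W \<alpha>' q \<Omega>')"
proof (intro impI allI)
  fix \<alpha>' assume FW: "F \<in> W \<alpha> q \<Omega>" and \<alpha>': "0 \<le> \<alpha>' \<and> \<alpha>' < \<alpha>"
  note D = assms(1,2)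
  have Ds: "\<Omega> \<in> sets lebesgue" using D by simp
  have Dl: "\<Omega> \<in> lmeasurable" using D by (simp add: lmeasurable_open)
  have D': "\<Omega>' \<subseteq> \<Omega>" "open \<Omega>'" using assms(14) by (auto simp: compactly_inside_def)
  have D'b: "bounded \<Omega>'" using D D' by (meson bounded_subset)
  have D's: "\<Omega>' \<in> sets lebesgue" and D'l: "\<Omega>' \<in> lmeasurable" using D' D'b by (simp_all add: lmeasurable_open)
  obtain R where R: "0 < R" "R \<le> 1 / 2" and KD: "nbhd \<Omega>' (10 * R) \<subseteq> \<Omega>"
    using compactly_inside_neighbourhood[OF D(2) assms(14)] by blast
  define d where "d = real DIM('a)"
  have d1: "1 \<le> d" by (simp add: d_def Suc_leI)
  have qd: "ennreal d < ennreal \<alpha> * q" using assms(9) by (simp add: d_def ennreal_of_nat_eq_real_of_nat)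
  obtain r s where r: "1 \<le> r" "d < s * r" "q \<noteq> \<infinity> \<Longrightarrow> r = enn2real q" "q = \<infinity> \<Longrightarrow> \<alpha>' < s - d / r"
    and s: "0 < s" "s < 1" "\<alpha>' < s" "s \<le> \<alpha>" and s1: "\<alpha> = 1 \<Longrightarrow> (1 - s) / 2 * r \<le> d" "\<alpha> < 1 \<Longrightarrow> s = \<alpha>"
    using admissible_exponents[OF assms(7,8) _ _ d1 assms(6) qd, of \<alpha>'] \<alpha>' by blast
  have r0: "0 < r" using r by simp
  have dr: "real DIM('a) < s * r" using r by (simp add: d_def)
  define K where "K = nbhd \<Omega>' (10 * R)"
  define P where "P = nbhd \<Omega>' (4 * R)"
  have Kc: "compact K" unfolding K_def by (rule compact_nbhd[OF D'b])
  have Ks: "K \<in> sets lebesgue" using Kc by (simp add: lmeasurable_compact fmeasurableD)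
  have KO: "K \<subseteq> \<Omega>" using KD by (simp add: K_def)
  have Pl: "P \<in> lmeasurable" unfolding P_def by (intro lmeasurable_compact compact_nbhd[OF D'b])
  have PK: "cball x (2 * R) \<subseteq> K" if "x \<in> P" for x
    using that R unfolding P_def K_def by (intro nbhd_cball_subset) auto
  have gr: "integrable (lebesgue_on \<Omega>) (\<lambda>x. norm (g x) powr r)"
    by (rule Lq_real_integrable(2)[OF Dl assms(10) r0 r(3)])
  define Ga where "Ga x = indicator \<Omega> x *\<^sub>R (norm (g x) powr r)" for x
  have Ga: "integrable lebesgue Ga" "\<And>x. 0 \<le> Ga x"
    unfolding Ga_def using gr Ds by (subst (asm) integrable_restrict_space, auto)
  have aG: "AE x in lebesgue. x \<in> \<Omega> \<longrightarrow> (AE y in lebesgue. y \<in> \<Omega> \<longrightarrow> \<bar>a x - a y\<bar> \<le> Ga x powr (1 / r) * norm (x - y) powr \<alpha>)"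
    using AE_pair_lebesgue_on[OF Ds assms(11)]
  proof eventually_elim
    case h: (elim x)
    show ?case
    proof
      assume x: "x \<in> \<Omega>"
      have "g x \<le> Ga x powr (1 / r)" using x r0 by (simp add: Ga_def powr_powr)
      then have le: "g x * norm (x - y) powr \<alpha> \<le> Ga x powr (1 / r) * norm (x - y) powr \<alpha>" for y
        by (rule mult_right_mono) simp
      have "AE y in lebesgue. y \<in> \<Omega> \<longrightarrow> \<bar>a x - a y\<bar> \<le> g x * norm (x - y) powr \<alpha>" using h x by blast
      then show "AE y in lebesgue. y \<in> \<Omega> \<longrightarrow> \<bar>a x - a y\<bar> \<le> Ga x powr (1 / r) * norm (x - y) powr \<alpha>"
        by eventually_elim (use le order_trans in blast)
    qed
  qed
  define F1 where "F1 z = indicator K z *\<^sub>R F z" for z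
  have "F \<in> Lq 2 (lebesgue_on \<Omega>)" using assms(13) by (simp add: weak_solution_def)
  then have "integrable (lebesgue_on \<Omega>) F" by (rule L2_integrable[OF Dl])
  from integrable_restrict_indicator[OF Ds this Ks KO] have F1: "integrable lebesgue F1" unfolding F1_def .
  have F1K: "F1 z = F z" if "z \<in> K" for z using that by (simp add: F1_def)
  have R2: "0 < 2 * R" "2 * R \<le> 1" using R by auto
  have "\<exists>GF. osc F1 s r P (2 * R) GF"
  proof (cases "\<alpha> = 1")
    case True
    then have "F \<in> sobolev1 q \<Omega>" using FW by (simp add: W_def)
    moreover have "nbhd \<Omega>' (6 * R) \<in> lmeasurable" by (intro lmeasurable_compact compact_nbhd[OF D'b])
    moreover have "cball x (2 * (2 * R)) \<subseteq> K" if "x \<in> nbhd \<Omega>' (6 * R)" for x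
      using that R unfolding K_def by (intro nbhd_cball_subset) auto
    moreover have "P \<subseteq> nbhd \<Omega>' (6 * R)" unfolding P_def using R by (intro nbhd_mono) simp
    moreover have "cball x (2 * R) \<subseteq> nbhd \<Omega>' (6 * R)" if "x \<in> P" for x
      using that R unfolding P_def by (intro nbhd_cball_subset) auto
    moreover have "(1 - s) / 2 * r \<le> real DIM('a)" using s1 True by (simp add: d_def)
    ultimately show ?thesis
      unfolding F1_def using r s R2 Kc KO D(2) Dl by (intro sobolev1_osc[where D = \<Omega> and q = q and P = "nbhd \<Omega>' (6 * R)"]) auto
  next
    case False
    then have al: "\<alpha> < 1" "s = \<alpha>" using assms(8) s1 by auto
    have FS: "F \<in> sobolev_slobodeckij \<alpha> q \<Omega>" using FW False assms(7) by (simp add: W_def)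
    show ?thesis
    proof (cases "q = \<infinity>")
      case True
      then obtain c where "AE p in lebesgue_on \<Omega> \<Otimes>\<^sub>M lebesgue_on \<Omega>. norm (case p of (x, y) \<Rightarrow> norm (F x - F y) / norm (x - y) powr \<alpha>) \<le> c"
        using FS by (auto simp: sobolev_slobodeckij_def Lq_def)
      then have "AE (x, y) in lebesgue_on \<Omega> \<Otimes>\<^sub>M lebesgue_on \<Omega>. norm (F x - F y) \<le> max 0 c * norm (x - y) powr \<alpha>"
      proof eventually_elim
        fix p assume p: "norm (case p of (x, y) \<Rightarrow> norm (F x - F y) / norm (x - y) powr \<alpha>) \<le> c"
        obtain x y where xy: "p = (x, y)" by (cases p)
        have "norm (F x - F y) \<le> max 0 c * norm (x - y) powr \<alpha>"
        proof (cases "x = y")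
          case False
          then have pos: "0 < norm (x - y) powr \<alpha>" by simp
          have "norm (F x - F y) / norm (x - y) powr \<alpha> \<le> max 0 c" using p xy by (simp add: max_def)
          then show ?thesis using pos by (simp only: pos_divide_le_eq)
        qed simp
        then show "case p of (x, y) \<Rightarrow> norm (F x - F y) \<le> max 0 c * norm (x - y) powr \<alpha>" by (simp add: xy)
      qed
      from AE_pair_lebesgue_on[OF Ds this] show ?thesis
        unfolding al(2) using assms(7) r by (intro uniform_osc[OF F1 KO F1K _ _ _ _ Pl PK R2(1)]) auto
    next
      case False
      then have "integrable (lebesgue_on \<Omega> \<Otimes>\<^sub>M lebesgue_on \<Omega>)
        (\<lambda>p. norm (case p of (x, y) \<Rightarrow> norm (F x - F y) / norm (x - y) powr (\<alpha> + real DIM('a) / r)) powr r)"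
        using FS r(3)[OF False] by (simp add: sobolev_slobodeckij_def Lq_real_iff)
      then have "integrable (lebesgue_on \<Omega> \<Otimes>\<^sub>M lebesgue_on \<Omega>)
        (\<lambda>(x, y). (norm (F x - F y) / norm (x - y) powr (\<alpha> + real DIM('a) / r)) powr r)"
        by (simp add: case_prod_beta')
      then show ?thesis
        unfolding al(2) using assms(7) r by (intro slobodeckij_osc[OF Ds F1 KO F1K _ _ _ Pl PK R2(1)]) auto
    qed
  qed
  then obtain GF where GF: "osc F1 s r P (2 * R) GF" by blast
  from local_regularity[OF D assms(3,4,5,13) D'(1) R KD s(1,2,4) r(1) dr Ga aG GF[unfolded F1_def K_def P_def]]
  obtain G M N where G: "integrable lebesgue G" "\<forall>x. 0 \<le> G x" and M: "0 \<le> M" and N: "N \<in> null_sets lebesgue"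
    and b': "\<forall>x\<in>\<Omega>' - N. norm (Du x) \<le> M"
    and hol': "\<forall>x\<in>\<Omega>' - N. \<forall>y\<in>\<Omega>' - N. norm (x - y) \<le> R / 2 \<longrightarrow>
      norm (Du x - Du y) \<le> M * norm (x - y) powr (s - real DIM('a) / r)"
    and haj': "\<forall>x\<in>\<Omega>' - N. \<forall>y\<in>\<Omega>' - N. norm (x - y) \<le> R / 2 \<longrightarrow>
      norm (Du x - Du y) \<le> M * (G x powr (1 / r) + G y powr (1 / r) + 1) * norm (x - y) powr s"
    by (elim exE conjE) (rule that, assumption+)
  note b = bspec[OF b'] and hol = hol'[rule_format] and haj = haj'[rule_format] and G = G(1) G(2)[rule_format]
  have Dum: "Du \<in> borel_measurable (lebesgue_on \<Omega>')"
  proof -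
    have "integrable lebesgue (\<lambda>z. indicator K z *\<^sub>R Du z)"
      using assms(13) by (intro weak_gradient_indicator_integrable[OF _ Kc KO]) (auto simp: weak_solution_def)
    then have "(\<lambda>z. indicator K z *\<^sub>R Du z) \<in> borel_measurable (lebesgue_on \<Omega>')"
      by (intro measurable_restrict_space1) simp
    moreover have "\<Omega>' \<subseteq> K" unfolding K_def using R by (intro subset_nbhd) simp
    then have "indicator K z *\<^sub>R Du z = Du z" if "z \<in> space (lebesgue_on \<Omega>')" for z
      using that by (auto simp: space_restrict_space)
    ultimately show ?thesis using measurable_cong[of "lebesgue_on \<Omega>'"] by (metis (no_types, lifting))
  qed
  have ae: "AE x in lebesgue_on \<Omega>'. norm (Du x) \<le> M"
  proof -
    have "AE x in lebesgue. x \<notin> N" using N by (rule AE_not_in)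
    then have "AE x in lebesgue. x \<in> \<Omega>' \<longrightarrow> norm (Du x) \<le> M" by eventually_elim (use b in blast)
    then show ?thesis by (simp add: AE_lebesgue_on_iff D's)
  qed
  have Lq: "Du \<in> Lq q (lebesgue_on \<Omega>')"
  proof (cases "q = \<infinity>")
    case True
    then show ?thesis using Dum ae by (auto simp: Lq_def)
  next
    case False
    then show ?thesis
      using Dum bounded_powr_integrable[OF D'l Dum ae r0] r(3)[OF False] by (simp add: Lq_real_iff)
  qed
  show "Du \<in> W \<alpha>' q \<Omega>'"
  proof (cases "\<alpha>' = 0")
    case True
    then show ?thesis using Lq by (simp add: W_def)
  next
    case False
    then have p: "0 < \<alpha>'" "\<alpha>' \<noteq> 1" using \<alpha>' assms(8) by auto
    have R4: "0 < R / 2" "R / 2 \<le> 1" using R by auto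
    have "Du \<in> sobolev_slobodeckij \<alpha>' q \<Omega>'"
    proof (cases "q = \<infinity>")
      case True
      obtain C where "AE (x, y) in lebesgue_on \<Omega>' \<Otimes>\<^sub>M lebesgue_on \<Omega>'. norm (norm (Du x - Du y) / norm (x - y) powr \<alpha>') \<le> C"
        using holder_slobodeckij[OF D's Dum M R4 p(1) r(4)[OF True, unfolded d_def] N M b hol] by blast
      then show ?thesis
        using Lq True quotient_measurable[OF Dum, of \<alpha>']
        by (auto simp: sobolev_slobodeckij_def Lq_def case_prod_beta')
    next
      case False
      have "integrable (lebesgue_on \<Omega>' \<Otimes>\<^sub>M lebesgue_on \<Omega>')
        (\<lambda>(x, y). norm (norm (Du x - Du y) / norm (x - y) powr (\<alpha>' + real DIM('a) / r)) powr r)"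
        using hajlasz_slobodeckij[OF D'l Dum G M R4(1) r(1) p(1) s(3) N M b haj] .
      then show ?thesis
        using Lq False r(3)[OF False] quotient_measurable[OF Dum, of "\<alpha>' + real DIM('a) / r"]
        by (simp add: sobolev_slobodeckij_def Lq_real_iff case_prod_beta')
    qed
    then show ?thesis using p False by (simp add: W_def)
  qed
qed

end
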